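(* Let $m\in\mathbb{N}^*$, $a\in\mathbb{R}$, $I_f\in\mathbb{I}_{a+}$, let $f:\mathbb{R}^m\times I_f\to\mathbb{R}^m$ be a Carathéodory function, let $q_a\in\mathbb{R}^m$ and let $\alpha=(\alpha_1,\dots,\alpha_m)\in(0,1]^m$. Assume that: (i) $f(0,\cdot)\in \mathrm{L}^1_{\mathrm{loc}}(I_f,\mathbb{R}^m)$; (ii) for any $[c,d]\subset I_f$ there exists $L\ge 0$ such that $|f(x_2,t)-f(x_1,t)|_m\le L|x_2-x_1|_m$ for any $x_1,x_2\in\mathbb{R}^m$ and for almost every $t\in[c,d]$. Then the Cauchy problem $$\mathrm{D}^\alpha_{a+}[q](t)=f(q(t),t),\qquad \mathrm{I}^{1-\alpha}_{a+}[q](a)=q_a$$ has a unique (global) solution.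
   Context: $\mathbb{N}^*$ is the set of positive integers and $|\cdot|_m$ is the Euclidean norm of $\mathbb{R}^m$. For $a\in\mathbb{R}$, $\mathbb{I}_{a+}$ denotes the set of intervals $I\subset\mathbb{R}$ with $\{a\}\subsetneq I\subset[a,+\infty)$ (not necessarily compact). For a function space $\mathrm{E}$ ($\mathrm{L}^1$: integrable functions, $\mathrm{AC}$: absolutely continuous functions), $\mathrm{E}_{\mathrm{loc}}(I,\mathbb{R}^m)$ is the set of functions on $I$ belonging to $\mathrm{E}(J,\mathbb{R}^m)$ for every compact subinterval $J\subset I$. Left Riemann-Liouville operators. Let $I\in\mathbb{I}_{a+}$ and $q\in \mathrm{L}^1_{\mathrm{loc}}(I,\mathbb{R})$. For a real $\alpha>0$, $\mathrm{I}^\alpha_{a+}[q](t):=\int_a^t\frac{1}{\Gamma(\alpha)}(t-\tau)^{\alpha-1}q(\tau)\,d\tau$ (defined for a.e. $t\in I$), and $\mathrm{I}^0_{a+}[q]:=q$. If $\mathrm{I}^\alpha_{a+}[q]$ is a.e. equal to a continuous function on $I$, it is identified with its continuous representative. For $0\le\alpha\le1$, $\mathrm{AC}^\alpha_{a+}(I,\mathbb{R})$ is the set of $q\in \mathrm{L}^1_{\mathrm{loc}}(I,\mathbb{R})$ with $\mathrm{I}^{1-\alpha}_{a+}[q]\in\mathrm{AC}_{\mathrm{loc}}(I,\mathbb{R})$, and for such $q$, $\mathrm{D}^\alpha_{a+}[q]:=\frac{d}{dt}\mathrm{I}^{1-\alpha}_{a+}[q]$ a.e. on $I$. For vector functions $q=(q_i)$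 and a multi-order $\alpha=(\alpha_i)$, all these notions are taken componentwise, the $i$-th component with order $\alpha_i$. A (global) solution of the Cauchy problem is a function $q:I_f\to\mathbb{R}^m$ with $q\in\mathrm{AC}^\alpha_{a+}(I_f,\mathbb{R}^m)$, $\mathrm{I}^{1-\alpha}_{a+}[q](a)=q_a$, and $\mathrm{D}^\alpha_{a+}[q](t)=f(q(t),t)$ for almost every $t\in I_f$. Functions in $\mathrm{L}^1_{\mathrm{loc}}$ are identified when equal almost everywhere. *)

theory Defs
  imports "HOL-Analysis.Analysis"
begin

definition intervals_from :: "real \<Rightarrow> real set set" where
  "intervals_from a = {I. is_interval I \<and> {a} \<subset> I \<and> I \<subseteq> {a..}}"

definition L1_loc :: "real set \<Rightarrow> (real \<Rightarrow> 'b::euclidean_space) set" where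
  "L1_loc I = {q. \<forall>c d. c \<le> d \<and> {c..d} \<subseteq> I \<longrightarrow> q absolutely_integrable_on {c..d}}"

(* Absolute continuity of point functions; the constant absolutely_continuous of
   HOL-Analysis concerns measures. *)
definition AC_on :: "real set \<Rightarrow> (real \<Rightarrow> real) set" where
  "AC_on J = {g. \<forall>\<epsilon>>0. \<exists>\<delta>>0. \<forall>P :: (real \<times> real) set.
     finite P \<and> (\<forall>(u, v)\<in>P. u \<le> v \<and> {u..v} \<subseteq> J) \<and>
     disjoint_family_on (\<lambda>(u, v). {u<..<v}) P \<and>
     (\<Sum>(u, v)\<in>P. v - u) < \<delta>
     \<longrightarrow> (\<Sum>(u, v)\<in>P. \<bar>g v - g u\<bar>) < \<epsilon>}"

definition AC_loc :: "real set \<Rightarrow> (real \<Rightarrow> real) set" where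
  "AC_loc I = {g. \<forall>c d. c \<le> d \<and> {c..d} \<subseteq> I \<longrightarrow> g \<in> AC_on {c..d}}"

(* Pointwise left Riemann-Liouville integral. Where the integral does not exist
   (a null set of t, for locally integrable q) the value is the library default 0. *)
definition rl_integral_raw :: "real \<Rightarrow> real \<Rightarrow> (real \<Rightarrow> real) \<Rightarrow> real \<Rightarrow> real" where
  "rl_integral_raw a \<beta> q t =
     (if \<beta> = 0 then q t
      else LINT \<tau>:{a..t}|lebesgue. 1 / Gamma \<beta> * (t - \<tau>) powr (\<beta> - 1) * q \<tau>)"

definition is_continuous_rep :: "real set \<Rightarrow> (real \<Rightarrow> real) \<Rightarrow> (real \<Rightarrow> real) \<Rightarrow> bool" where
  "is_continuous_rep I h g \<longleftrightarrow> continuous_on I g \<and> (AE t in lebesgue_on I. g t = h t)"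

(* The integral of order \<beta>, replaced by its continuous representative on I when there
   is one (also for \<beta> = 0). On a nondegenerate interval I the representative is
   unique, so the choice only concerns values outside I. *)
definition rl_integral :: "real set \<Rightarrow> real \<Rightarrow> real \<Rightarrow> (real \<Rightarrow> real) \<Rightarrow> real \<Rightarrow> real" where
  "rl_integral I a \<beta> q =
     (if \<exists>g. is_continuous_rep I (rl_integral_raw a \<beta> q) g
      then SOME g. is_continuous_rep I (rl_integral_raw a \<beta> q) g
      else rl_integral_raw a \<beta> q)"

definition AC_frac :: "real set \<Rightarrow> real \<Rightarrow> real \<Rightarrow> (real \<Rightarrow> real) set" where
  "AC_frac I a \<alpha> = {q \<in> L1_loc I. rl_integral I a (1 - \<alpha>) q \<in> AC_loc I}"

(* The left Riemann-Liouville derivative of order \<alpha> of q exists at t and equals d. *)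
definition has_rl_derivative ::
  "real set \<Rightarrow> real \<Rightarrow> real \<Rightarrow> (real \<Rightarrow> real) \<Rightarrow> real \<Rightarrow> real \<Rightarrow> bool" where
  "has_rl_derivative I a \<alpha> q d t \<longleftrightarrow>
     (rl_integral I a (1 - \<alpha>) q has_real_derivative d) (at t within I)"

(* Lebesgue measurable in time, and continuous in the state for almost every time. *)
definition caratheodory :: "real set \<Rightarrow> (real ^ 'm \<Rightarrow> real \<Rightarrow> real ^ 'm) \<Rightarrow> bool" where
  "caratheodory I f \<longleftrightarrow>
     (\<forall>x. (\<lambda>t. f x t) \<in> borel_measurable (lebesgue_on I)) \<and>
     (AE t in lebesgue_on I. continuous_on UNIV (\<lambda>x. f x t))"

definition is_solution ::
  "real set \<Rightarrow> real \<Rightarrow> real ^ 'm \<Rightarrow> (real ^ 'm \<Rightarrow> real \<Rightarrow> real ^ 'm) \<Rightarrow> real ^ 'm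
     \<Rightarrow> (real \<Rightarrow> real ^ 'm) \<Rightarrow> bool" where
  "is_solution I a \<alpha> f qa q \<longleftrightarrow>
     (\<forall>i. (\<lambda>t. q t $ i) \<in> AC_frac I a (\<alpha> $ i)) \<and>
     (\<forall>i. rl_integral I a (1 - \<alpha> $ i) (\<lambda>t. q t $ i) a = qa $ i) \<and>
     (AE t in lebesgue_on I. \<forall>i.
        has_rl_derivative I a (\<alpha> $ i) (\<lambda>t. q t $ i) (f (q t) t $ i) t)"

end

theory Submission
  imports Defs
begin

text \<open>
  Write \<open>k\<close> for the Riemann-Liouville kernel. By the Beta integral the kernels form a
  convolution semigroup in the order, so applying the integral of order \<open>\<alpha>\<close>, respectively
  \<open>1 - \<alpha>\<close>, turns the Cauchy problem into the Volterra equation \<open>q = T q\<close>, where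
  \<open>T q\<close> has \<open>i\<close>-th component \<open>qa i * k (\<alpha> i) (t - a) + I^(\<alpha> i) [f(q, .)_i] (t)\<close>, and back; the
  derivatives are handled by the Lebesgue differentiation theorem and by the fundamental
  theorem of calculus for absolutely continuous functions. The Laplace transform of \<open>k \<alpha>\<close> at \<open>\<mu>\<close>
  is \<open>\<mu> powr - \<alpha>\<close>, which tends to 0, so on each compact interval \<open>T\<close> contracts the \<open>L\<^sup>1\<close>
  norm with weight \<open>exp (- \<mu> t)\<close> once \<open>\<mu>\<close> is large. The Picard iterates do not depend on the
  compact interval, so they converge almost everywhere on the whole of \<open>I\<close>.
\<close>

section \<open>Riemann-Liouville kernels\<close>

text \<open>For \<alpha> < 1 the homogeneous part
  \<open>qa $ i * rl_kernel (\<alpha> $ i) (t - a)\<close> is unbounded near \<open>a\<close> unless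
  \<open>qa $ i\<close> is 0. There the exponential weight is multiplicative along convolutions, so
  on nonnegative functions the Laplace transform of the kernel is the exact scaling factor;
  components of different orders just add their factors. Two obstacles shape the rest. A divergent
  Bochner integral has the value 0, so linearity and Fubini for signed functions must be preceded by
  finiteness of the convolution of absolute values: at total order at least 1 it is finite at every
  \<open>t\<close>, below 1 only almost everywhere. And the Lipschitz constant, hence \<mu>, depends
  on the compact interval, so a noncompact \<open>I\<close> carries no single norm in which
  \<open>T\<close> contracts. The kernel is extended by 0 to nonpositive arguments. Its support then
  carries the upper limit \<open>t\<close> of the integral, and causality (values at
  \<open>t\<close> depend only on the past) is a statement about supports.\<close>

definition rl_kernel :: "real \<Rightarrow> real \<Rightarrow> real" where
  "rl_kernel \<alpha> x = (if x > 0 then x powr (\<alpha> - 1) / Gamma \<alpha> else 0)"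

lemma rl_kernel_measurable [measurable]: "rl_kernel \<alpha> \<in> borel_measurable borel"
  unfolding rl_kernel_def by measurable

lemma rl_kernel_nonneg [simp]: "0 < \<alpha> \<Longrightarrow> 0 \<le> rl_kernel \<alpha> x"
  by (simp add: rl_kernel_def Gamma_real_pos less_imp_le)

lemma rl_kernel_nonpos [simp]: "x \<le> 0 \<Longrightarrow> rl_kernel \<alpha> x = 0"
  by (simp add: rl_kernel_def)

lemma rl_kernel_1: "0 < x \<Longrightarrow> rl_kernel 1 x = 1"
  by (simp add: rl_kernel_def)

text \<open>The open interval is what the product of two kernels leaves after rescaling. Since
  \<open>0 powr y = 0\<close>, the integrand vanishes at 0 and at 1 anyway, so passing to the closed
  interval changes no value.\<close>

lemma nn_integral_Beta:
  fixes p q :: real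
  assumes "0 < p" "0 < q"
  shows "(\<integral>\<^sup>+t. ennreal (indicator {0<..<1} t * ((1 - t) powr (p - 1) * t powr (q - 1))) \<partial>lborel)
    = ennreal (Beta p q)"
proof -
  have "(\<integral>\<^sup>+t. ennreal (indicator {0<..<1} t * ((1 - t) powr (p - 1) * t powr (q - 1))) \<partial>lborel)
    = (\<integral>\<^sup>+t. ennreal (indicator {0..1} t * (t powr (q - 1) * (1 - t) powr (p - 1))) \<partial>lborel)"
    by (intro nn_integral_cong) (auto simp: indicator_def)
  also have "\<dots> = ennreal (Beta q p)"
    using nn_integral_has_integral_lebesgue[OF _ has_integral_Beta_real[OF assms(2,1)]] by simp
  finally show ?thesis by (simp add: Beta_commute)
qed

text \<open>Scaling \<open>s\<close> by \<open>x\<close> pulls out the power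
  \<open>\<alpha> + \<beta> - 1\<close> of \<open>x\<close> and leaves a Beta integral, whose Gamma
  quotient cancels the normalising factors of the two kernels. The \<open>ennreal\<close> form can
  be fed directly into Tonelli.\<close>

lemma rl_kernel_conv_0:
  assumes "0 < \<alpha>" "0 < \<beta>"
  shows "(\<integral>\<^sup>+s. ennreal (rl_kernel \<alpha> (x - s)) * ennreal (rl_kernel \<beta> s) \<partial>lborel)
    = ennreal (rl_kernel (\<alpha> + \<beta>) x)"
proof (cases "x > 0")
  case False
  have "ennreal (rl_kernel \<alpha> (x - s)) * ennreal (rl_kernel \<beta> s) = 0" for s
    using False by (cases "s > 0") auto
  then have "(\<integral>\<^sup>+s. ennreal (rl_kernel \<alpha> (x - s)) * ennreal (rl_kernel \<beta> s) \<partial>lborel) = (\<integral>\<^sup>+s. 0 \<partial>(lborel :: real measure))"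
    by (simp only:)
  then show ?thesis using False by simp
next
  case True
  note G = Gamma_real_pos[OF assms(1)] Gamma_real_pos[OF assms(2)]
  have "(\<integral>\<^sup>+s. ennreal (rl_kernel \<alpha> (x - s)) * ennreal (rl_kernel \<beta> s) \<partial>lborel)
    = x * (\<integral>\<^sup>+s. ennreal (rl_kernel \<alpha> (x - (0 + x * s))) * ennreal (rl_kernel \<beta> (0 + x * s)) \<partial>lborel)"
    using nn_integral_real_affine[of "\<lambda>s. ennreal (rl_kernel \<alpha> (x - s)) * ennreal (rl_kernel \<beta> s)" x 0] True
    by simp
  also have "(\<integral>\<^sup>+s. ennreal (rl_kernel \<alpha> (x - (0 + x * s))) * ennreal (rl_kernel \<beta> (0 + x * s)) \<partial>lborel)
    = (\<integral>\<^sup>+s. ennreal (x powr (\<alpha> + \<beta> - 2) / (Gamma \<alpha> * Gamma \<beta>)) *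
        ennreal (indicator {0<..<1} s * ((1 - s) powr (\<alpha> - 1) * s powr (\<beta> - 1))) \<partial>lborel)"
  proof (rule nn_integral_cong)
    fix s :: real
    show "ennreal (rl_kernel \<alpha> (x - (0 + x * s))) * ennreal (rl_kernel \<beta> (0 + x * s))
      = ennreal (x powr (\<alpha> + \<beta> - 2) / (Gamma \<alpha> * Gamma \<beta>)) *
        ennreal (indicator {0<..<1} s * ((1 - s) powr (\<alpha> - 1) * s powr (\<beta> - 1)))"
    proof (cases "0 < s \<and> s < 1")
      case T: True
      have e: "x - x * s = x * (1 - s)" by (simp add: algebra_simps)
      have p: "x powr (\<alpha> - 1) * x powr (\<beta> - 1) = x powr (\<alpha> + \<beta> - 2)"
        by (simp add: powr_add[symmetric] algebra_simps)
      have k1: "rl_kernel \<alpha> (x - (0 + x * s)) = x powr (\<alpha> - 1) * (1 - s) powr (\<alpha> - 1) / Gamma \<alpha>"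
        using T True by (simp add: rl_kernel_def e powr_mult)
      have k2: "rl_kernel \<beta> (0 + x * s) = x powr (\<beta> - 1) * s powr (\<beta> - 1) / Gamma \<beta>"
        using T True by (simp add: rl_kernel_def powr_mult)
      show ?thesis
        using T True G assms unfolding k1 k2
        by (simp add: ennreal_mult[symmetric] p[symmetric] mult_ac)
    next
      \<comment> \<open>Outside (0, 1) one of the two kernels has a nonpositive argument.\<close>
      case F: False
      have "x * s \<le> 0 \<or> x - x * s \<le> 0"
        using F True by (auto simp: mult_le_0_iff not_less)
      then show ?thesis using F by auto
    qed
  qed
  also have "\<dots> = ennreal (x powr (\<alpha> + \<beta> - 2) / (Gamma \<alpha> * Gamma \<beta>)) * ennreal (Beta \<alpha> \<beta>)"
    using nn_integral_Beta[OF assms] by (simp add: nn_integral_cmult)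
  also have "ennreal x * \<dots> = ennreal (rl_kernel (\<alpha> + \<beta>) x)"
  proof -
    have p: "x * x powr (\<alpha> + \<beta> - 2) = x powr (\<alpha> + \<beta> - 1)"
      using True powr_add[of x 1 "\<alpha> + \<beta> - 2"] by (simp add: algebra_simps)
    have "Beta \<alpha> \<beta> = Gamma \<alpha> * Gamma \<beta> / Gamma (\<alpha> + \<beta>)"
      using assms by (simp add: Beta_def)
    then have "x * (x powr (\<alpha> + \<beta> - 2) / (Gamma \<alpha> * Gamma \<beta>) * Beta \<alpha> \<beta>) = rl_kernel (\<alpha> + \<beta>) x"
      using True G p by (simp add: rl_kernel_def field_simps)
    moreover have "0 \<le> Beta \<alpha> \<beta>"
      using assms G Gamma_real_pos[of "\<alpha> + \<beta>"] by (simp add: Beta_def)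
    ultimately show ?thesis using True G
      by (simp add: ennreal_mult[symmetric])
  qed
  finally show ?thesis .
qed

lemma rl_kernel_conv:
  assumes "0 < \<alpha>" "0 < \<beta>"
  shows "(\<integral>\<^sup>+s. ennreal (rl_kernel \<alpha> (t - s)) * ennreal (rl_kernel \<beta> (s - \<tau>)) \<partial>lborel)
    = ennreal (rl_kernel (\<alpha> + \<beta>) (t - \<tau>))"
  using nn_integral_real_affine[of "\<lambda>s. ennreal (rl_kernel \<alpha> (t - s)) * ennreal (rl_kernel \<beta> (s - \<tau>))" 1 \<tau>]
    rl_kernel_conv_0[OF assms, of "t - \<tau>"]
  by (simp add: algebra_simps)

text \<open>Substituting \<open>x / \<mu>\<close> for \<open>x\<close> gives Euler's integral for
  Gamma.\<close>

lemma rl_kernel_Laplace: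
  assumes "0 < \<alpha>" "0 < \<mu>"
  shows "(\<integral>\<^sup>+x. ennreal (exp (- \<mu> * x)) * ennreal (rl_kernel \<alpha> x) \<partial>lborel) = ennreal (\<mu> powr - \<alpha>)"
proof -
  note G = Gamma_real_pos[OF assms(1)]
  have "(\<integral>\<^sup>+x. ennreal (exp (- \<mu> * x)) * ennreal (rl_kernel \<alpha> x) \<partial>lborel)
    = ennreal (1 / \<mu>) * (\<integral>\<^sup>+x. ennreal (exp (- \<mu> * (0 + 1 / \<mu> * x))) * ennreal (rl_kernel \<alpha> (0 + 1 / \<mu> * x)) \<partial>lborel)"
    using nn_integral_real_affine[of "\<lambda>x. ennreal (exp (- \<mu> * x)) * ennreal (rl_kernel \<alpha> x)" "1 / \<mu>" 0] assms
    by simp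
  also have "(\<integral>\<^sup>+x. ennreal (exp (- \<mu> * (0 + 1 / \<mu> * x))) * ennreal (rl_kernel \<alpha> (0 + 1 / \<mu> * x)) \<partial>lborel)
    = (\<integral>\<^sup>+x. ennreal (\<mu> powr (1 - \<alpha>) / Gamma \<alpha>) * ennreal (indicator {0..} x * x powr (\<alpha> - 1) / exp x) \<partial>lborel)"
  proof (rule nn_integral_cong)
    fix x :: real
    show "ennreal (exp (- \<mu> * (0 + 1 / \<mu> * x))) * ennreal (rl_kernel \<alpha> (0 + 1 / \<mu> * x))
      = ennreal (\<mu> powr (1 - \<alpha>) / Gamma \<alpha>) * ennreal (indicator {0..} x * x powr (\<alpha> - 1) / exp x)"
    proof (cases "x > 0")
      case True
      have "(x / \<mu>) powr (\<alpha> - 1) = x powr (\<alpha> - 1) * \<mu> powr (1 - \<alpha>)"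
        using True assms powr_minus_divide[of \<mu> "\<alpha> - 1"] by (simp add: powr_divide)
      then show ?thesis
        using True assms G
        by (simp add: rl_kernel_def ennreal_mult[symmetric] exp_minus field_simps)
    next
      case False
      then show ?thesis using assms by (cases "x = 0") (auto simp: rl_kernel_def divide_less_0_iff zero_less_divide_iff)
    qed
  qed
  also have "\<dots> = ennreal (\<mu> powr (1 - \<alpha>) / Gamma \<alpha>) * ennreal (Gamma \<alpha>)"
    by (simp add: nn_integral_cmult Gamma_conv_nn_integral_real[OF assms(1)])
  also have "ennreal (1 / \<mu>) * \<dots> = ennreal (\<mu> powr - \<alpha>)"
  proof -
    have "\<mu> powr (1 - \<alpha>) / Gamma \<alpha> * Gamma \<alpha> = \<mu> powr (1 - \<alpha>)"
      using G by (metis less_irrefl nonzero_eq_divide_eq)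
    moreover have "1 / \<mu> * \<mu> powr (1 - \<alpha>) = \<mu> powr - \<alpha>"
      using assms powr_add[of \<mu> 1 "- \<alpha>"] by simp
    ultimately have "1 / \<mu> * (\<mu> powr (1 - \<alpha>) / Gamma \<alpha> * Gamma \<alpha>) = \<mu> powr - \<alpha>"
      by metis
    moreover have "0 \<le> \<mu> powr (1 - \<alpha>) / Gamma \<alpha>" "0 \<le> 1 / \<mu>" "0 \<le> Gamma \<alpha>"
      using assms G by auto
    ultimately show ?thesis by (simp only: ennreal_mult[symmetric] mult_nonneg_nonneg)
  qed
  finally show ?thesis .
qed

section \<open>Convolution with the kernels\<close>

text \<open>Unlike the real convolution, whose junk value is 0, this one detects divergence.\<close>

definition nconv :: "real \<Rightarrow> (real \<Rightarrow> ennreal) \<Rightarrow> real \<Rightarrow> ennreal" where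
  "nconv \<alpha> \<phi> t = (\<integral>\<^sup>+\<tau>. ennreal (rl_kernel \<alpha> (t - \<tau>)) * \<phi> \<tau> \<partial>lebesgue)"

definition rconv :: "real \<Rightarrow> (real \<Rightarrow> real) \<Rightarrow> real \<Rightarrow> real" where
  "rconv \<alpha> q t = (LINT \<tau>|lebesgue. rl_kernel \<alpha> (t - \<tau>) * q \<tau>)"

text \<open>Causality: the kernel vanishes at nonpositive arguments, so the value at
  \<open>t\<close> depends only on the past of \<open>t\<close>, and there only up to null
  sets.\<close>

lemma nconv_cong_AE:
  assumes "AE \<tau> in lebesgue. \<tau> < t \<longrightarrow> \<phi> \<tau> = \<psi> \<tau>"
  shows "nconv \<alpha> \<phi> t = nconv \<alpha> \<psi> t"
  unfolding nconv_def
proof (rule nn_integral_cong_AE)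
  show "AE \<tau> in lebesgue. ennreal (rl_kernel \<alpha> (t - \<tau>)) * \<phi> \<tau> = ennreal (rl_kernel \<alpha> (t - \<tau>)) * \<psi> \<tau>"
    using assms
  proof eventually_elim
    case (elim \<tau>)
    then show ?case by (cases "\<tau> < t") auto
  qed
qed

lemma nconv_mono_AE:
  assumes "AE \<tau> in lebesgue. \<tau> < t \<longrightarrow> \<phi> \<tau> \<le> \<psi> \<tau>"
  shows "nconv \<alpha> \<phi> t \<le> nconv \<alpha> \<psi> t"
  unfolding nconv_def
proof (rule nn_integral_mono_AE)
  show "AE \<tau> in lebesgue. ennreal (rl_kernel \<alpha> (t - \<tau>)) * \<phi> \<tau> \<le> ennreal (rl_kernel \<alpha> (t - \<tau>)) * \<psi> \<tau>"
    using assms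
  proof eventually_elim
    case (elim \<tau>)
    then show ?case by (cases "\<tau> < t") (auto intro: mult_left_mono)
  qed
qed

section \<open>Measurability, integrability and linearity of the convolutions\<close>

lemma borel_imp_lebesgue:
  "f \<in> borel_measurable borel \<Longrightarrow> f \<in> borel_measurable lebesgue"
  by (rule measurable_completion) simp

lemma rl_kernel_lebesgue [measurable]:
  "(\<lambda>\<tau>. rl_kernel \<alpha> (t - \<tau>)) \<in> borel_measurable lebesgue"
  by (rule measurable_completion) simp

lemma rconv_cong_AE:
  assumes [measurable]: "p \<in> borel_measurable lebesgue" "q \<in> borel_measurable lebesgue"
    and "AE \<tau> in lebesgue. \<tau> < t \<longrightarrow> p \<tau> = q \<tau>"
  shows "rconv \<alpha> p t = rconv \<alpha> q t"
  unfolding rconv_def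
proof (rule integral_cong_AE)
  show "AE \<tau> in lebesgue. rl_kernel \<alpha> (t - \<tau>) * p \<tau> = rl_kernel \<alpha> (t - \<tau>) * q \<tau>"
    using assms(3)
  proof eventually_elim
    case (elim \<tau>)
    then show ?case by (cases "\<tau> < t") auto
  qed
qed measurable

text \<open>Exchanging integrals requires joint measurability in both times, which is at hand for
  Borel functions and \<open>lborel\<close>. Results on convolutions are therefore proved for Borel
  functions and moved to Lebesgue measurable ones through this representative.\<close>

lemma borel_representative:
  fixes q :: "real \<Rightarrow> real"
  assumes "q \<in> borel_measurable lebesgue"
  obtains p where "p \<in> borel_measurable borel" "AE t in lebesgue. q t = p t"
  using completion_ex_borel_measurable_real[OF assms] AE_completion that by auto

text \<open>A convolution does not see null sets, so at every \<open>t\<close>, not just almost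
  everywhere, it equals the convolution of the Borel representative, which is a parametrised
  integral over \<open>lborel\<close>.\<close>

lemma rconv_measurable [measurable]:
  assumes "q \<in> borel_measurable lebesgue"
  shows "rconv \<alpha> q \<in> borel_measurable borel"
proof -
  obtain p where p [measurable]: "p \<in> borel_measurable borel" and e: "AE t in lebesgue. q t = p t"
    using borel_representative[OF assms] .
  have "rconv \<alpha> q = (\<lambda>t. LINT \<tau>|lborel. rl_kernel \<alpha> (t - \<tau>) * p \<tau>)"
  proof
    fix t
    have "rconv \<alpha> q t = rconv \<alpha> p t"
      by (rule rconv_cong_AE) (use assms e borel_imp_lebesgue[OF p] in auto)
    also have "\<dots> = (LINT \<tau>|lborel. rl_kernel \<alpha> (t - \<tau>) * p \<tau>)"
      unfolding rconv_def by (rule integral_completion) simp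
    finally show "rconv \<alpha> q t = (LINT \<tau>|lborel. rl_kernel \<alpha> (t - \<tau>) * p \<tau>)" .
  qed
  then show ?thesis by simp
qed

text \<open>If the real integral diverges, its default value 0 makes the left side 0, so the bound
  holds in every case.\<close>

lemma norm_rconv_le:
  assumes "0 < \<alpha>"
  shows "ennreal \<bar>rconv \<alpha> q t\<bar> \<le> nconv \<alpha> (\<lambda>\<tau>. ennreal \<bar>q \<tau>\<bar>) t"
proof -
  have "ennreal \<bar>rconv \<alpha> q t\<bar> \<le> (\<integral>\<^sup>+\<tau>. ennreal (norm (rl_kernel \<alpha> (t - \<tau>) * q \<tau>)) \<partial>lebesgue)"
    unfolding rconv_def
  proof (cases "integrable lebesgue (\<lambda>\<tau>. rl_kernel \<alpha> (t - \<tau>) * q \<tau>)")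
    case True
    then show "ennreal \<bar>LINT \<tau>|lebesgue. rl_kernel \<alpha> (t - \<tau>) * q \<tau>\<bar> \<le> (\<integral>\<^sup>+\<tau>. ennreal (norm (rl_kernel \<alpha> (t - \<tau>) * q \<tau>)) \<partial>lebesgue)"
      using integral_norm_bound_ennreal[OF True] by simp
  qed (simp add: not_integrable_integral_eq)
  also have "\<dots> = nconv \<alpha> (\<lambda>\<tau>. ennreal \<bar>q \<tau>\<bar>) t"
    unfolding nconv_def using assms by (simp add: abs_mult ennreal_mult)
  finally show ?thesis .
qed

lemma rconv_integrable:
  assumes "0 < \<alpha>" and [measurable]: "q \<in> borel_measurable lebesgue"
    and "nconv \<alpha> (\<lambda>\<tau>. ennreal \<bar>q \<tau>\<bar>) t < \<infinity>"
  shows "integrable lebesgue (\<lambda>\<tau>. rl_kernel \<alpha> (t - \<tau>) * q \<tau>)"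
proof (rule integrableI_bounded)
  show "(\<integral>\<^sup>+\<tau>. ennreal (norm (rl_kernel \<alpha> (t - \<tau>) * q \<tau>)) \<partial>lebesgue) < \<infinity>"
    using assms(3) unfolding nconv_def using assms(1) by (simp add: abs_mult ennreal_mult)
qed measurable

text \<open>Finiteness at the point \<open>t\<close> rules out the default value 0. The shape with a
  single factor \<open>u\<close> fits both uses: a multiple of a kernel plus a convolution, and a
  difference with \<open>u = - 1\<close>.\<close>

lemma rconv_linear:
  assumes "0 < \<alpha>" and [measurable]: "p \<in> borel_measurable lebesgue" "q \<in> borel_measurable lebesgue"
    and "nconv \<alpha> (\<lambda>\<tau>. ennreal \<bar>p \<tau>\<bar>) t < \<infinity>" "nconv \<alpha> (\<lambda>\<tau>. ennreal \<bar>q \<tau>\<bar>) t < \<infinity>"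
  shows "rconv \<alpha> (\<lambda>\<tau>. u * p \<tau> + q \<tau>) t = u * rconv \<alpha> p t + rconv \<alpha> q t"
proof -
  have "rconv \<alpha> (\<lambda>\<tau>. u * p \<tau> + q \<tau>) t
    = (LINT \<tau>|lebesgue. u * (rl_kernel \<alpha> (t - \<tau>) * p \<tau>) + rl_kernel \<alpha> (t - \<tau>) * q \<tau>)"
    unfolding rconv_def by (simp add: algebra_simps)
  also have "\<dots> = u * rconv \<alpha> p t + rconv \<alpha> q t"
    unfolding rconv_def using assms
    by (subst Bochner_Integration.integral_add) (auto intro!: rconv_integrable)
  finally show ?thesis .
qed

text \<open>Tonelli and the semigroup law; infinite values are included, so the identity also serves
  to certify the absolute integrability behind the signed version.\<close>

lemma nconv_nconv:
  assumes "0 < \<alpha>" "0 < \<beta>" and [measurable]: "\<phi> \<in> borel_measurable borel"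
  shows "nconv \<alpha> (nconv \<beta> \<phi>) t = nconv (\<alpha> + \<beta>) \<phi> t"
proof -
  have "nconv \<alpha> (nconv \<beta> \<phi>) t
    = (\<integral>\<^sup>+s. \<integral>\<^sup>+\<tau>. ennreal (rl_kernel \<alpha> (t - s)) * (ennreal (rl_kernel \<beta> (s - \<tau>)) * \<phi> \<tau>) \<partial>lborel \<partial>lborel)"
    unfolding nconv_def nn_integral_completion by (simp add: nn_integral_cmult)
  also have "\<dots> = (\<integral>\<^sup>+\<tau>. \<integral>\<^sup>+s. ennreal (rl_kernel \<alpha> (t - s)) * (ennreal (rl_kernel \<beta> (s - \<tau>)) * \<phi> \<tau>) \<partial>lborel \<partial>lborel)"
    by (rule lborel_pair.Fubini') measurable
  also have "\<dots> = (\<integral>\<^sup>+\<tau>. (\<integral>\<^sup>+s. ennreal (rl_kernel \<alpha> (t - s)) * ennreal (rl_kernel \<beta> (s - \<tau>)) \<partial>lborel) * \<phi> \<tau> \<partial>lborel)"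
    by (simp add: nn_integral_multc mult.assoc[symmetric])
  also have "\<dots> = nconv (\<alpha> + \<beta>) \<phi> t"
    by (simp only: rl_kernel_conv[OF assms(1,2)] nconv_def nn_integral_completion)
  finally show ?thesis .
qed

text \<open>The weight splits as exp(-\<mu>(t - \<tau>)) times exp(-\<mu> \<tau>). After exchanging
  the integrals and shifting \<open>t\<close> by \<tau>, the first factor integrates against the
  kernel to its Laplace transform and the second stays with \<phi>.\<close>

lemma nconv_weighted:
  assumes "0 < \<alpha>" "0 < \<mu>" and [measurable]: "\<phi> \<in> borel_measurable borel"
  shows "(\<integral>\<^sup>+t. ennreal (exp (- \<mu> * t)) * nconv \<alpha> \<phi> t \<partial>lborel)
    = ennreal (\<mu> powr - \<alpha>) * (\<integral>\<^sup>+t. ennreal (exp (- \<mu> * t)) * \<phi> t \<partial>lborel)"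
proof -
  have "(\<integral>\<^sup>+t. ennreal (exp (- \<mu> * t)) * nconv \<alpha> \<phi> t \<partial>lborel)
    = (\<integral>\<^sup>+t. \<integral>\<^sup>+\<tau>. ennreal (exp (- \<mu> * t)) * (ennreal (rl_kernel \<alpha> (t - \<tau>)) * \<phi> \<tau>) \<partial>lborel \<partial>lborel)"
    unfolding nconv_def nn_integral_completion by (simp add: nn_integral_cmult)
  also have "\<dots> = (\<integral>\<^sup>+\<tau>. \<integral>\<^sup>+t. ennreal (exp (- \<mu> * t)) * (ennreal (rl_kernel \<alpha> (t - \<tau>)) * \<phi> \<tau>) \<partial>lborel \<partial>lborel)"
    by (rule lborel_pair.Fubini') measurable
  also have "\<dots> = (\<integral>\<^sup>+\<tau>. ennreal (\<mu> powr - \<alpha>) * (ennreal (exp (- \<mu> * \<tau>)) * \<phi> \<tau>) \<partial>lborel)"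
  proof (rule nn_integral_cong)
    fix \<tau> :: real
    have "(\<integral>\<^sup>+t. ennreal (exp (- \<mu> * t)) * (ennreal (rl_kernel \<alpha> (t - \<tau>)) * \<phi> \<tau>) \<partial>lborel)
      = (\<integral>\<^sup>+x. ennreal (exp (- \<mu> * (\<tau> + 1 * x))) * (ennreal (rl_kernel \<alpha> ((\<tau> + 1 * x) - \<tau>)) * \<phi> \<tau>) \<partial>lborel)"
      using nn_integral_real_affine[of "\<lambda>t. ennreal (exp (- \<mu> * t)) * (ennreal (rl_kernel \<alpha> (t - \<tau>)) * \<phi> \<tau>)" 1 \<tau>]
      by simp
    also have "\<dots> = (\<integral>\<^sup>+x. (ennreal (exp (- \<mu> * x)) * ennreal (rl_kernel \<alpha> x)) * (ennreal (exp (- \<mu> * \<tau>)) * \<phi> \<tau>) \<partial>lborel)"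
      by (rule nn_integral_cong)
         (simp add: distrib_left exp_add[symmetric] ennreal_mult mult_ac exp_diff exp_minus divide_inverse)
    also have "\<dots> = ennreal (\<mu> powr - \<alpha>) * (ennreal (exp (- \<mu> * \<tau>)) * \<phi> \<tau>)"
      using rl_kernel_Laplace[OF assms(1,2)] by (subst nn_integral_multc) auto
    finally show "(\<integral>\<^sup>+t. ennreal (exp (- \<mu> * t)) * (ennreal (rl_kernel \<alpha> (t - \<tau>)) * \<phi> \<tau>) \<partial>lborel)
      = ennreal (\<mu> powr - \<alpha>) * (ennreal (exp (- \<mu> * \<tau>)) * \<phi> \<tau>)" .
  qed
  also have "\<dots> = ennreal (\<mu> powr - \<alpha>) * (\<integral>\<^sup>+t. ennreal (exp (- \<mu> * t)) * \<phi> t \<partial>lborel)"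
    by (simp add: nn_integral_cmult)
  finally show ?thesis .
qed

text \<open>Fubini. Its integrability condition is the double integral of the absolute values, which
  \<open>nconv_nconv\<close> turns into the single convolution of order
  \<open>\<alpha> + \<beta>\<close>; finiteness of that one number at \<open>t\<close> is
  enough.\<close>

lemma rconv_rconv_borel:
  assumes "0 < \<alpha>" "0 < \<beta>" and [measurable]: "q \<in> borel_measurable borel"
    and "nconv (\<alpha> + \<beta>) (\<lambda>\<tau>. ennreal \<bar>q \<tau>\<bar>) t < \<infinity>"
  shows "rconv \<alpha> (rconv \<beta> q) t = rconv (\<alpha> + \<beta>) q t"
proof -
  let ?g = "\<lambda>(s, \<tau>). rl_kernel \<alpha> (t - s) * (rl_kernel \<beta> (s - \<tau>) * q \<tau>)"
  have eqN: "(\<integral>\<^sup>+s. \<integral>\<^sup>+\<tau>. ennreal (norm (?g (s, \<tau>))) \<partial>lborel \<partial>lborel)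
    = nconv \<alpha> (nconv \<beta> (\<lambda>\<tau>. ennreal \<bar>q \<tau>\<bar>)) t"
    unfolding nconv_def nn_integral_completion using assms(1,2)
    by (simp add: nn_integral_cmult abs_mult ennreal_mult)
  have "integrable (lborel \<Otimes>\<^sub>M lborel) ?g"
  proof (rule integrableI_bounded)
    have m: "(\<lambda>z. ennreal (norm (?g z))) \<in> borel_measurable (lborel \<Otimes>\<^sub>M lborel)"
      by measurable
    show "(\<integral>\<^sup>+z. ennreal (norm (?g z)) \<partial>(lborel \<Otimes>\<^sub>M lborel)) < \<infinity>"
      using eqN nconv_nconv[OF assms(1,2), of "\<lambda>\<tau>. ennreal \<bar>q \<tau>\<bar>" t] assms(4)
      unfolding lborel.nn_integral_fst[OF m, symmetric] by simp
  qed measurable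
  then have "(LINT \<tau>|lborel. LINT s|lborel. ?g (s, \<tau>)) = (LINT s|lborel. LINT \<tau>|lborel. ?g (s, \<tau>))"
    by (intro lborel_pair.Fubini_integral) simp
  moreover have "(LINT s|lborel. LINT \<tau>|lborel. ?g (s, \<tau>)) = rconv \<alpha> (rconv \<beta> q) t"
    unfolding rconv_def by (simp add: integral_completion)
  moreover have "(LINT \<tau>|lborel. LINT s|lborel. ?g (s, \<tau>)) = rconv (\<alpha> + \<beta>) q t"
  proof -
    have "(LINT s|lborel. rl_kernel \<alpha> (t - s) * rl_kernel \<beta> (s - \<tau>)) = rl_kernel (\<alpha> + \<beta>) (t - \<tau>)" for \<tau>
      using rl_kernel_conv[OF assms(1,2), of t \<tau>] assms(1,2)
      by (intro integral_eq_nn_integral[THEN trans]) (auto simp: ennreal_mult)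
    then show ?thesis
      unfolding rconv_def by (simp add: integral_completion mult.assoc[symmetric])
  qed
  ultimately show ?thesis by simp
qed

lemma rconv_rconv:
  assumes "0 < \<alpha>" "0 < \<beta>" and q: "q \<in> borel_measurable lebesgue"
    and "nconv (\<alpha> + \<beta>) (\<lambda>\<tau>. ennreal \<bar>q \<tau>\<bar>) t < \<infinity>"
  shows "rconv \<alpha> (rconv \<beta> q) t = rconv (\<alpha> + \<beta>) q t"
proof -
  obtain p where p [measurable]: "p \<in> borel_measurable borel" and e: "AE t in lebesgue. q t = p t"
    using borel_representative[OF q] .
  have *: "rconv \<gamma> q = rconv \<gamma> p" for \<gamma>
    by (rule ext, rule rconv_cong_AE) (use e q borel_imp_lebesgue[OF p] in auto)
  have "nconv (\<alpha> + \<beta>) (\<lambda>\<tau>. ennreal \<bar>p \<tau>\<bar>) t = nconv (\<alpha> + \<beta>) (\<lambda>\<tau>. ennreal \<bar>q \<tau>\<bar>) t"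
    by (rule nconv_cong_AE) (use e in auto)
  then show ?thesis
    using rconv_rconv_borel[OF assms(1,2) p, of t] assms(4) by (simp add: *)
qed

lemma rconv_rl_kernel:
  assumes "0 < \<alpha>" "0 < \<beta>"
  shows "rconv \<alpha> (\<lambda>s. rl_kernel \<beta> (s - a)) t = rl_kernel (\<alpha> + \<beta>) (t - a)"
    and "nconv \<alpha> (\<lambda>s. ennreal \<bar>rl_kernel \<beta> (s - a)\<bar>) t < \<infinity>"
proof -
  show "rconv \<alpha> (\<lambda>s. rl_kernel \<beta> (s - a)) t = rl_kernel (\<alpha> + \<beta>) (t - a)"
    unfolding rconv_def using rl_kernel_conv[OF assms, of t a] assms
    by (subst integral_completion, simp, intro integral_eq_nn_integral[THEN trans]) (auto simp: ennreal_mult)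
  show "nconv \<alpha> (\<lambda>s. ennreal \<bar>rl_kernel \<beta> (s - a)\<bar>) t < \<infinity>"
    using rl_kernel_conv[OF assms, of t a] assms unfolding nconv_def nn_integral_completion by simp
qed

section \<open>Absolute continuity and Lebesgue differentiation\<close>

hide_const (open) Polynomial.content

section \<open>The fundamental theorem of calculus for absolutely continuous functions\<close>

lemma sum_lengths_le_measure:
  fixes P :: "(real \<times> real) set"
  assumes "finite P" "\<And>u v. (u, v) \<in> P \<Longrightarrow> u \<le> v \<and> {u<..<v} \<subseteq> U"
    and "disjoint_family_on (\<lambda>(u, v). {u<..<v}) P" "U \<in> lmeasurable"
  shows "(\<Sum>(u, v)\<in>P. v - u) \<le> measure lebesgue U"
proof -
  have "(\<Sum>(u, v)\<in>P. v - u) = (\<Sum>p\<in>P. measure lebesgue (case p of (u, v) \<Rightarrow> {u<..<v}))"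
    using assms(2) by (intro sum.cong) auto
  also have "\<dots> = measure lebesgue (\<Union>p\<in>P. case p of (u, v) \<Rightarrow> {u<..<v})"
    using assms(1,3)
    by (intro measure_finite_Union[symmetric]) (auto simp: image_subset_iff dest!: assms(2))
  also have "\<dots> \<le> measure lebesgue U"
  proof (rule measure_mono_fmeasurable)
    show "(\<Union>p\<in>P. case p of (u, v) \<Rightarrow> {u<..<v}) \<subseteq> U" using assms(2) by fast
    show "(\<Union>p\<in>P. case p of (u, v) \<Rightarrow> {u<..<v}) \<in> sets lebesgue"
      using assms(1) by (intro sets.finite_UN) auto
  qed fact
  finally show ?thesis .
qed

lemma AC_onD:
  assumes "g \<in> AC_on S" "\<epsilon> > 0"
  obtains \<delta> where "\<delta> > 0" "\<And>P. finite P \<Longrightarrow> (\<forall>(u, v)\<in>P. u \<le> v \<and> {u..v} \<subseteq> S) \<Longrightarrow>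
      disjoint_family_on (\<lambda>(u, v). {u<..<v}) P \<Longrightarrow> (\<Sum>(u, v)\<in>P. v - u) < \<delta> \<Longrightarrow>
      (\<Sum>(u, v)\<in>P. \<bar>g v - g u\<bar>) < \<epsilon>"
proof -
  from assms(1)[unfolded AC_on_def, THEN CollectD, THEN spec, THEN mp, OF assms(2)]
  obtain \<delta> where \<delta>: "\<delta> > 0" "\<forall>P :: (real \<times> real) set. finite P \<and> (\<forall>(u, v)\<in>P. u \<le> v \<and> {u..v} \<subseteq> S) \<and>
      disjoint_family_on (\<lambda>(u, v). {u<..<v}) P \<and> (\<Sum>(u, v)\<in>P. v - u) < \<delta> \<longrightarrow>
      (\<Sum>(u, v)\<in>P. \<bar>g v - g u\<bar>) < \<epsilon>"
    by (elim exE conjE)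
  show ?thesis
    by (rule that[OF \<delta>(1)]) (rule \<delta>(2)[THEN spec, THEN mp], intro conjI)
qed

text \<open>With the gauge integral, integrability of \<open>h\<close> is part of the conclusion:
  the Riemann sum of a fine tagged division is compared term by term with the telescoping increments
  of \<open>g\<close>.\<close>

lemma AC_on_has_integral_derivative:
  fixes g h :: "real \<Rightarrow> real"
  assumes g: "g \<in> AC_on {c..d}" and "c \<le> d"
    and der: "AE t in lebesgue. t \<in> {c..d} \<longrightarrow> (g has_real_derivative h t) (at t within {c..d})"
  shows "(h has_integral (g d - g c)) {c..d}"
proof -
  define N where "N = {t \<in> {c..d}. \<not> (g has_real_derivative h t) (at t within {c..d})}"
  \<comment> \<open>On the exceptional set \<open>h\<close> is arbitrary. Setting it to 0 there
    leaves only increments of \<open>g\<close> to estimate at tags in \<open>N\<close>; changing it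
    back on a null set does not affect the integral.\<close>
  define h' where "h' t = (if t \<in> N then 0 else h t)" for t
  have N: "negligible N"
    using der unfolding N_def eventually_ae_filter
    by (auto simp: negligible_iff_null_sets[symmetric] intro: negligible_subset)
  have "(h' has_integral (g d - g c)) {c..d}"
    unfolding has_integral_real
  proof (intro allI impI)
    fix e :: real assume "e > 0"
    obtain \<delta> where "\<delta> > 0" and \<delta>: "\<And>P. finite P \<Longrightarrow> (\<forall>(u, v)\<in>P. u \<le> v \<and> {u..v} \<subseteq> {c..d}) \<Longrightarrow>
        disjoint_family_on (\<lambda>(u, v). {u<..<v}) P \<Longrightarrow> (\<Sum>(u, v)\<in>P. v - u) < \<delta> \<Longrightarrow>
        (\<Sum>(u, v)\<in>P. \<bar>g v - g u\<bar>) < e / 2"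
      by (rule AC_onD[OF g half_gt_zero[OF \<open>e > 0\<close>]], rule that)
    \<comment> \<open>Nonoverlapping intervals inside \<open>U\<close> have total length below
      \<delta>, which is what absolute continuity asks for.\<close>
    obtain U where U: "open U" "N \<subseteq> U" "U \<in> lmeasurable" "measure lebesgue U < \<delta>"
    proof -
      have Nl: "N \<in> lmeasurable" "measure lebesgue N = 0"
        using N by (auto simp: negligible_iff_measure)
      obtain T where T: "open T" "N \<subseteq> T" "T - N \<in> lmeasurable" "emeasure lebesgue (T - N) < ennreal \<delta>"
        using sets_lebesgue_outer_open[OF fmeasurableD[OF Nl(1)] \<open>\<delta> > 0\<close>] by blast
      have "T = (T - N) \<union> N" using T(2) by auto
      then have "T \<in> lmeasurable" "measure lebesgue T \<le> measure lebesgue (T - N) + measure lebesgue N"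
        using fmeasurable.Un[OF T(3) Nl(1)] measure_Un_le[OF fmeasurableD[OF T(3)] fmeasurableD[OF Nl(1)]] by auto
      moreover have "measure lebesgue (T - N) < \<delta>"
        using T(3,4) \<open>\<delta> > 0\<close> by (simp add: emeasure_eq_measure2 ennreal_less_iff)
      ultimately show ?thesis using that T Nl by auto
    qed
    \<comment> \<open>The sum over the good tags is at most \<open>e' * (d - c)\<close>; the summand
      1 makes this strictly less than \<open>e / 2\<close> and covers \<open>c = d\<close>.\<close>
    define e' where "e' = e / (2 * (d - c + 1))"
    have "e' > 0" using \<open>e > 0\<close> \<open>c \<le> d\<close> by (simp add: e'_def)
    have "\<exists>r>0. \<forall>y\<in>{c..d}. \<bar>y - t\<bar> < r \<longrightarrow> \<bar>g y - g t - h t * (y - t)\<bar> \<le> e' * \<bar>y - t\<bar>"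
      if "t \<in> {c..d} - N" for t
    proof -
      have "(g has_derivative (\<lambda>x. h t * x)) (at t within {c..d})"
        using that by (auto simp: N_def has_field_derivative_def)
      then show ?thesis
        using \<open>e' > 0\<close> unfolding has_derivative_within_alt by (auto simp: dist_norm)
    qed
    then obtain r where r: "\<And>t. t \<in> {c..d} - N \<Longrightarrow> r t > 0"
        "\<And>t y. t \<in> {c..d} - N \<Longrightarrow> y \<in> {c..d} \<Longrightarrow> \<bar>y - t\<bar> < r t \<Longrightarrow> \<bar>g y - g t - h t * (y - t)\<bar> \<le> e' * \<bar>y - t\<bar>"
      by metis
    \<comment> \<open>Intervals tagged in \<open>N\<close> are controlled by absolute continuity, the others by the derivative.\<close>
    define \<gamma> where "\<gamma> t = (if t \<in> N then U else if t \<in> {c..d} then ball t (r t) else ball t 1)" for t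
    have gauge: "gauge \<gamma>"
      using U r(1) by (auto simp: gauge_def \<gamma>_def)
    have main: "norm ((\<Sum>(x,k)\<in>D. content k *\<^sub>R h' x) - (g d - g c)) < e"
      if D: "D tagged_division_of {c..d}" and fine: "\<gamma> fine D" for D
    proof -
      have fin: "finite D" using D by blast
      have D1: "\<exists>u v. k = {u..v} \<and> u \<le> v \<and> x \<in> {u..v} \<and> {u..v} \<subseteq> {c..d}" if "(x, k) \<in> D" for x k
        using tagged_division_ofD(2,3,4)[OF D that] by (metis atLeastAtMost_iff cbox_interval order_trans)
      let ?T = "\<lambda>(x,k). content k *\<^sub>R h' x - (g (Sup k) - g (Inf k))"
      \<comment> \<open>Degenerate intervals contribute 0. Setting them aside leaves nonempty
        interiors in \<open>?D2\<close>, on which the injectivity argument below relies.\<close>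
      let ?D1 = "{(x, k) \<in> D. x \<notin> N}" and ?D2 = "{(x, k) \<in> D. x \<in> N \<and> Inf k < Sup k}"
        and ?D3 = "{(x, k) \<in> D. x \<in> N \<and> \<not> Inf k < Sup k}"
      have s1: "(\<Sum>(x,k)\<in>D. content k *\<^sub>R h' x) - (g d - g c) = (\<Sum>z\<in>D. ?T z)"
        using additive_tagged_division_1[OF \<open>c \<le> d\<close> D, of g] by (simp add: sum_subtractf split_def)
      have "D = ?D1 \<union> (?D2 \<union> ?D3)" by auto
      then have s2: "(\<Sum>z\<in>D. ?T z) = (\<Sum>z\<in>?D1 \<union> (?D2 \<union> ?D3). ?T z)" by (rule arg_cong)
      have fin': "finite ?D1" "finite ?D2" "finite ?D3"
        using fin by (auto intro: finite_subset)
      have s3: "(\<Sum>z\<in>?D1 \<union> (?D2 \<union> ?D3). ?T z) = (\<Sum>z\<in>?D1. ?T z) + (\<Sum>z\<in>?D2 \<union> ?D3. ?T z)"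
        using fin' by (intro sum.union_disjoint) auto
      have s4: "(\<Sum>z\<in>?D2 \<union> ?D3. ?T z) = (\<Sum>z\<in>?D2. ?T z) + (\<Sum>z\<in>?D3. ?T z)"
        using fin' by (intro sum.union_disjoint) auto
      have s5: "(\<Sum>z\<in>?D3. ?T z) = 0"
        using D1 by (intro sum.neutral) (fastforce simp: h'_def)
      have *: "norm ((\<Sum>(x,k)\<in>D. content k *\<^sub>R h' x) - (g d - g c))
        \<le> \<bar>\<Sum>z\<in>?D1. ?T z\<bar> + \<bar>\<Sum>z\<in>?D2. ?T z\<bar>"
        unfolding s1 s2 s3 s4 s5 real_norm_def add_0_right by (rule abs_triangle_ineq)
      have "\<bar>\<Sum>z\<in>?D1. ?T z\<bar> \<le> (\<Sum>z\<in>?D1. \<bar>?T z\<bar>)" by (rule sum_abs)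
      also have "\<dots> \<le> (\<Sum>(x,k)\<in>?D1. e' * content k)"
      proof (rule sum_mono)
        fix z assume "z \<in> ?D1"
        then obtain x k where z: "z = (x, k)" "(x, k) \<in> D" "x \<notin> N" by auto
        obtain u v where k: "k = {u..v}" "u \<le> v" "x \<in> {u..v}" "{u..v} \<subseteq> {c..d}" using D1[OF z(2)] by auto
        then have x: "x \<in> {c..d} - N" using z by auto
        have "{u..v} \<subseteq> ball x (r x)"
          using fineD[OF fine z(2)] x k by (auto simp: \<gamma>_def)
        then have "\<bar>u - x\<bar> < r x" "\<bar>v - x\<bar> < r x"
          using k subsetD[of "{u..v}" "ball x (r x)" u] subsetD[of "{u..v}" "ball x (r x)" v]
          by (auto simp: dist_real_def abs_minus_commute)
        moreover have "u \<in> {c..d}" "v \<in> {c..d}" using k by auto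
        ultimately have "\<bar>g u - g x - h x * (u - x)\<bar> \<le> e' * \<bar>u - x\<bar>" "\<bar>g v - g x - h x * (v - x)\<bar> \<le> e' * \<bar>v - x\<bar>"
          using r(2)[OF x] by auto
        moreover have "\<bar>u - x\<bar> = x - u" "\<bar>v - x\<bar> = v - x" using k by auto
        ultimately have "\<bar>(v - u) * h x - (g v - g u)\<bar> \<le> e' * (v - u)"
          by (auto simp: abs_le_iff algebra_simps)
        then show "\<bar>?T z\<bar> \<le> (case z of (x, k) \<Rightarrow> e' * content k)"
          using z k by (simp add: h'_def)
      qed
      also have "\<dots> \<le> (\<Sum>(x,k)\<in>D. e' * content k)"
        using fin \<open>e' > 0\<close> by (intro sum_mono2) auto
      also have "\<dots> = e' * (d - c)"
        using additive_content_tagged_division[of D c d] D \<open>c \<le> d\<close>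
        by (simp add: sum_distrib_left[symmetric] split_def)
      also have "\<dots> < e / 2"
        using \<open>e > 0\<close> \<open>c \<le> d\<close> by (simp add: e'_def field_simps)
      finally have 1: "\<bar>\<Sum>z\<in>?D1. ?T z\<bar> < e / 2" .
      \<comment> \<open>\<open>AC_on\<close> speaks of a set of endpoint pairs, so the tags have to
        be forgotten without merging two terms of the sum.\<close>
      define P where "P = (\<lambda>(x, k). (Inf k, Sup k)) ` ?D2"
      have disj: "{u<..<v} \<inter> {u'<..<v'} = {}"
        if "(x, {u..v}) \<in> D" "(x', {u'..v'}) \<in> D" "(x, {u..v}) \<noteq> (x', {u'..v'})" for x x' u v u' v'
        using tagged_division_ofD(5)[OF D that] by (simp add: interior_atLeastAtMost_real)
      \<comment> \<open>Two different members with equal endpoints would have disjoint interiors,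
        yet share the midpoint.\<close>
      have inj: "inj_on (\<lambda>(x, k). (Inf k, Sup k)) ?D2"
      proof (rule inj_onI)
        fix z z'
        assume "z \<in> ?D2" "z' \<in> ?D2"
          and eq: "(case z of (x, k) \<Rightarrow> (Inf k, Sup k)) = (case z' of (x, k) \<Rightarrow> (Inf k, Sup k))"
        then obtain x k x' k' where z: "z = (x, k)" "z' = (x', k')"
          and a: "(x, k) \<in> D" "(x', k') \<in> D" "Inf k' < Sup k'" by auto
        obtain u v where k: "k = {u..v}" "u \<le> v" using D1[OF a(1)] by auto
        obtain u' v' where k': "k' = {u'..v'}" "u' \<le> v'" using D1[OF a(2)] by auto
        have uv: "u = u'" "v = v'" "u' < v'" using a eq z k k' by auto
        then have mid: "(u' + v') / 2 \<in> {u<..<v} \<inter> {u'<..<v'}" by auto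
        show "z = z'"
        proof (rule ccontr)
          assume "z \<noteq> z'"
          then have "{u<..<v} \<inter> {u'<..<v'} = {}"
            using a(1,2) unfolding z k(1) k'(1) by (rule disj[rotated 2])
          with mid show False by blast
        qed
      qed
      have PD: "\<exists>x. (x, {u..v}) \<in> D \<and> x \<in> N \<and> u < v \<and> {u..v} \<subseteq> {c..d} \<and> {u..v} \<subseteq> U" if uv: "(u, v) \<in> P" for u v
      proof -
        obtain x k where xk: "(x, k) \<in> D" "x \<in> N" "Inf k < Sup k" "u = Inf k" "v = Sup k"
          using uv by (auto simp: P_def)
        obtain u' v' where k: "k = {u'..v'}" "u' \<le> v'" "{u'..v'} \<subseteq> {c..d}" using D1[OF xk(1)] by auto
        have "k \<subseteq> U" using fineD[OF fine xk(1)] xk(2) by (simp add: \<gamma>_def)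
        then show ?thesis using xk k by auto
      qed
      have "(\<Sum>(u, v)\<in>P. \<bar>g v - g u\<bar>) < e / 2"
      proof (rule \<delta>)
        show "finite P" using fin by (auto simp: P_def intro: finite_subset)
        show "\<forall>(u, v)\<in>P. u \<le> v \<and> {u..v} \<subseteq> {c..d}" using PD by fastforce
        show dj: "disjoint_family_on (\<lambda>(u, v). {u<..<v}) P"
          unfolding disjoint_family_on_def
        proof (intro ballI impI)
          fix z z' assume zz: "z \<in> P" "z' \<in> P" "z \<noteq> z'"
          obtain u v u' v' where z: "z = (u, v)" "z' = (u', v')" by (cases z, cases z')
          then have a: "(u, v) \<in> P" "(u', v') \<in> P" "(u, v) \<noteq> (u', v')" using zz by auto
          obtain x x' where "(x, {u..v}) \<in> D" "u < v" "(x', {u'..v'}) \<in> D" "u' < v'"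
            using PD[OF a(1)] PD[OF a(2)] by auto
          then have "{u<..<v} \<inter> {u'<..<v'} = {}"
            using a(3) by (intro disj[of x u v x' u' v']) (auto simp: Icc_eq_Icc)
          then show "(case z of (u, v) \<Rightarrow> {u<..<v}) \<inter> (case z' of (u, v) \<Rightarrow> {u<..<v}) = {}"
            by (simp add: z)
        qed
        have "(\<Sum>(u, v)\<in>P. v - u) \<le> measure lebesgue U"
          by (rule sum_lengths_le_measure) (use \<open>finite P\<close> dj U PD in \<open>fastforce+\<close>)
        then show "(\<Sum>(u, v)\<in>P. v - u) < \<delta>" using U by simp
      qed
      also have "(\<Sum>(u, v)\<in>P. \<bar>g v - g u\<bar>) = (\<Sum>z\<in>?D2. \<bar>?T z\<bar>)"
        unfolding P_def by (subst sum.reindex[OF inj]) (auto intro!: sum.cong simp: h'_def abs_minus_commute)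
      finally have 2: "\<bar>\<Sum>z\<in>?D2. ?T z\<bar> < e / 2"
        using sum_abs[of ?T ?D2] by linarith
      show ?thesis using * 1 2 by linarith
    qed
    show "\<exists>\<gamma>. gauge \<gamma> \<and> (\<forall>\<D>. \<D> tagged_division_of {c..d} \<and> \<gamma> fine \<D> \<longrightarrow>
        norm ((\<Sum>(x,k)\<in>\<D>. content k *\<^sub>R h' x) - (g d - g c)) < e)"
    proof (intro exI conjI allI impI)
      show "gauge \<gamma>" by (rule gauge)
    next
      fix \<D> assume "\<D> tagged_division_of {c..d} \<and> \<gamma> fine \<D>"
      then show "norm ((\<Sum>(x,k)\<in>\<D>. content k *\<^sub>R h' x) - (g d - g c)) < e"
        by (intro main) auto
    qed
  qed
  then show ?thesis
    by (rule has_integral_spike[OF N, rotated]) (auto simp: h'_def)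
qed

text \<open>\<open>E n\<close> collects the points with difference quotients arbitrarily close by
  that miss \<open>h t\<close> by more than \<open>1 / Suc n\<close>. Off the union of these sets
  the derivative is \<open>h t\<close>, so it suffices that each of them is null.\<close>

lemma AE_has_derivative_integral:
  fixes h :: "real \<Rightarrow> real"
  assumes h: "h integrable_on {c..d}"
  shows "AE t in lebesgue. t \<in> {c..d} \<longrightarrow>
    ((\<lambda>s. integral {c..s} h) has_real_derivative h t) (at t within {c..d})"
proof -
  define F where "F = (\<lambda>s. integral {c..s} h)"
  define E where "E n = {t \<in> {c..d}. \<forall>r>0. \<exists>s\<in>{c..d}. s \<noteq> t \<and> \<bar>s - t\<bar> < r \<and>
    \<bar>F s - F t - h t * (s - t)\<bar> > 1 / Suc n * \<bar>s - t\<bar>}" for n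
  have neg: "negligible (E n)" for n
    unfolding negligible_outer_le
  proof (intro allI impI)
    fix e :: real assume "e > 0"
    define \<eta> where "\<eta> = 1 / real (Suc n)"
    have "\<eta> > 0" by (simp add: \<eta>_def)
    \<comment> \<open>Each interval of the cover contributes at least \<eta> times its length to the
      Henstock sum, so the bound \<open>e * \<eta>\<close> turns into total length at most
      \<open>e\<close>.\<close>
    obtain \<gamma> where \<gamma>: "gauge \<gamma>" and hen: "\<And>p. \<lbrakk>p tagged_partial_division_of (cbox c d); \<gamma> fine p\<rbrakk> \<Longrightarrow>
        (\<Sum>(x,k)\<in>p. norm (content k *\<^sub>R h x - integral k h)) < e * \<eta>"
      using Henstock_lemma[of h c d "e * \<eta>"] h \<open>e > 0\<close> \<open>\<eta> > 0\<close> by (auto simp: cbox_interval)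
    \<comment> \<open>Intervals with a bad difference quotient form a Vitali cover of \<open>E n\<close>; by Henstock's lemma
      finitely many disjoint ones have total length at most \<open>e\<close>.\<close>
    define B where "B = (\<lambda>(t, s). cball ((t + s) / 2) (\<bar>s - t\<bar> / 2))"
    \<comment> \<open>Vitali's theorem is about balls and Henstock's lemma about tagged intervals. A
      pair \<open>(t, s)\<close> provides both: the ball with diameter from \<open>t\<close> to
      \<open>s\<close>, tagged at its endpoint \<open>t\<close>.\<close>
    have B: "B (t, s) = {min t s..max t s}" for t s :: real
      unfolding B_def by (auto simp: cball_eq_atLeastAtMost field_simps min_def max_def abs_if)
    define K where "K = {(t, s). t \<in> E n \<and> s \<in> {c..d} \<and> s \<noteq> t \<and> B (t, s) \<subseteq> \<gamma> t \<and>
      \<bar>F s - F t - h t * (s - t)\<bar> > \<eta> * \<bar>s - t\<bar>}"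
    obtain C where C: "countable C" "C \<subseteq> K"
      "pairwise (\<lambda>i j. disjnt (B i) (B j)) C" "negligible (E n - (\<Union>i\<in>C. B i))"
    proof -
      have "\<exists>i. i \<in> K \<and> x \<in> cball ((fst i + snd i) / 2) (\<bar>snd i - fst i\<bar> / 2) \<and> \<bar>snd i - fst i\<bar> / 2 < r"
        if x: "x \<in> E n" "0 < r" for x r
      proof -
        have "x \<in> \<gamma> x" "open (\<gamma> x)" using \<gamma> by (auto simp: gauge_def)
        then obtain r0 where r0: "r0 > 0" "ball x r0 \<subseteq> \<gamma> x" by (meson open_contains_ball)
        then obtain s where s: "s \<in> {c..d}" "s \<noteq> x" "\<bar>s - x\<bar> < min r0 r" "\<bar>F s - F x - h x * (s - x)\<bar> > \<eta> * \<bar>s - x\<bar>"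
          using x r0(1) unfolding E_def \<eta>_def mem_Collect_eq by (metis min_less_iff_conj)
        have "B (x, s) \<subseteq> ball x r0"
          using s(3) by (auto simp: B dist_real_def)
        then have "(x, s) \<in> K" using x s r0 by (auto simp: K_def)
        moreover have "x \<in> B (x, s)" by (simp add: B)
        ultimately show ?thesis using s(3) x(2) by (intro exI[of _ "(x, s)"]) (auto simp: B_def)
      qed
      moreover have "0 < \<bar>snd i - fst i\<bar> / 2" if "i \<in> K" for i
        using that by (auto simp: K_def)
      ultimately show ?thesis
        using that Vitali_covering_theorem_cballs[of K "\<lambda>i. \<bar>snd i - fst i\<bar> / 2" "E n" "\<lambda>i. (fst i + snd i) / 2"]
        unfolding B_def split_def by blast
    qed
    have fin: "(\<Sum>i\<in>C'. measure lebesgue (B i)) \<le> e" if C': "C' \<subseteq> C" "finite C'" for C'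
    proof -
      define p where "p = (\<lambda>i. (fst i, B i)) ` C'"
      have C'K: "C' \<subseteq> K" using C' C by auto
      have disj: "B i \<inter> B j = {}" if "i \<in> C'" "j \<in> C'" "i \<noteq> j" for i j
        using C(3) C'(1) that unfolding pairwise_def disjnt_def by blast
      have mem: "fst i \<in> B i" for i by (cases i) (simp add: B)
      have inj: "inj_on (\<lambda>i. (fst i, B i)) C'"
        by (rule inj_onI) (metis disj mem disjoint_iff prod.inject)
      have K1: "fst i \<in> {c..d}" "snd i \<in> {c..d}" "B i \<subseteq> {c..d}" if "i \<in> K" for i
        using that by (auto simp: K_def E_def B)
      have "p tagged_partial_division_of (cbox c d)"
        unfolding tagged_partial_division_of_def p_def
      proof (intro conjI allI impI)
        show "finite ((\<lambda>i. (fst i, B i)) ` C')" using C' by simp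
      next
        fix x k assume "(x, k) \<in> (\<lambda>i. (fst i, B i)) ` C'"
        then obtain i where i: "i \<in> C'" "x = fst i" "k = B i" by auto
        show "x \<in> k" using i mem by simp
        show "k \<subseteq> cbox c d" using K1(3)[of i] i C'K by (auto simp: cbox_interval)
        show "\<exists>a b. k = cbox a b" unfolding i(3) by (cases i) (metis B cbox_interval)
      next
        fix x1 k1 x2 k2
        assume "(x1, k1) \<in> (\<lambda>i. (fst i, B i)) ` C' \<and> (x2, k2) \<in> (\<lambda>i. (fst i, B i)) ` C' \<and> (x1, k1) \<noteq> (x2, k2)"
        then obtain i j where "i \<in> C'" "j \<in> C'" "i \<noteq> j" "k1 = B i" "k2 = B j" by auto
        then show "interior k1 \<inter> interior k2 = {}"
          using disj[of i j] interior_subset by blast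
      qed
      moreover have "B i \<subseteq> \<gamma> (fst i)" if "i \<in> C'" for i
        using subsetD[OF C'K that] by (auto simp: K_def)
      then have "\<gamma> fine p"
        by (auto simp: fine_def p_def)
      ultimately have "(\<Sum>(x,k)\<in>p. norm (content k *\<^sub>R h x - integral k h)) < e * \<eta>"
        by (rule hen)
      moreover have "(\<Sum>(x,k)\<in>p. norm (content k *\<^sub>R h x - integral k h))
        = (\<Sum>i\<in>C'. norm (content (B i) *\<^sub>R h (fst i) - integral (B i) h))"
        unfolding p_def by (subst sum.reindex[OF inj]) simp
      moreover have "\<eta> * (\<Sum>i\<in>C'. measure lebesgue (B i))
        \<le> (\<Sum>i\<in>C'. norm (content (B i) *\<^sub>R h (fst i) - integral (B i) h))"
        unfolding sum_distrib_left
      proof (rule sum_mono)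
        fix i assume "i \<in> C'"
        then have iK: "i \<in> K" using C'K by auto
        obtain t s where i: "i = (t, s)" by (cases i)
        have ts: "t \<in> {c..d}" "s \<in> {c..d}" "s \<noteq> t" "\<bar>F s - F t - h t * (s - t)\<bar> > \<eta> * \<bar>s - t\<bar>"
          using iK K1[of i] by (auto simp: K_def i)
        have split: "F v - F u = integral {u..v} h" if "u \<in> {c..d}" "v \<in> {c..d}" "u \<le> v" for u v
          using Henstock_Kurzweil_Integration.integral_combine[of c u v h] that
            integrable_subinterval_real[OF h, of c v]
          unfolding F_def by auto
        have "\<eta> * measure lebesgue (B i) = \<eta> * \<bar>s - t\<bar>"
          by (cases "t \<le> s") (auto simp: i B measure_completion min_def max_def)
        also have "\<dots> \<le> \<bar>F s - F t - h t * (s - t)\<bar>" using ts by simp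
        also have "\<dots> = norm (content (B i) *\<^sub>R h (fst i) - integral (B i) h)"
        proof (cases "t \<le> s")
          case True
          then have B1: "integral (B i) h = F s - F t" and B2: "content (B i) = s - t"
            using split[of t s] ts by (auto simp: i B min_def max_def)
          show ?thesis unfolding B1 B2 by (simp add: i abs_minus_commute mult.commute)
        next
          case False
          then have B1: "integral (B i) h = F t - F s" and B2: "content (B i) = t - s"
            using split[of s t] ts by (auto simp: i B min_def max_def)
          have "content (B i) *\<^sub>R h (fst i) - integral (B i) h = F s - F t - h t * (s - t)"
            unfolding B1 B2 by (simp add: i algebra_simps)
          then show ?thesis by simp
        qed
        finally show "\<eta> * measure lebesgue (B i) \<le> norm (content (B i) *\<^sub>R h (fst i) - integral (B i) h)" .
      qed
      ultimately have "\<eta> * (\<Sum>i\<in>C'. measure lebesgue (B i)) \<le> \<eta> * e" by (simp add: mult.commute)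
      then show ?thesis using \<open>\<eta> > 0\<close> by simp
    qed
    have lm: "B i \<in> lmeasurable" for i by (cases i) (simp add: B)
    \<comment> \<open>The bound for finite subfamilies passes to the countable union; the part of
      \<open>E n\<close> outside it is null by Vitali.\<close>
    have U: "(\<Union>i\<in>C. B i) \<in> lmeasurable" "measure lebesgue (\<Union>i\<in>C. B i) \<le> e"
    proof -
      have "measure lebesgue (\<Union>i\<in>C'. B i) \<le> e" if "C' \<subseteq> C" "finite C'" for C'
        using measure_UNION_le[of C' B lebesgue] fin[OF that] lm that by (auto simp: fmeasurableD)
      then show "(\<Union>i\<in>C. B i) \<in> lmeasurable" "measure lebesgue (\<Union>i\<in>C. B i) \<le> e"
        using fmeasurable_UN_bound[of C B lebesgue e] measure_UN_bound[of C B lebesgue e] C(1) lm by auto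
    qed
    show "\<exists>T. E n \<subseteq> T \<and> T \<in> lmeasurable \<and> measure lebesgue T \<le> e"
    proof (intro exI conjI)
      let ?T = "(E n - (\<Union>i\<in>C. B i)) \<union> (\<Union>i\<in>C. B i)"
      show "E n \<subseteq> ?T" by auto
      show "?T \<in> lmeasurable" using U C(4) by (intro fmeasurable.Un) (auto simp: negligible_iff_measure)
      have "measure lebesgue ?T \<le> measure lebesgue (E n - (\<Union>i\<in>C. B i)) + measure lebesgue (\<Union>i\<in>C. B i)"
        using U C(4) by (intro measure_Un_le) (auto simp: negligible_iff_measure)
      then show "measure lebesgue ?T \<le> e" using U C(4) by (auto simp: negligible_iff_measure)
    qed
  qed
  have "negligible (\<Union>n. E n)" using neg by (rule negligible_Union_nat)
  then have "AE t in lebesgue. t \<notin> (\<Union>n. E n)"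
    unfolding negligible_iff_null_sets by (rule AE_not_in)
  then show ?thesis
  proof eventually_elim
    case (elim t)
    show ?case
    proof
      assume t: "t \<in> {c..d}"
      have "(F has_derivative (\<lambda>x. h t * x)) (at t within {c..d})"
        unfolding has_derivative_within_alt
      proof (intro conjI allI impI)
        show "bounded_linear ((*) (h t))" by (rule bounded_linear_mult_right)
        fix \<epsilon> :: real assume "\<epsilon> > 0"
        then obtain n where n: "1 / real (Suc n) < \<epsilon>" using nat_approx_posE by blast
        have "t \<notin> E n" using elim by auto
        then obtain r where r: "r > 0" "\<And>s. s \<in> {c..d} \<Longrightarrow> s \<noteq> t \<Longrightarrow> \<bar>s - t\<bar> < r \<Longrightarrow>
            \<bar>F s - F t - h t * (s - t)\<bar> \<le> 1 / Suc n * \<bar>s - t\<bar>"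
          using t unfolding E_def mem_Collect_eq by (meson not_less)
        show "\<exists>r>0. \<forall>y\<in>{c..d}. norm (y - t) < r \<longrightarrow> norm (F y - F t - h t * (y - t)) \<le> \<epsilon> * norm (y - t)"
        proof (intro exI[of _ r] conjI ballI impI)
          fix y assume y: "y \<in> {c..d}" "norm (y - t) < r"
          show "norm (F y - F t - h t * (y - t)) \<le> \<epsilon> * norm (y - t)"
          proof (cases "y = t")
            case False
            then have "norm (F y - F t - h t * (y - t)) \<le> 1 / Suc n * \<bar>y - t\<bar>"
              using r(2)[of y] y by simp
            also have "\<dots> \<le> \<epsilon> * \<bar>y - t\<bar>" using n by (intro mult_right_mono) auto
            finally show ?thesis by simp
          qed simp
        qed (use r in auto)
      qed
      then show "((\<lambda>s. integral {c..s} h) has_real_derivative h t) (at t within {c..d})"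
        by (simp add: has_field_derivative_def F_def)
    qed
  qed
qed

text \<open>Truncation: \<open>R n\<close> is the part of \<open>\<bar>h\<bar>\<close> above height
  \<open>n\<close>. Its integral tends to 0 by dominated convergence, while the part below
  contributes at most \<open>n\<close> times the total length of the intervals.\<close>

lemma AC_on_integral:
  fixes h :: "real \<Rightarrow> real"
  assumes h: "h absolutely_integrable_on {c..d}"
  shows "(\<lambda>s. C + integral {c..s} h) \<in> AC_on {c..d}"
  unfolding AC_on_def
proof (intro CollectI allI impI)
  fix \<epsilon> :: real assume "\<epsilon> > 0"
  define W where "W x = indicator {c..d} x * \<bar>h x\<bar>" for x
  have W: "integrable lebesgue W"
    using set_integrable_norm[OF h] by (simp add: W_def[abs_def] set_integrable_def)
  define R where "R n x = W x - min (W x) (real n)" for n x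
  have W0: "0 \<le> W x" for x by (simp add: W_def)
  have [measurable]: "W \<in> borel_measurable lebesgue" using W by auto
  have R: "integrable lebesgue (R n)" for n
    by (rule Bochner_Integration.integrable_bound[OF W]) (auto simp: R_def[abs_def] W0 min_def)
  have "(\<lambda>n. integral\<^sup>L lebesgue (R n)) \<longlonglongrightarrow> integral\<^sup>L lebesgue (\<lambda>x::real. 0 :: real)"
  proof (rule integral_dominated_convergence[where w = W])
    show "AE x in lebesgue. (\<lambda>n. R n x) \<longlonglongrightarrow> 0"
    proof (rule AE_I2)
      fix x
      have "eventually (\<lambda>n. R n x = 0) sequentially"
        using eventually_ge_at_top[of "nat \<lceil>W x\<rceil>"] by eventually_elim (simp add: R_def min_def nat_le_iff ceiling_le_iff)
      then show "(\<lambda>n. R n x) \<longlonglongrightarrow> 0" by (rule tendsto_eventually)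
    qed
    show "AE x in lebesgue. norm (R n x) \<le> W x" for n
      by (auto simp: R_def W0 min_def)
  qed (use W R in auto)
  then have "eventually (\<lambda>n. integral\<^sup>L lebesgue (R n) < \<epsilon> / 2) sequentially"
    using \<open>\<epsilon> > 0\<close> by (intro order_tendstoD) auto
  then obtain n where n: "integral\<^sup>L lebesgue (R n) < \<epsilon> / 2"
    by (auto simp: eventually_sequentially)
  \<comment> \<open>Chosen so that \<open>real n * \<delta>\<close> is at most half of \<epsilon>;
    the summand 1 covers \<open>n = 0\<close>.\<close>
  define \<delta> where "\<delta> = \<epsilon> / (2 * (real n + 1))"
  show "\<exists>\<delta>>0. \<forall>P. finite P \<and> (\<forall>(u, v)\<in>P. u \<le> v \<and> {u..v} \<subseteq> {c..d}) \<and>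
       disjoint_family_on (\<lambda>(u, v). {u<..<v}) P \<and> (\<Sum>(u, v)\<in>P. v - u) < \<delta> \<longrightarrow>
       (\<Sum>(u, v)\<in>P. \<bar>C + integral {c..v} h - (C + integral {c..u} h)\<bar>) < \<epsilon>"
  proof (intro exI[of _ \<delta>] conjI allI impI)
    show "\<delta> > 0" using \<open>\<epsilon> > 0\<close> by (simp add: \<delta>_def)
    fix P :: "(real \<times> real) set"
    assume P: "finite P \<and> (\<forall>(u, v)\<in>P. u \<le> v \<and> {u..v} \<subseteq> {c..d}) \<and>
       disjoint_family_on (\<lambda>(u, v). {u<..<v}) P \<and> (\<Sum>(u, v)\<in>P. v - u) < \<delta>"
    \<comment> \<open>The closed intervals of \<open>P\<close> may share endpoints, so the tails
      \<open>R n\<close> are summed over the disjoint open ones; the endpoints are null.\<close>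
    define J where "J = (\<lambda>(u::real, v). {u<..<v})"
    have JR: "integrable lebesgue (\<lambda>x. indicator (J p) x * R n x)" for p
      using integrable_mult_indicator[OF _ R, of "J p" n] by (cases p) (simp add: J_def)
    have Iuv: "integrable lebesgue (\<lambda>x. real n * indicator {u..v} x)" for u v :: real
    proof -
      have "{u..v} \<in> lmeasurable" using lmeasurable_cbox[of u v] by (simp add: cbox_interval)
      then show ?thesis
        by (intro integrable_mult_right integrable_real_indicator) (auto simp: fmeasurable_def)
    qed
    have term_le: "\<bar>C + integral {c..v} h - (C + integral {c..u} h)\<bar>
        \<le> (LINT x|lebesgue. indicator (J (u, v)) x * R n x) + real n * (v - u)" if uv: "(u, v) \<in> P" for u v
    proof -
      have uv': "u \<le> v" "c \<le> u" "v \<le> d" "{u..v} \<subseteq> {c..d}" using P uv by auto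
      have hi: "h absolutely_integrable_on {u..v}"
        by (rule set_integrable_subset[OF h]) (use uv' in auto)
      have hc: "h integrable_on {c..v}"
        by (rule integrable_subinterval_real[of h c d]) (use set_lebesgue_integral_eq_integral(1)[OF h] uv' in auto)
      have "C + integral {c..v} h - (C + integral {c..u} h) = integral {u..v} h"
        using Henstock_Kurzweil_Integration.integral_combine[of c u v h] uv' hc by simp
      also have "\<dots> = (LINT x:{u..v}|lebesgue. h x)"
        by (rule set_lebesgue_integral_eq_integral(2)[OF hi, symmetric])
      also have "\<bar>\<dots>\<bar> \<le> (LINT x|lebesgue. norm (indicator {u..v} x *\<^sub>R h x))"
        unfolding set_lebesgue_integral_def real_norm_def[symmetric] by (rule integral_norm_bound)
      also have "\<dots> \<le> (LINT x|lebesgue. indicator (J (u, v)) x * R n x + real n * indicator {u..v} x)"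
      proof (rule integral_mono_AE)
        show "integrable lebesgue (\<lambda>x. norm (indicator {u..v} x *\<^sub>R h x))"
          using hi unfolding set_integrable_def by (rule integrable_norm)
        show "integrable lebesgue (\<lambda>x. indicator (J (u, v)) x * R n x + real n * indicator {u..v} x)"
          using JR Iuv by (rule Bochner_Integration.integrable_add)
        have "AE x in lebesgue. x \<noteq> u \<and> x \<noteq> v"
          using AE_not_in[of "{u, v}" lebesgue] negligible_finite[of "{u,v}"] by (simp add: negligible_iff_null_sets)
        then show "AE x in lebesgue. norm (indicator {u..v} x *\<^sub>R h x) \<le> indicator (J (u, v)) x * R n x + real n * indicator {u..v} x"
        proof eventually_elim
          case (elim x)
          then show ?case using uv' by (auto simp: J_def indicator_def R_def W_def)
        qed
      qed
      also have "\<dots> = (LINT x|lebesgue. indicator (J (u, v)) x * R n x) + real n * (v - u)"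
        using uv' by (subst Bochner_Integration.integral_add[OF JR Iuv]) (simp add: measure_completion)
      finally show ?thesis .
    qed
    have "(\<Sum>(u, v)\<in>P. \<bar>C + integral {c..v} h - (C + integral {c..u} h)\<bar>)
      \<le> (\<Sum>(u, v)\<in>P. (LINT x|lebesgue. indicator (J (u, v)) x * R n x) + real n * (v - u))"
      using term_le by (intro sum_mono) auto
    also have "\<dots> = (\<Sum>p\<in>P. LINT x|lebesgue. indicator (J p) x * R n x) + real n * (\<Sum>(u, v)\<in>P. v - u)"
      by (simp add: split_def sum.distrib sum_distrib_left)
    also have "(\<Sum>p\<in>P. LINT x|lebesgue. indicator (J p) x * R n x)
        = (LINT x|lebesgue. (\<Sum>p\<in>P. indicator (J p) x * R n x))"
      by (rule Bochner_Integration.integral_sum[symmetric]) (rule JR)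
    also have "\<dots> \<le> (LINT x|lebesgue. R n x)"
    proof (rule integral_mono)
      show "integrable lebesgue (\<lambda>x. \<Sum>p\<in>P. indicator (J p) x * R n x)"
        by (rule Bochner_Integration.integrable_sum) (rule JR)
      fix x
      have "(\<Sum>p\<in>P. indicator (J p) x * R n x) = indicator (\<Union>p\<in>P. J p) x * R n x"
        using P by (subst indicator_UN_disjoint) (auto simp: J_def sum_distrib_right)
      also have "\<dots> \<le> R n x" by (auto simp: indicator_def R_def)
      finally show "(\<Sum>p\<in>P. indicator (J p) x * R n x) \<le> R n x" .
    qed (use R in auto)
    also have "\<dots> < \<epsilon> / 2" by (rule n)
    also have "real n * (\<Sum>(u, v)\<in>P. v - u) \<le> real n * \<delta>" using P by (intro mult_left_mono) auto
    also have "real n * \<delta> \<le> \<epsilon> / 2" using \<open>\<epsilon> > 0\<close> by (simp add: \<delta>_def field_simps)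
    finally show "(\<Sum>(u, v)\<in>P. \<bar>C + integral {c..v} h - (C + integral {c..u} h)\<bar>) < \<epsilon>" by simp
  qed
qed

section \<open>The Riemann-Liouville integral on compact intervals\<close>

lemma nconv_nconv_abs:
  assumes "0 < \<alpha>" "0 < \<beta>" and q: "q \<in> borel_measurable lebesgue"
  shows "nconv \<alpha> (nconv \<beta> (\<lambda>\<tau>. ennreal \<bar>q \<tau>\<bar>)) t = nconv (\<alpha> + \<beta>) (\<lambda>\<tau>. ennreal \<bar>q \<tau>\<bar>) t"
proof -
  obtain p where p [measurable]: "p \<in> borel_measurable borel" and e: "AE t in lebesgue. q t = p t"
    using borel_representative[OF q] .
  have "nconv \<gamma> (\<lambda>\<tau>. ennreal \<bar>q \<tau>\<bar>) = nconv \<gamma> (\<lambda>\<tau>. ennreal \<bar>p \<tau>\<bar>)" for \<gamma>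
    by (rule ext, rule nconv_cong_AE) (use e in auto)
  then show ?thesis
    using nconv_nconv[OF assms(1,2), of "\<lambda>\<tau>. ennreal \<bar>p \<tau>\<bar>" t] by simp
qed

lemma nconv_abs_measurable [measurable]:
  assumes q: "q \<in> borel_measurable lebesgue"
  shows "nconv \<beta> (\<lambda>\<tau>. ennreal \<bar>q \<tau>\<bar>) \<in> borel_measurable borel"
proof -
  obtain p where p [measurable]: "p \<in> borel_measurable borel" and e: "AE t in lebesgue. q t = p t"
    using borel_representative[OF q] .
  have "nconv \<beta> (\<lambda>\<tau>. ennreal \<bar>q \<tau>\<bar>) = nconv \<beta> (\<lambda>\<tau>. ennreal \<bar>p \<tau>\<bar>)"
    by (rule ext, rule nconv_cong_AE) (use e in auto)
  also have "\<dots> = (\<lambda>t. \<integral>\<^sup>+\<tau>. ennreal (rl_kernel \<beta> (t - \<tau>)) * ennreal \<bar>p \<tau>\<bar> \<partial>lborel)"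
    by (simp add: nconv_def[abs_def] nn_integral_completion)
  finally show ?thesis by simp
qed

lemma nconv_weighted_abs:
  assumes "0 < \<alpha>" "0 < \<mu>" and q: "q \<in> borel_measurable lebesgue"
  shows "(\<integral>\<^sup>+t. ennreal (exp (- \<mu> * t)) * nconv \<alpha> (\<lambda>\<tau>. ennreal \<bar>q \<tau>\<bar>) t \<partial>lebesgue)
    = ennreal (\<mu> powr - \<alpha>) * (\<integral>\<^sup>+t. ennreal (exp (- \<mu> * t)) * ennreal \<bar>q t\<bar> \<partial>lebesgue)"
proof -
  obtain p where p [measurable]: "p \<in> borel_measurable borel" and e: "AE t in lebesgue. q t = p t"
    using borel_representative[OF q] .
  have "nconv \<gamma> (\<lambda>\<tau>. ennreal \<bar>q \<tau>\<bar>) = nconv \<gamma> (\<lambda>\<tau>. ennreal \<bar>p \<tau>\<bar>)" for \<gamma>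
    by (rule ext, rule nconv_cong_AE) (use e in auto)
  moreover have "(\<integral>\<^sup>+t. ennreal (exp (- \<mu> * t)) * ennreal \<bar>q t\<bar> \<partial>lebesgue)
    = (\<integral>\<^sup>+t. ennreal (exp (- \<mu> * t)) * ennreal \<bar>p t\<bar> \<partial>lebesgue)"
    by (rule nn_integral_cong_AE) (use e in auto)
  ultimately show ?thesis
    using nconv_weighted[OF assms(1,2), of "\<lambda>\<tau>. ennreal \<bar>p \<tau>\<bar>"] by (simp add: nn_integral_completion)
qed

text \<open>Extension by 0 makes a function that is integrable on \<open>{a..c}\<close> integrable
  on the whole line. By causality the convolution at any \<open>t \<le> c\<close> is unaffected by
  the cut at \<open>c\<close>, so different choices of \<open>c\<close> are compatible.\<close>

abbreviation cut :: "real \<Rightarrow> real \<Rightarrow> (real \<Rightarrow> real) \<Rightarrow> real \<Rightarrow> real" where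
  "cut a c q \<equiv> (\<lambda>\<tau>. indicator {a..c} \<tau> * q \<tau>)"

lemma rl_integral_raw_eq_rconv:
  assumes "0 < \<beta>" "t \<le> c"
  shows "rl_integral_raw a \<beta> q t = rconv \<beta> (cut a c q) t"
proof -
  have "indicator {a..t} \<tau> *\<^sub>R (1 / Gamma \<beta> * (t - \<tau>) powr (\<beta> - 1) * q \<tau>)
      = rl_kernel \<beta> (t - \<tau>) * (indicator {a..c} \<tau> * q \<tau>)" for \<tau>
    using assms by (auto simp: indicator_def rl_kernel_def)
  then show ?thesis
    using assms by (simp only: rl_integral_raw_def rconv_def set_lebesgue_integral_def) simp
qed

lemma rconv_before:
  assumes "t \<le> a"
  shows "rconv \<beta> (cut a c q) t = 0"
proof -
  have "rl_kernel \<beta> (t - \<tau>) * (indicator {a..c} \<tau> * q \<tau>) = 0" for \<tau>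
    using assms by (auto simp: indicator_def)
  then show ?thesis unfolding rconv_def by (simp only:) simp
qed

text \<open>\<open>rl_kernel 1\<close> is the indicator of the positive half line. For
  \<open>t < a\<close> both sides are 0.\<close>

lemma rconv_1:
  assumes q: "q absolutely_integrable_on {a..c}" and t: "t \<le> c"
  shows "rconv 1 (cut a c q) t = integral {a..t} q"
proof -
  have sub: "q absolutely_integrable_on {a..t}"
    by (rule set_integrable_subset[OF q]) (use t in auto)
  have [measurable]: "cut a c q \<in> borel_measurable lebesgue" "cut a t q \<in> borel_measurable lebesgue"
    using q sub by (auto simp: set_integrable_def dest!: borel_measurable_integrable)
  have "AE \<tau> in lebesgue. \<tau> \<noteq> t"
    using AE_not_in[of "{t}" lebesgue] by simp
  then have "rconv 1 (cut a c q) t = (LINT \<tau>|lebesgue. indicator {a..t} \<tau> *\<^sub>R q \<tau>)"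
    unfolding rconv_def
  proof (intro integral_cong_AE)
    show "AE \<tau> in lebesgue. rl_kernel 1 (t - \<tau>) * (indicator {a..c} \<tau> * q \<tau>) = indicator {a..t} \<tau> *\<^sub>R q \<tau>"
      using \<open>AE \<tau> in lebesgue. \<tau> \<noteq> t\<close>
      by eventually_elim (use t in \<open>auto simp: indicator_def rl_kernel_def\<close>)
  qed simp_all
  also have "\<dots> = integral {a..t} q"
    using set_lebesgue_integral_eq_integral(2)[OF sub] by (simp add: set_lebesgue_integral_def)
  finally show ?thesis .
qed

lemma cut_measurable:
  assumes "q absolutely_integrable_on {a..c}"
  shows "cut a c q \<in> borel_measurable lebesgue"
  using assms by (auto simp: set_integrable_def dest!: borel_measurable_integrable)

text \<open>From order 1 on the kernel is bounded on bounded sets: on the support of the cut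
  function \<open>t - \<tau>\<close> is at most \<open>t - a\<close>, whence \<open>B\<close>. This
  gives finiteness at every \<open>t\<close>.\<close>

lemma nconv_cut_finite:
  assumes q: "q absolutely_integrable_on {a..c}" and "1 \<le> \<gamma>"
  shows "nconv \<gamma> (\<lambda>\<tau>. ennreal \<bar>cut a c q \<tau>\<bar>) t < \<infinity>"
proof -
  note [measurable] = cut_measurable[OF q]
  define B where "B = (\<bar>t - a\<bar>) powr (\<gamma> - 1) / Gamma \<gamma>"
  have G: "Gamma \<gamma> > 0" using assms by (intro Gamma_real_pos) auto
  have "nconv \<gamma> (\<lambda>\<tau>. ennreal \<bar>cut a c q \<tau>\<bar>) t \<le> (\<integral>\<^sup>+\<tau>. ennreal B * ennreal \<bar>cut a c q \<tau>\<bar> \<partial>lebesgue)"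
    unfolding nconv_def
  proof (rule nn_integral_mono)
    fix \<tau>
    show "ennreal (rl_kernel \<gamma> (t - \<tau>)) * ennreal \<bar>cut a c q \<tau>\<bar> \<le> ennreal B * ennreal \<bar>cut a c q \<tau>\<bar>"
    proof (cases "\<tau> \<in> {a..c}")
      case True
      have "rl_kernel \<gamma> (t - \<tau>) \<le> B"
        using True assms G by (auto simp: rl_kernel_def B_def intro!: divide_right_mono powr_mono2)
      then show ?thesis by (intro mult_right_mono ennreal_leI) auto
    qed simp
  qed
  also have "\<dots> = ennreal B * (\<integral>\<^sup>+\<tau>. ennreal (norm (cut a c q \<tau>)) \<partial>lebesgue)"
    by (simp add: nn_integral_cmult)
  also have "\<dots> < \<infinity>"
    using q by (auto simp: set_integrable_def integrable_iff_bounded ennreal_mult_less_top)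
  finally show ?thesis .
qed

lemma weighted_cut_finite:
  assumes q: "q absolutely_integrable_on {a..c}" and "0 < \<mu>"
  shows "(\<integral>\<^sup>+t. ennreal (exp (- \<mu> * t)) * ennreal \<bar>cut a c q t\<bar> \<partial>lebesgue) < \<infinity>"
proof -
  note [measurable] = cut_measurable[OF q]
  have "(\<integral>\<^sup>+t. ennreal (exp (- \<mu> * t)) * ennreal \<bar>cut a c q t\<bar> \<partial>lebesgue)
    \<le> (\<integral>\<^sup>+t. ennreal (exp (- \<mu> * a)) * ennreal \<bar>cut a c q t\<bar> \<partial>lebesgue)"
    using assms by (intro nn_integral_mono) (auto simp: indicator_def intro!: mult_right_mono ennreal_leI)
  also have "\<dots> = ennreal (exp (- \<mu> * a)) * (\<integral>\<^sup>+\<tau>. ennreal (norm (cut a c q \<tau>)) \<partial>lebesgue)"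
    by (simp add: nn_integral_cmult)
  also have "\<dots> < \<infinity>"
    using q by (auto simp: set_integrable_def integrable_iff_bounded ennreal_mult_less_top)
  finally show ?thesis .
qed

text \<open>For small orders the kernel is unbounded and finiteness can fail at single points; a
  finite weighted integral still gives it almost everywhere. The rate 1 is an arbitrary positive
  choice.\<close>

lemma nconv_cut_finite_AE:
  assumes q: "q absolutely_integrable_on {a..c}" and "0 < \<gamma>"
  shows "AE t in lebesgue. nconv \<gamma> (\<lambda>\<tau>. ennreal \<bar>cut a c q \<tau>\<bar>) t < \<infinity>"
proof -
  note [measurable] = cut_measurable[OF q]
  have "(\<integral>\<^sup>+t. ennreal (exp (- 1 * t)) * nconv \<gamma> (\<lambda>\<tau>. ennreal \<bar>cut a c q \<tau>\<bar>) t \<partial>lebesgue) \<noteq> \<infinity>"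
    using nconv_weighted_abs[OF assms(2), of 1 "cut a c q"] weighted_cut_finite[OF q, of 1]
    by (auto simp: ennreal_mult_eq_top_iff)
  then have "AE t in lebesgue. ennreal (exp (- 1 * t)) * nconv \<gamma> (\<lambda>\<tau>. ennreal \<bar>cut a c q \<tau>\<bar>) t \<noteq> \<infinity>"
    by (rule nn_integral_PInf_AE[rotated]) (simp add: borel_imp_lebesgue)
  then show ?thesis
    by eventually_elim (auto simp: ennreal_mult_eq_top_iff less_top)
qed

text \<open>The weighted identity with rate 1 bounds the weighted L1 norm over the whole line, and
  up to \<open>d\<close> the factor \<open>exp d\<close> undoes the weight.\<close>

lemma rconv_cut_absolutely_integrable:
  assumes q: "q absolutely_integrable_on {a..c}" and "0 < \<gamma>"
  shows "rconv \<gamma> (cut a c q) absolutely_integrable_on {a..d}"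
  unfolding set_integrable_def
proof (rule integrableI_bounded)
  note [measurable] = cut_measurable[OF q]
  show "(\<lambda>x. indicat_real {a..d} x *\<^sub>R rconv \<gamma> (cut a c q) x) \<in> borel_measurable lebesgue"
    by (intro borel_measurable_scaleR borel_measurable_indicator) (simp_all add: borel_imp_lebesgue)
  have "(\<integral>\<^sup>+x. ennreal (norm (indicat_real {a..d} x *\<^sub>R rconv \<gamma> (cut a c q) x)) \<partial>lebesgue)
    \<le> (\<integral>\<^sup>+x. ennreal (exp d) * (ennreal (exp (- 1 * x)) * nconv \<gamma> (\<lambda>\<tau>. ennreal \<bar>cut a c q \<tau>\<bar>) x) \<partial>lebesgue)"
  proof (rule nn_integral_mono)
    fix x
    show "ennreal (norm (indicat_real {a..d} x *\<^sub>R rconv \<gamma> (cut a c q) x))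
      \<le> ennreal (exp d) * (ennreal (exp (- 1 * x)) * nconv \<gamma> (\<lambda>\<tau>. ennreal \<bar>cut a c q \<tau>\<bar>) x)"
    proof (cases "x \<in> {a..d}")
      case True
      have "ennreal (norm (indicat_real {a..d} x *\<^sub>R rconv \<gamma> (cut a c q) x)) \<le> 1 * nconv \<gamma> (\<lambda>\<tau>. ennreal \<bar>cut a c q \<tau>\<bar>) x"
        using norm_rconv_le[OF assms(2)] True by simp
      also have "\<dots> \<le> ennreal (exp d * exp (- 1 * x)) * nconv \<gamma> (\<lambda>\<tau>. ennreal \<bar>cut a c q \<tau>\<bar>) x"
        using True by (intro mult_right_mono) (auto simp: exp_add[symmetric])
      finally show ?thesis by (simp add: ennreal_mult mult.assoc)
    qed simp
  qed
  also have "\<dots> < \<infinity>"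
    using nconv_weighted_abs[OF assms(2), of 1 "cut a c q"] weighted_cut_finite[OF q, of 1]
    by (subst nn_integral_cmult) (auto simp: ennreal_mult_less_top borel_imp_lebesgue)
  finally show "(\<integral>\<^sup>+x. ennreal (norm (indicat_real {a..d} x *\<^sub>R rconv \<gamma> (cut a c q) x)) \<partial>lebesgue) < \<infinity>" .
qed

text \<open>On \<open>{a..c}\<close> the factor \<open>rl_kernel 1 (c + 1 - x)\<close> is 1, so the
  integral is bounded by an order 1 convolution evaluated at \<open>c + 1\<close>, finite by the
  semigroup law. The shift by 1 keeps the argument positive at \<open>x = c\<close>.\<close>

lemma rl_kernel_absolutely_integrable:
  assumes "0 < \<gamma>"
  shows "(\<lambda>t. rl_kernel \<gamma> (t - a)) absolutely_integrable_on {a..c}"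
  unfolding set_integrable_def
proof (rule integrableI_bounded)
  show "(\<lambda>x. indicat_real {a..c} x *\<^sub>R rl_kernel \<gamma> (x - a)) \<in> borel_measurable lebesgue"
    by (rule borel_imp_lebesgue) simp
  have "(\<integral>\<^sup>+x. ennreal (norm (indicat_real {a..c} x *\<^sub>R rl_kernel \<gamma> (x - a))) \<partial>lebesgue)
    \<le> (\<integral>\<^sup>+x. ennreal (rl_kernel 1 (c + 1 - x)) * ennreal \<bar>rl_kernel \<gamma> (x - a)\<bar> \<partial>lebesgue)"
    by (intro nn_integral_mono) (auto simp: indicator_def rl_kernel_1)
  also have "\<dots> < \<infinity>"
    using rconv_rl_kernel(2)[of 1 \<gamma> a "c + 1"] assms by (simp add: nconv_def)
  finally show "(\<integral>\<^sup>+x. ennreal (norm (indicat_real {a..c} x *\<^sub>R rl_kernel \<gamma> (x - a))) \<partial>lebesgue) < \<infinity>" .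
qed

text \<open>The derivative of the zero function is 0 and, by Lebesgue differentiation, also
  \<open>w t\<close>. Uniqueness of the derivative requires \<open>t\<close> to be a limit point,
  hence the separate case of an interval with at most one point.\<close>

lemma AE_zero_if_integrals_zero:
  fixes w :: "real \<Rightarrow> real"
  assumes "w integrable_on {a..c}" "\<And>t. t \<in> {a..c} \<Longrightarrow> integral {a..t} w = 0"
  shows "AE t in lebesgue. t \<in> {a..c} \<longrightarrow> w t = 0"
proof (cases "a < c")
  case False
  have "AE t in lebesgue. t \<noteq> a"
    using AE_not_in[of "{a}" lebesgue] by simp
  then show ?thesis by eventually_elim (use False in auto)
next
  case True
  show ?thesis
    using AE_has_derivative_integral[OF assms(1)]
  proof eventually_elim
    case (elim t)
    show ?case
    proof
      assume t: "t \<in> {a..c}"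
      have "((\<lambda>s. integral {a..s} w) has_real_derivative w t) (at t within {a..c})"
        using elim t by blast
      then have "((\<lambda>s. 0) has_real_derivative w t) (at t within {a..c})"
        by (rule has_field_derivative_transform_within[OF _ zero_less_one t]) (use assms(2) in auto)
      then show "w t = 0"
        using True t islimpt_Icc[of a c t]
        by (intro has_field_derivative_unique[OF _ DERIV_const]) (auto simp: trivial_limit_within)
    qed
  qed
qed

text \<open>Forwards, the integral of order \<open>1 - \<alpha>\<close> turns the kernel into the
  constant 1 and the convolution into the primitive of \<open>h\<close>. Backwards, the integral of
  order \<alpha> shows that \<open>q\<close> and the right-hand side have the same primitive, and
  primitives determine functions up to null sets.\<close>

lemma rl_convolution_equation:
  fixes q h :: "real \<Rightarrow> real"
  assumes q: "q absolutely_integrable_on {a..c}" and h: "h absolutely_integrable_on {a..c}"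
    and "0 < \<alpha>" "\<alpha> < 1"
  shows "(AE t in lebesgue. t \<in> {a..c} \<longrightarrow> q t = q0 * rl_kernel \<alpha> (t - a) + rconv \<alpha> (cut a c h) t)
    \<longleftrightarrow> (AE t in lebesgue. t \<in> {a..c} \<longrightarrow> rconv (1 - \<alpha>) (cut a c q) t = q0 + integral {a..t} h)"
    (is "?A \<longleftrightarrow> ?B")
proof
  let ?Q = "cut a c q" and ?H = "cut a c h"
  let ?k = "\<lambda>\<gamma> t. rl_kernel \<gamma> (t - a)"
  have Q: "?Q \<in> borel_measurable lebesgue" and H: "?H \<in> borel_measurable lebesgue"
    using q h by (auto intro: cut_measurable)
  have km: "?k \<gamma> \<in> borel_measurable lebesgue" for \<gamma>
    by (rule borel_imp_lebesgue) simp
  have RH: "rconv \<gamma> ?H \<in> borel_measurable lebesgue" for \<gamma>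
    using H by (simp add: borel_imp_lebesgue)
  \<comment> \<open>All compositions below have total order at least 1, so the finiteness conditions
    of linearity and Fubini hold at every \<open>t\<close>.\<close>
  have fin: "nconv \<gamma> (\<lambda>\<tau>. ennreal \<bar>rconv \<beta> ?H \<tau>\<bar>) t < \<infinity>" if "0 < \<gamma>" "0 < \<beta>" "1 \<le> \<gamma> + \<beta>" for \<gamma> \<beta> t
  proof -
    have "nconv \<gamma> (\<lambda>\<tau>. ennreal \<bar>rconv \<beta> ?H \<tau>\<bar>) t \<le> nconv \<gamma> (nconv \<beta> (\<lambda>\<tau>. ennreal \<bar>?H \<tau>\<bar>)) t"
      by (rule nconv_mono_AE) (use norm_rconv_le[OF \<open>0 < \<beta>\<close>] in auto)
    also have "\<dots> < \<infinity>"
      using nconv_cut_finite[OF h that(3)] nconv_nconv_abs[OF that(1,2) H] by simp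
    finally show ?thesis .
  qed
  have conv: "rconv \<gamma> (\<lambda>\<tau>. q0 * ?k \<beta> \<tau> + rconv \<beta> ?H \<tau>) t = q0 * ?k (\<gamma> + \<beta>) t + rconv (\<gamma> + \<beta>) ?H t"
    if "0 < \<gamma>" "0 < \<beta>" "1 \<le> \<gamma> + \<beta>" for \<gamma> \<beta> t
    using rconv_linear[OF that(1) km RH rconv_rl_kernel(2)[OF that(1,2)] fin[OF that]]
      rconv_rl_kernel(1)[OF that(1,2)] rconv_rconv[OF that(1,2) H nconv_cut_finite[OF h that(3)]]
    by simp
  {
    assume A: ?A
    \<comment> \<open>Below \<open>a\<close> all three terms vanish, so the equation extends to the
      whole past of any \<open>t \<le> c\<close>, as the congruence rule demands.\<close>
    have "AE \<tau> in lebesgue. \<tau> \<le> c \<longrightarrow> ?Q \<tau> = q0 * ?k \<alpha> \<tau> + rconv \<alpha> ?H \<tau>"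
      using A
    proof eventually_elim
      case (elim \<tau>)
      then show ?case by (cases "\<tau> < a") (auto simp: rconv_before)
    qed
    then have *: "AE \<tau> in lebesgue. \<tau> < t \<longrightarrow> ?Q \<tau> = q0 * ?k \<alpha> \<tau> + rconv \<alpha> ?H \<tau>" if "t \<le> c" for t
      by eventually_elim (use that in auto)
    \<comment> \<open>The point \<open>a\<close> is left out because \<open>rl_kernel 1 0\<close> is
      0 and not 1.\<close>
    have "rconv (1 - \<alpha>) ?Q t = q0 + integral {a..t} h" if t: "t \<in> {a<..c}" for t
    proof -
      have "rconv (1 - \<alpha>) ?Q t = rconv (1 - \<alpha>) (\<lambda>\<tau>. q0 * ?k \<alpha> \<tau> + rconv \<alpha> ?H \<tau>) t"
        by (rule rconv_cong_AE) (use Q km RH * t in auto)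
      also have "\<dots> = q0 * ?k 1 t + rconv 1 ?H t"
        using conv[of "1 - \<alpha>" \<alpha> t] assms by simp
      finally show ?thesis
        using t rconv_1[OF h, of t] by (simp add: rl_kernel_1)
    qed
    moreover have "AE t in lebesgue. t \<noteq> a"
      using AE_not_in[of "{a}" lebesgue] by simp
    ultimately show ?B
      by (auto elim!: eventually_mono)
  next
    assume B: ?B
    have "AE t in lebesgue. t \<noteq> a"
      using AE_not_in[of "{a}" lebesgue] by simp
    then have "AE \<tau> in lebesgue. \<tau> \<le> c \<longrightarrow> rconv (1 - \<alpha>) ?Q \<tau> = q0 * ?k 1 \<tau> + rconv 1 ?H \<tau>"
      using B
    proof eventually_elim
      case (elim \<tau>)
      then show ?case
        using rconv_1[OF h, of \<tau>] by (cases "\<tau> < a") (auto simp: rconv_before rl_kernel_1)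
    qed
    then have *: "AE \<tau> in lebesgue. \<tau> < t \<longrightarrow> rconv (1 - \<alpha>) ?Q \<tau> = q0 * ?k 1 \<tau> + rconv 1 ?H \<tau>" if "t \<le> c" for t
      by eventually_elim (use that in auto)
    let ?Z = "\<lambda>t. q0 * ?k \<alpha> t + rconv \<alpha> ?H t"
    have Z: "?Z absolutely_integrable_on {a..c}"
      using rl_kernel_absolutely_integrable[OF assms(3)] rconv_cut_absolutely_integrable[OF h assms(3)]
      by (intro set_integral_add(1) set_integrable_mult_right) auto
    \<comment> \<open>Both primitives are brought to the order \<open>\<alpha> + 1\<close> form,
      which is then read as the order 1 integral of \<open>?Z\<close>.\<close>
    have eq: "integral {a..t} (\<lambda>s. q s - ?Z s) = 0" if t: "t \<in> {a..c}" for t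
    proof -
      have "integral {a..t} q = rconv 1 ?Q t"
        using rconv_1[OF q, of t] t by simp
      also have "\<dots> = rconv \<alpha> (rconv (1 - \<alpha>) ?Q) t"
        using rconv_rconv[of \<alpha> "1 - \<alpha>" ?Q t] nconv_cut_finite[OF q, of 1 t] assms Q by simp
      also have "\<dots> = rconv \<alpha> (\<lambda>\<tau>. q0 * ?k 1 \<tau> + rconv 1 ?H \<tau>) t"
        by (rule rconv_cong_AE)
          (use Q km RH * t in \<open>auto simp: borel_imp_lebesgue intro!: borel_measurable_add borel_measurable_times\<close>)
      also have "\<dots> = q0 * ?k (\<alpha> + 1) t + rconv (\<alpha> + 1) ?H t"
        using conv[of \<alpha> 1 t] assms by simp
      also have "\<dots> = rconv 1 ?Z t"
        using conv[of 1 \<alpha> t] assms by (simp add: add.commute)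
      also have "\<dots> = rconv 1 (cut a c ?Z) t"
      proof (rule rconv_cong_AE)
        show "AE \<tau> in lebesgue. \<tau> < t \<longrightarrow> ?Z \<tau> = cut a c ?Z \<tau>"
        proof (rule AE_I2)
          fix \<tau>
          show "\<tau> < t \<longrightarrow> ?Z \<tau> = cut a c ?Z \<tau>"
            by (cases "\<tau> < a") (use t in \<open>simp_all add: rconv_before\<close>)
        qed
      qed (use km RH in \<open>auto intro!: borel_measurable_times borel_measurable_indicator\<close>)
      also have "\<dots> = integral {a..t} ?Z"
        using rconv_1[OF Z, of t] t by simp
      finally have "integral {a..t} q = integral {a..t} ?Z" .
      moreover have "q integrable_on {a..t}" "?Z integrable_on {a..t}"
        using set_lebesgue_integral_eq_integral(1)[OF q] set_lebesgue_integral_eq_integral(1)[OF Z] t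
        by (auto intro: integrable_subinterval_real)
      ultimately show ?thesis by (simp add: Henstock_Kurzweil_Integration.integral_diff)
    qed
    have "AE t in lebesgue. t \<in> {a..c} \<longrightarrow> q t - ?Z t = 0"
      by (rule AE_zero_if_integrals_zero)
        (use eq set_lebesgue_integral_eq_integral(1)[OF q] set_lebesgue_integral_eq_integral(1)[OF Z] in
          \<open>auto intro!: integrable_diff\<close>)
    then show ?A by eventually_elim auto
  }
qed

section \<open>Equivalence with the Volterra equation\<close>

lemma intervals_from_subset:
  assumes "I \<in> intervals_from a" "c \<in> I"
  shows "{a..c} \<subseteq> I"
proof
  fix t assume "t \<in> {a..c}"
  then show "t \<in> I"
    using assms mem_is_interval_1_I[of I a c t] by (simp add: intervals_from_def psubset_eq)
qed

lemma intervals_from_le: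
  assumes "I \<in> intervals_from a" "c \<in> I"
  shows "a \<le> c"
  using assms unfolding intervals_from_def by auto

lemma intervals_from_beyond:
  assumes "I \<in> intervals_from a" "t \<in> I"
  obtains c where "c \<in> I" "t \<le> c" "a < c"
proof -
  have "\<exists>b\<in>I. a < b"
    using assms(1) unfolding intervals_from_def by force
  then show ?thesis using that assms(2) by (metis linear order_less_le_trans order_refl)
qed

text \<open>Half-open pieces with rational right ends exhaust \<open>I\<close> except for its
  maximum, if it has one; \<open>N\<close> takes up that point. This treats bounded, unbounded, open
  and closed right ends at once.\<close>

lemma intervals_from_cover:
  assumes I: "I \<in> intervals_from a"
  obtains C N where "countable C" "C \<subseteq> I" "finite N" "I = (\<Union>c\<in>C. {a..<c}) \<union> N"
proof
  let ?C = "I \<inter> \<rat>" and ?N = "{t \<in> I. \<forall>s\<in>I. s \<le> t}"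
  show "countable ?C" using countable_rat by blast
  show "?C \<subseteq> I" by simp
  show "finite ?N"
  proof (cases "?N = {}")
    case False
    then obtain t where "t \<in> ?N" by blast
    then have "?N \<subseteq> {t}" by (auto intro: antisym)
    then show ?thesis by (rule finite_subset) simp
  next
    case True
    show ?thesis unfolding True by simp
  qed
  show "I = (\<Union>c\<in>?C. {a..<c}) \<union> ?N"
  proof (intro equalityI subsetI)
    fix t assume t: "t \<in> I"
    show "t \<in> (\<Union>c\<in>?C. {a..<c}) \<union> ?N"
    proof (cases "t \<in> ?N")
      case False
      then obtain s where s: "s \<in> I" "t < s" using t by (auto simp: not_le)
      obtain r where r: "r \<in> \<rat>" "t < r" "r < s" using Rats_dense_in_real[OF s(2)] by blast
      have "r \<in> I" using intervals_from_subset[OF I s(1)] intervals_from_le[OF I t] r by auto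
      then show ?thesis using r intervals_from_le[OF I t] by auto
    qed blast
  next
    fix t assume "t \<in> (\<Union>c\<in>?C. {a..<c}) \<union> ?N"
    then show "t \<in> I" using intervals_from_subset[OF I] by fastforce
  qed
qed

lemma intervals_from_lebesgue:
  assumes I: "I \<in> intervals_from a"
  shows "I \<in> sets lebesgue"
proof -
  obtain C N where "countable C" "finite N" "I = (\<Union>c\<in>C. {a..<c}) \<union> N"
    using intervals_from_cover[OF I] by metis
  then have "I \<in> sets borel" by (auto intro!: sets.Un sets.countable_UN' simp: finite_imp_closed)
  then show ?thesis by simp
qed

lemma AE_lebesgue_on_iff:
  assumes I: "I \<in> intervals_from a"
  shows "(AE t in lebesgue_on I. P t) \<longleftrightarrow> (AE t in lebesgue. t \<in> I \<longrightarrow> P t)"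
  using intervals_from_lebesgue[OF I] by (subst AE_restrict_space_iff) auto

text \<open>The hypothesis excludes \<open>c\<close> because a derivative within
  \<open>{a..c}\<close> is one within \<open>I\<close> only at points \<open>t < c\<close>.\<close>

lemma AE_intervals_fromI:
  assumes I: "I \<in> intervals_from a"
    and *: "\<And>c. c \<in> I \<Longrightarrow> AE t in lebesgue. t \<in> {a..<c} \<longrightarrow> P t"
  shows "AE t in lebesgue. t \<in> I \<longrightarrow> P t"
proof -
  obtain C N where C: "countable C" "C \<subseteq> I" "finite N" "I = (\<Union>c\<in>C. {a..<c}) \<union> N"
    using intervals_from_cover[OF I] .
  have "AE t in lebesgue. \<forall>c\<in>C. t \<in> {a..<c} \<longrightarrow> P t"
    unfolding AE_ball_countable[OF C(1)] using C(2) * by blast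
  moreover have "AE t in lebesgue. t \<notin> N"
    using C(3) negligible_finite[of N] unfolding negligible_iff_null_sets by (intro AE_not_in) auto
  ultimately show ?thesis
    by eventually_elim (use C(4) in blast)
qed

lemma AE_intervals_from_iff:
  assumes I: "I \<in> intervals_from a"
  shows "(AE t in lebesgue_on I. P t) \<longleftrightarrow> (\<forall>c\<in>I. AE t in lebesgue. t \<in> {a..c} \<longrightarrow> P t)"
proof
  assume "AE t in lebesgue_on I. P t"
  then have *: "AE t in lebesgue. t \<in> I \<longrightarrow> P t" by (simp add: AE_lebesgue_on_iff[OF I])
  show "\<forall>c\<in>I. AE t in lebesgue. t \<in> {a..c} \<longrightarrow> P t"
  proof
    fix c assume "c \<in> I"
    then have sub: "{a..c} \<subseteq> I" by (rule intervals_from_subset[OF I])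
    show "AE t in lebesgue. t \<in> {a..c} \<longrightarrow> P t"
      using * by eventually_elim (use sub in blast)
  qed
next
  assume *: "\<forall>c\<in>I. AE t in lebesgue. t \<in> {a..c} \<longrightarrow> P t"
  have "AE t in lebesgue. t \<in> I \<longrightarrow> P t"
  proof (rule AE_intervals_fromI[OF I])
    fix c assume "c \<in> I"
    with * have "AE t in lebesgue. t \<in> {a..c} \<longrightarrow> P t" by blast
    then show "AE t in lebesgue. t \<in> {a..<c} \<longrightarrow> P t" by eventually_elim auto
  qed
  then show "AE t in lebesgue_on I. P t" by (simp add: AE_lebesgue_on_iff[OF I])
qed

lemma L1_loc_iff:
  assumes I: "I \<in> intervals_from a"
  shows "q \<in> L1_loc I \<longleftrightarrow> (\<forall>c\<in>I. q absolutely_integrable_on {a..c})"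
proof
  assume "q \<in> L1_loc I"
  then show "\<forall>c\<in>I. q absolutely_integrable_on {a..c}"
    using intervals_from_le[OF I] intervals_from_subset[OF I] by (auto simp: L1_loc_def)
next
  assume *: "\<forall>c\<in>I. q absolutely_integrable_on {a..c}"
  show "q \<in> L1_loc I"
    unfolding L1_loc_def
  proof (intro CollectI allI impI)
    fix c d assume cd: "c \<le> d \<and> {c..d} \<subseteq> I"
    then have "c \<in> I" "d \<in> I" by auto
    then show "q absolutely_integrable_on {c..d}"
      using * intervals_from_le[OF I, of c] by (elim ballE[of _ _ d] set_integrable_subset) auto
  qed
qed

text \<open>A continuous nonnegative function with integral 0 over a nondegenerate interval
  vanishes. The bound \<open>c\<close> beyond \<open>t\<close> provides such an interval even for
  \<open>t = a\<close>.\<close>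

lemma continuous_AE_eq_imp_eq:
  fixes f g :: "real \<Rightarrow> real"
  assumes I: "I \<in> intervals_from a" and f: "continuous_on I f" and g: "continuous_on I g"
    and eq: "AE t in lebesgue_on I. f t = g t" and t: "t \<in> I"
  shows "f t = g t"
proof -
  obtain c where c: "c \<in> I" "t \<le> c" "a < c" using intervals_from_beyond[OF I t] .
  have sub: "{a..c} \<subseteq> I" using intervals_from_subset[OF I c(1)] .
  have cont: "continuous_on {a..c} (\<lambda>s. \<bar>f s - g s\<bar>)"
    using f g sub by (auto intro!: continuous_intros intro: continuous_on_subset)
  have "AE s in lebesgue. s \<in> {a..c} \<longrightarrow> f s = g s"
    using eq c(1) by (simp add: AE_intervals_from_iff[OF I])
  then obtain N where N: "N \<in> null_sets lebesgue" "{s. \<not> (s \<in> {a..c} \<longrightarrow> f s = g s)} \<subseteq> N"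
    unfolding eventually_ae_filter by auto
  have "((\<lambda>s. \<bar>f s - g s\<bar>) has_integral 0) {a..c}"
    by (rule has_integral_spike[of N _ _ "\<lambda>s. 0"]) (use N in \<open>auto simp: negligible_iff_null_sets\<close>)
  then have "integral {a..c} (\<lambda>s. \<bar>f s - g s\<bar>) = 0" by (rule integral_unique)
  then have "\<bar>f t - g t\<bar> = 0"
    using integral_eq_0_iff[OF cont] c t intervals_from_le[OF I t] by auto
  then show ?thesis by simp
qed

section \<open>Local absolute continuity and the integrated equation\<close>

lemma AC_on_subset_cong:
  assumes "\<And>t. t \<in> T \<Longrightarrow> f t = g t" "f \<in> AC_on S" "T \<subseteq> S"
  shows "g \<in> AC_on T"
  unfolding AC_on_def
proof (intro CollectI allI impI)
  fix \<epsilon> :: real assume "\<epsilon> > 0"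
  obtain \<delta> where "\<delta> > 0" and \<delta>: "\<And>P. finite P \<Longrightarrow> (\<forall>(u, v)\<in>P. u \<le> v \<and> {u..v} \<subseteq> S) \<Longrightarrow>
      disjoint_family_on (\<lambda>(u, v). {u<..<v}) P \<Longrightarrow> (\<Sum>(u, v)\<in>P. v - u) < \<delta> \<Longrightarrow>
      (\<Sum>(u, v)\<in>P. \<bar>f v - f u\<bar>) < \<epsilon>"
    by (rule AC_onD[OF assms(2) \<open>\<epsilon> > 0\<close>], rule that)
  show "\<exists>\<delta>>0. \<forall>P. finite P \<and> (\<forall>(u, v)\<in>P. u \<le> v \<and> {u..v} \<subseteq> T) \<and>
      disjoint_family_on (\<lambda>(u, v). {u<..<v}) P \<and> (\<Sum>(u, v)\<in>P. v - u) < \<delta> \<longrightarrow>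
      (\<Sum>(u, v)\<in>P. \<bar>g v - g u\<bar>) < \<epsilon>"
  proof (intro exI conjI allI impI)
    show "\<delta> > 0" by fact
    fix P :: "(real \<times> real) set"
    assume P: "finite P \<and> (\<forall>(u, v)\<in>P. u \<le> v \<and> {u..v} \<subseteq> T) \<and>
      disjoint_family_on (\<lambda>(u, v). {u<..<v}) P \<and> (\<Sum>(u, v)\<in>P. v - u) < \<delta>"
    have "(\<Sum>(u, v)\<in>P. \<bar>g v - g u\<bar>) = (\<Sum>(u, v)\<in>P. \<bar>f v - f u\<bar>)"
    proof (rule sum.cong[OF refl])
      fix z assume z: "z \<in> P"
      obtain u v where uv: "z = (u, v)" by (cases z)
      then have "u \<in> T" "v \<in> T" using P z by fastforce+
      then show "(case z of (u, v) \<Rightarrow> \<bar>g v - g u\<bar>) = (case z of (u, v) \<Rightarrow> \<bar>f v - f u\<bar>)"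
        using assms(1) by (simp add: uv)
    qed
    moreover have "\<forall>(u, v)\<in>P. u \<le> v \<and> {u..v} \<subseteq> S" using P assms(3) by blast
    ultimately show "(\<Sum>(u, v)\<in>P. \<bar>g v - g u\<bar>) < \<epsilon>" using \<delta>[of P] P by simp
  qed
qed

lemma AC_on_imp_continuous_on:
  assumes g: "g \<in> AC_on {c..d}"
  shows "continuous_on {c..d} g"
  unfolding continuous_on_iff
proof (intro ballI allI impI)
  fix x \<epsilon> :: real assume x: "x \<in> {c..d}" and "\<epsilon> > 0"
  obtain \<delta> where "\<delta> > 0" and \<delta>: "\<And>P. finite P \<Longrightarrow> (\<forall>(u, v)\<in>P. u \<le> v \<and> {u..v} \<subseteq> {c..d}) \<Longrightarrow>
      disjoint_family_on (\<lambda>(u, v). {u<..<v}) P \<Longrightarrow> (\<Sum>(u, v)\<in>P. v - u) < \<delta> \<Longrightarrow>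
      (\<Sum>(u, v)\<in>P. \<bar>g v - g u\<bar>) < \<epsilon>"
    by (rule AC_onD[OF g \<open>\<epsilon> > 0\<close>], rule that)
  show "\<exists>d'>0. \<forall>y\<in>{c..d}. dist y x < d' \<longrightarrow> dist (g y) (g x) < \<epsilon>"
  proof (intro exI conjI ballI impI)
    show "\<delta> > 0" by fact
    fix y assume y: "y \<in> {c..d}" "dist y x < \<delta>"
    have "\<bar>g (max x y) - g (min x y)\<bar> < \<epsilon>"
    proof -
      have "max x y - min x y < \<delta>" using y(2) by (auto simp: dist_real_def min_def max_def)
      then show ?thesis
        using \<delta>[of "{(min x y, max x y)}"] x y(1) by (auto simp: disjoint_family_on_def)
    qed
    then show "dist (g y) (g x) < \<epsilon>"
      by (cases "x \<le> y") (auto simp: dist_real_def min_def max_def abs_minus_commute)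
  qed
qed

text \<open>Continuity on \<open>{a..s}\<close> with \<open>s\<close> beyond \<open>t\<close> is
  continuity within \<open>I\<close>, as the two filters at \<open>t\<close> agree. If no such
  \<open>s\<close> exists, \<open>I\<close> itself is \<open>{a..t}\<close>.\<close>

lemma AC_loc_imp_continuous_on:
  assumes I: "I \<in> intervals_from a" and g: "g \<in> AC_loc I"
  shows "continuous_on I g"
  unfolding continuous_on_eq_continuous_within
proof
  fix t assume t: "t \<in> I"
  show "continuous (at t within I) g"
  proof (cases "\<exists>s\<in>I. t < s")
    case True
    then obtain s where s: "s \<in> I" "t < s" by blast
    have "continuous_on {a..s} g"
      using g intervals_from_le[OF I s(1)] intervals_from_subset[OF I s(1)]
      by (intro AC_on_imp_continuous_on) (auto simp: AC_loc_def)
    then have "continuous (at t within {a..s}) g"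
      using s t intervals_from_le[OF I t] by (auto simp: continuous_on_eq_continuous_within)
    moreover have "at t within {a..s} = at t within I"
      using s intervals_from_le[OF I] intervals_from_subset[OF I s(1)]
      by (intro at_within_nhd[of t "{..<s}"]) (auto simp: subset_iff)
    ultimately show ?thesis by simp
  next
    case False
    then have "I = {a..t}"
      using intervals_from_le[OF I] intervals_from_subset[OF I t] by (auto simp: not_less)
    moreover have "continuous_on {a..t} g"
      using g intervals_from_le[OF I t] intervals_from_subset[OF I t]
      by (intro AC_on_imp_continuous_on) (auto simp: AC_loc_def)
    ultimately show ?thesis using t by (simp add: continuous_on_eq_continuous_within)
  qed
qed

lemma AC_loc_integral:
  assumes I: "I \<in> intervals_from a" and h: "h \<in> L1_loc I"
  shows "(\<lambda>t. q0 + integral {a..t} h) \<in> AC_loc I"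
  unfolding AC_loc_def
proof (intro CollectI allI impI)
  fix c d assume cd: "c \<le> d \<and> {c..d} \<subseteq> I"
  then have "c \<in> I" "d \<in> I" by auto
  then have "(\<lambda>t. q0 + integral {a..t} h) \<in> AC_on {a..d}"
    using h by (intro AC_on_integral) (simp add: L1_loc_iff[OF I])
  then show "(\<lambda>t. q0 + integral {a..t} h) \<in> AC_on {c..d}"
    by (rule AC_on_subset_cong[rotated]) (use intervals_from_le[OF I \<open>c \<in> I\<close>] in auto)
qed

text \<open>Regularity, initial value and derivative together say that the representative is the
  primitive of \<open>h\<close> starting at \<open>q0\<close>. Only the almost everywhere form on
  the right is accessible to convolution identities.\<close>

lemma rl_integral_conditions_iff:
  assumes I: "I \<in> intervals_from a" and h: "h \<in> L1_loc I"
  shows "rl_integral I a \<beta> q \<in> AC_loc I \<and> rl_integral I a \<beta> q a = q0 \<and>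
      (AE t in lebesgue_on I. (rl_integral I a \<beta> q has_real_derivative h t) (at t within I))
    \<longleftrightarrow> (AE t in lebesgue_on I. rl_integral_raw a \<beta> q t = q0 + integral {a..t} h)"
    (is "?L \<longleftrightarrow> ?R")
proof
  let ?G = "rl_integral I a \<beta> q"
  assume L: ?L
  then have "continuous_on I ?G" using AC_loc_imp_continuous_on[OF I] by blast
  \<comment> \<open>Absolute continuity makes \<open>?G\<close> continuous, so it is a continuous
    representative in either branch of its definition.\<close>
  have "is_continuous_rep I (rl_integral_raw a \<beta> q) ?G"
  proof (cases "\<exists>g. is_continuous_rep I (rl_integral_raw a \<beta> q) g")
    case True
    then show ?thesis unfolding rl_integral_def by (simp add: someI_ex)
  next
    case False
    then have "?G = rl_integral_raw a \<beta> q" by (simp add: rl_integral_def)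
    with \<open>continuous_on I ?G\<close> show ?thesis by (simp add: is_continuous_rep_def)
  qed
  then have rep: "AE t in lebesgue_on I. ?G t = rl_integral_raw a \<beta> q t"
    by (simp add: is_continuous_rep_def)
  have eq: "?G t = q0 + integral {a..t} h" if t: "t \<in> I" for t
  proof -
    have "(h has_integral (?G t - ?G a)) {a..t}"
    proof (rule AC_on_has_integral_derivative)
      show "?G \<in> AC_on {a..t}" "a \<le> t"
        using L t intervals_from_le[OF I t] intervals_from_subset[OF I t] by (auto simp: AC_loc_def)
      have "AE s in lebesgue. s \<in> {a..t} \<longrightarrow> (?G has_real_derivative h s) (at s within I)"
        using L t by (simp add: AE_intervals_from_iff[OF I])
      then show "AE s in lebesgue. s \<in> {a..t} \<longrightarrow> (?G has_real_derivative h s) (at s within {a..t})"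
        by eventually_elim (use intervals_from_subset[OF I t] in \<open>auto intro: has_field_derivative_subset\<close>)
    qed
    then show ?thesis using L by (auto dest: integral_unique)
  qed
  have "AE t in lebesgue_on I. t \<in> I" by (simp add: AE_lebesgue_on_iff[OF I])
  with rep show ?R by eventually_elim (simp add: eq)
next
  let ?G = "rl_integral I a \<beta> q" and ?F = "\<lambda>t. q0 + integral {a..t} h"
  assume R: ?R
  have AC0: "?F \<in> AC_loc I" using AC_loc_integral[OF I h] .
  then have cont0: "continuous_on I ?F" using AC_loc_imp_continuous_on[OF I] by blast
  \<comment> \<open>The primitive is a continuous representative, so the definition takes the choice
    branch, and by uniqueness the chosen function agrees with the primitive on all of
    \<open>I\<close>, in particular at \<open>a\<close>.\<close>
  then have ex: "is_continuous_rep I (rl_integral_raw a \<beta> q) ?F"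
    using R by (auto simp: is_continuous_rep_def elim!: eventually_mono)
  then have "is_continuous_rep I (rl_integral_raw a \<beta> q) ?G"
    unfolding rl_integral_def by (metis (mono_tags, lifting) someI_ex)
  then have G: "continuous_on I ?G" "AE t in lebesgue_on I. ?G t = rl_integral_raw a \<beta> q t"
    by (auto simp: is_continuous_rep_def)
  have AEeq: "AE t in lebesgue_on I. ?F t = ?G t"
    using G(2) R by eventually_elim simp
  have eq: "?F t = ?G t" if "t \<in> I" for t
    using continuous_AE_eq_imp_eq[OF I cont0 G(1) AEeq that] .
  have aI: "a \<in> I" using I by (auto simp: intervals_from_def)
  have G_AC: "?G \<in> AC_loc I"
    unfolding AC_loc_def mem_Collect_eq
  proof (intro allI impI)
    fix c d assume cd: "c \<le> d \<and> {c..d} \<subseteq> I"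
    then have "?F \<in> AC_on {c..d}" using AC0 unfolding AC_loc_def by blast
    then show "?G \<in> AC_on {c..d}"
      by (rule AC_on_subset_cong[rotated]) (use eq cd in auto)
  qed
  have Ga: "?G a = q0" using eq[OF aI] by simp
  have "AE t in lebesgue. t \<in> I \<longrightarrow> (?G has_real_derivative h t) (at t within I)"
  proof (rule AE_intervals_fromI[OF I])
    fix c assume c: "c \<in> I"
    have "h integrable_on {a..c}"
      using h c by (intro set_lebesgue_integral_eq_integral(1)) (simp add: L1_loc_iff[OF I])
    from AE_has_derivative_integral[OF this]
    show "AE t in lebesgue. t \<in> {a..<c} \<longrightarrow> (?G has_real_derivative h t) (at t within I)"
    proof eventually_elim
      case (elim t)
      show ?case
      proof
        assume t: "t \<in> {a..<c}"
        then have tI: "t \<in> I" using intervals_from_subset[OF I c] by auto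
        have "(?F has_real_derivative 0 + h t) (at t within {a..c})"
          using elim t by (intro DERIV_add DERIV_const) auto
        moreover have "at t within {a..c} = at t within I"
          using t intervals_from_le[OF I] intervals_from_subset[OF I c]
          by (intro at_within_nhd[of t "{..<c}"]) (auto simp: subset_iff)
        ultimately have "(?F has_real_derivative h t) (at t within I)" by simp
        then show "(?G has_real_derivative h t) (at t within I)"
          by (rule has_field_derivative_transform_within[OF _ zero_less_one tI]) (rule eq)
      qed
    qed
  qed
  then have "AE t in lebesgue_on I. (?G has_real_derivative h t) (at t within I)"
    by (simp add: AE_lebesgue_on_iff[OF I])
  with G_AC Ga show ?L by (intro conjI)
qed

text \<open>At \<alpha> = 1 the complementary order is 0, which is not a kernel convolution. There
  both equations already agree, except possibly at \<open>t = a\<close>, where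
  \<open>rl_kernel 1\<close> is 0.\<close>

lemma rl_cauchy_iff_convolution:
  assumes I: "I \<in> intervals_from a" and q: "q \<in> L1_loc I" and h: "h \<in> L1_loc I"
    and \<alpha>: "0 < \<alpha>" "\<alpha> \<le> 1"
  shows "q \<in> AC_frac I a \<alpha> \<and> rl_integral I a (1 - \<alpha>) q a = q0 \<and>
      (AE t in lebesgue_on I. has_rl_derivative I a \<alpha> q (h t) t)
    \<longleftrightarrow> (AE t in lebesgue_on I. q t = q0 * rl_kernel \<alpha> (t - a) + rl_integral_raw a \<alpha> h t)"
proof -
  have "(AE t in lebesgue_on I. rl_integral_raw a (1 - \<alpha>) q t = q0 + integral {a..t} h)
    \<longleftrightarrow> (AE t in lebesgue_on I. q t = q0 * rl_kernel \<alpha> (t - a) + rl_integral_raw a \<alpha> h t)"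
    unfolding AE_intervals_from_iff[OF I]
  proof (rule ball_cong[OF refl])
    fix c assume c: "c \<in> I"
    have qc: "q absolutely_integrable_on {a..c}" and hc: "h absolutely_integrable_on {a..c}"
      using q h c by (auto simp: L1_loc_iff[OF I])
    have ne: "AE t in lebesgue. t \<noteq> a"
      using AE_not_in[of "{a}" lebesgue] by simp
    have h_eq: "rl_integral_raw a \<alpha> h t = rconv \<alpha> (cut a c h) t" if "t \<in> {a..c}" for t
      using that \<alpha> by (intro rl_integral_raw_eq_rconv) auto
    show "(AE t in lebesgue. t \<in> {a..c} \<longrightarrow> rl_integral_raw a (1 - \<alpha>) q t = q0 + integral {a..t} h)
      \<longleftrightarrow> (AE t in lebesgue. t \<in> {a..c} \<longrightarrow> q t = q0 * rl_kernel \<alpha> (t - a) + rl_integral_raw a \<alpha> h t)"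
    proof (cases "\<alpha> = 1")
      case True
      have "rl_integral_raw a 1 h t = integral {a..t} h" if "t \<in> {a..c}" for t
        using h_eq[OF that] rconv_1[OF hc, of t] that True by simp
      then have eqv: "t \<noteq> a \<Longrightarrow> (t \<in> {a..c} \<longrightarrow> rl_integral_raw a (1 - \<alpha>) q t = q0 + integral {a..t} h)
        \<longleftrightarrow> (t \<in> {a..c} \<longrightarrow> q t = q0 * rl_kernel \<alpha> (t - a) + rl_integral_raw a \<alpha> h t)" for t
        using True by (auto simp: rl_integral_raw_def[of a 0] rl_kernel_1)
      show ?thesis
        by (rule eventually_subst) (use ne in eventually_elim, rule eqv)
    next
      case False
      have q_eq: "rl_integral_raw a (1 - \<alpha>) q t = rconv (1 - \<alpha>) (cut a c q) t" if "t \<in> {a..c}" for t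
        using that \<alpha> False by (intro rl_integral_raw_eq_rconv) auto
      show ?thesis
        using rl_convolution_equation[OF qc hc, of \<alpha> q0] \<alpha> False h_eq q_eq
        by (simp cong: imp_cong)
    qed
  qed
  then show ?thesis
    using rl_integral_conditions_iff[OF I h, of "1 - \<alpha>" q q0] q
    by (auto simp: AC_frac_def has_rl_derivative_def)
qed

section \<open>Superposition operators and limits of iterates\<close>

lemma borel_measurable_lebesgue_AE:
  fixes f g :: "real \<Rightarrow> 'b::topological_space"
  assumes f: "f \<in> borel_measurable lebesgue" and eq: "AE t in lebesgue. f t = g t"
  shows "g \<in> borel_measurable lebesgue"
proof (rule measurableI)
  fix A :: "'b set" assume A: "A \<in> sets borel"
  have "f -` A \<inter> space lebesgue \<in> sets lebesgue" using f A by (rule measurable_sets)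
  moreover have "AE t in lebesgue. t \<in> f -` A \<inter> space lebesgue \<longleftrightarrow> t \<in> g -` A \<inter> space lebesgue"
    using eq by eventually_elim auto
  ultimately show "g -` A \<inter> space lebesgue \<in> sets lebesgue"
    using completion.in_sets_AE by blast
qed simp

text \<open>Along simple functions approximating \<open>q\<close> the composition is a finite sum
  over the attained states, hence measurable; continuity in the state carries this to the
  limit.\<close>

lemma caratheodory_compose_measurable:
  fixes f :: "'b::euclidean_space \<Rightarrow> real \<Rightarrow> 'c::euclidean_space"
  assumes f: "\<And>x. (\<lambda>t. indicator S t *\<^sub>R f x t) \<in> borel_measurable lebesgue"
    and cont: "AE t in lebesgue. t \<in> S \<longrightarrow> continuous_on UNIV (\<lambda>x. f x t)"
    and q: "(\<lambda>t. indicator S t *\<^sub>R q t) \<in> borel_measurable lebesgue"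
  shows "(\<lambda>t. indicator S t *\<^sub>R f (q t) t) \<in> borel_measurable lebesgue"
proof -
  obtain s where s: "\<And>i. simple_function lebesgue (s i)"
      "\<And>t. (\<lambda>i. s i t) \<longlonglongrightarrow> indicator S t *\<^sub>R q t"
    using borel_measurable_implies_sequence_metric[OF q, of 0] by auto
  have m: "(\<lambda>t. indicator S t *\<^sub>R f (s i t) t) \<in> borel_measurable lebesgue" for i
  proof -
    have fin: "finite (range (s i))" using simple_functionD(1)[OF s(1)[of i]] by simp
    have eq: "(\<lambda>t. indicator S t *\<^sub>R f (s i t) t)
      = (\<lambda>t. \<Sum>x\<in>range (s i). indicator (s i -` {x}) t *\<^sub>R (indicator S t *\<^sub>R f x t))"
    proof
      fix t
      have "(\<Sum>x\<in>range (s i). indicator (s i -` {x}) t *\<^sub>R (indicator S t *\<^sub>R f x t))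
        = (\<Sum>x\<in>range (s i). if x = s i t then indicator S t *\<^sub>R f x t else 0)"
        by (rule sum.cong) (auto simp: indicator_def)
      also have "\<dots> = indicator S t *\<^sub>R f (s i t) t"
        using fin by (simp add: sum.delta)
      finally show "indicator S t *\<^sub>R f (s i t) t
        = (\<Sum>x\<in>range (s i). indicator (s i -` {x}) t *\<^sub>R (indicator S t *\<^sub>R f x t))" by simp
    qed
    have "s i -` {x} \<in> sets lebesgue" for x
      using simple_functionD(2)[OF s(1)[of i], of "{x}"] by simp
    then show ?thesis
      unfolding eq by (intro borel_measurable_sum borel_measurable_scaleR borel_measurable_indicator f) auto
  qed
  obtain N where N: "N \<in> null_sets lebesgue" "{t. \<not> (t \<in> S \<longrightarrow> continuous_on UNIV (\<lambda>x. f x t))} \<subseteq> N"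
    using cont unfolding eventually_ae_filter by auto
  define g where "g t = indicator (- N) t *\<^sub>R (indicator S t *\<^sub>R f (q t) t)" for t
  have Nm: "- N \<in> sets lebesgue" using N(1) by (metis Compl_in_sets_lebesgue null_setsD2)
  have "g \<in> borel_measurable lebesgue"
  proof (rule borel_measurable_LIMSEQ_metric)
    show "(\<lambda>t. indicator (- N) t *\<^sub>R (indicator S t *\<^sub>R f (s i t) t)) \<in> borel_measurable lebesgue" for i
      by (rule borel_measurable_scaleR[OF borel_measurable_indicator[OF Nm] m])
    fix t
    show "(\<lambda>i. indicator (- N) t *\<^sub>R (indicator S t *\<^sub>R f (s i t) t)) \<longlonglongrightarrow> g t"
    proof (cases "t \<in> S \<and> t \<notin> N")
      case True
      then have "continuous_on UNIV (\<lambda>x. f x t)" using N(2) by auto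
      then have "isCont (\<lambda>x. f x t) (q t)" by (simp add: continuous_on_eq_continuous_at)
      moreover have "(\<lambda>i. s i t) \<longlonglongrightarrow> q t" using s(2)[of t] True by simp
      ultimately have "(\<lambda>i. f (s i t) t) \<longlonglongrightarrow> f (q t) t"
        by (rule isCont_tendsto_compose)
      then show ?thesis using True by (simp add: g_def)
    qed (auto simp: g_def indicator_def)
  qed
  moreover have "AE t in lebesgue. g t = indicator S t *\<^sub>R f (q t) t"
    using AE_not_in[OF N(1)] by eventually_elim (simp add: g_def)
  ultimately show ?thesis by (rule borel_measurable_lebesgue_AE)
qed

text \<open>The exceptional null set of the hypothesis may depend on the two states.\<close>

lemma AE_Lipschitz_uniform:
  fixes f :: "'b::euclidean_space \<Rightarrow> real \<Rightarrow> 'c::euclidean_space"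
  assumes lip: "\<And>x y. AE t in lebesgue. t \<in> S \<longrightarrow> norm (f y t - f x t) \<le> L * norm (y - x)"
    and cont: "AE t in lebesgue. t \<in> S \<longrightarrow> continuous_on UNIV (\<lambda>x. f x t)"
  shows "AE t in lebesgue. t \<in> S \<longrightarrow> (\<forall>x y. norm (f y t - f x t) \<le> L * norm (y - x))"
proof -
  \<comment> \<open>The countably many pairs from a dense set share one null set; continuity in the
    state extends the inequality to all pairs.\<close>
  obtain D :: "'b set" where D: "countable D" "\<And>X. open X \<Longrightarrow> X \<noteq> {} \<Longrightarrow> \<exists>d\<in>D. d \<in> X"
    by (erule countable_dense_setE)
  have "x \<in> closure D" for x
    unfolding closure_approachable
  proof (intro allI impI)
    fix e :: real assume "e > 0"
    then show "\<exists>y\<in>D. dist y x < e" using D(2)[of "ball x e"] by (auto simp: dist_commute)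
  qed
  then have dense: "\<exists>s. (\<forall>n. s n \<in> D) \<and> s \<longlonglongrightarrow> x" for x by (simp add: closure_sequential)
  have "AE t in lebesgue. \<forall>x\<in>D. \<forall>y\<in>D. t \<in> S \<longrightarrow> norm (f y t - f x t) \<le> L * norm (y - x)"
    unfolding AE_ball_countable[OF D(1)] using lip by blast
  then show ?thesis using cont
  proof eventually_elim
    case (elim t)
    show ?case
    proof (intro impI allI)
      fix x y assume t: "t \<in> S"
      obtain u v where u: "\<And>n. u n \<in> D" "u \<longlonglongrightarrow> x" and v: "\<And>n. v n \<in> D" "v \<longlonglongrightarrow> y"
        using dense by metis
      have c: "isCont (\<lambda>x. f x t) z" for z
        using elim(2) t by (simp add: continuous_on_eq_continuous_at)
      have "(\<lambda>n. norm (f (v n) t - f (u n) t)) \<longlonglongrightarrow> norm (f y t - f x t)"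
        by (intro tendsto_norm tendsto_diff isCont_tendsto_compose[OF c] u v)
      moreover have "(\<lambda>n. L * norm (v n - u n)) \<longlonglongrightarrow> L * norm (y - x)"
        by (intro tendsto_mult tendsto_const tendsto_norm tendsto_diff u v)
      moreover have "norm (f (v n) t - f (u n) t) \<le> L * norm (v n - u n)" for n
        using elim(1) t u(1) v(1) by blast
      ultimately show "norm (f y t - f x t) \<le> L * norm (y - x)"
        by (intro LIMSEQ_le) auto
    qed
  qed
qed

text \<open>The series of the norms of the increments has a finite integral, so it converges almost
  everywhere, and its tail dominates the distance to the limit; the factor 2 is the sum of the
  geometric series. Where the sequence diverges \<open>lim\<close> is unspecified, but only on a
  null set.\<close>

lemma geometric_L1_limit:
  fixes u :: "nat \<Rightarrow> 'a \<Rightarrow> 'b::{banach, second_countable_topology}"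
  assumes m [measurable]: "\<And>n. u n \<in> borel_measurable M" and "0 \<le> D"
    and bound: "\<And>n. (\<integral>\<^sup>+x. ennreal (norm (u (Suc n) x - u n x)) \<partial>M) \<le> ennreal (D * (1/2) ^ n)"
  shows "AE x in M. convergent (\<lambda>n. u n x)"
    and "(\<integral>\<^sup>+x. ennreal (norm (lim (\<lambda>n. u n x) - u n x)) \<partial>M) \<le> ennreal (2 * D * (1/2) ^ n)"
proof -
  define d where "d k x = ennreal (norm (u (Suc k) x - u k x))" for k x
  have [measurable]: "d k \<in> borel_measurable M" for k unfolding d_def by measurable
  have S: "(\<integral>\<^sup>+x. (\<Sum>k. d (k + n) x) \<partial>M) \<le> ennreal (2 * D * (1/2) ^ n)" for n
  proof -
    have "(\<integral>\<^sup>+x. (\<Sum>k. d (k + n) x) \<partial>M) = (\<Sum>k. \<integral>\<^sup>+x. d (k + n) x \<partial>M)"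
      by (intro nn_integral_suminf) measurable
    also have "\<dots> \<le> (\<Sum>k. ennreal (D * (1/2) ^ (k + n)))"
      using bound by (intro suminf_le) (auto simp: d_def)
    also have "\<dots> = ennreal (\<Sum>k. D * (1/2) ^ (k + n))"
      using \<open>0 \<le> D\<close> by (intro suminf_ennreal2) (auto simp: power_add intro!: summable_mult summable_mult2)
    also have "(\<Sum>k. D * (1/2) ^ (k + n)) = 2 * D * (1/2 :: real) ^ n"
    proof -
      have "(\<lambda>k. (D * (1/2) ^ n) * (1/2 :: real) ^ k) sums ((D * (1/2) ^ n) * (1 / (1 - 1/2)))"
        by (intro sums_mult geometric_sums) auto
      then show ?thesis by (simp add: power_add mult_ac sums_iff)
    qed
    finally show ?thesis .
  qed
  have fin: "AE x in M. (\<Sum>k. d k x) \<noteq> \<infinity>"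
  proof (rule nn_integral_PInf_AE)
    have "(\<integral>\<^sup>+x. (\<Sum>k. d k x) \<partial>M) \<le> ennreal (2 * D)" using S[of 0] by simp
    then show "(\<integral>\<^sup>+x. (\<Sum>k. d k x) \<partial>M) \<noteq> \<infinity>" by (auto simp: top_unique)
  qed measurable
  have sm: "summable (\<lambda>k. norm (u (Suc k) x - u k x))" if "(\<Sum>k. d k x) \<noteq> \<infinity>" for x
    using that unfolding d_def by (intro summable_suminf_not_top) auto
  have tel: "(\<lambda>k. u (Suc k) x - u k x) sums (lim (\<lambda>n. u n x) - u 0 x)" "convergent (\<lambda>n. u n x)"
    if "(\<Sum>k. d k x) \<noteq> \<infinity>" for x
  proof -
    have "summable (\<lambda>k. u (Suc k) x - u k x)"
      using summable_norm_cancel[OF sm[OF that]] .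
    then obtain l where l: "(\<lambda>k. u (Suc k) x - u k x) sums l" by (auto simp: summable_def)
    then have "(\<lambda>n. u n x - u 0 x) \<longlonglongrightarrow> l"
      by (simp add: sums_def sum_lessThan_telescope[of "\<lambda>i. u i x"])
    then have "(\<lambda>n. u n x - u 0 x + u 0 x) \<longlonglongrightarrow> l + u 0 x"
      by (intro tendsto_add tendsto_const)
    then have lim: "(\<lambda>n. u n x) \<longlonglongrightarrow> l + u 0 x" by simp
    then show "convergent (\<lambda>n. u n x)" by (auto simp: convergent_def)
    show "(\<lambda>k. u (Suc k) x - u k x) sums (lim (\<lambda>n. u n x) - u 0 x)"
      using l limI[OF lim] by simp
  qed
  show "AE x in M. convergent (\<lambda>n. u n x)"
    using fin by eventually_elim (rule tel(2))
  have "(\<integral>\<^sup>+x. ennreal (norm (lim (\<lambda>n. u n x) - u n x)) \<partial>M) \<le> (\<integral>\<^sup>+x. (\<Sum>k. d (k + n) x) \<partial>M)"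
  proof (rule nn_integral_mono_AE)
    show "AE x in M. ennreal (norm (lim (\<lambda>n. u n x) - u n x)) \<le> (\<Sum>k. d (k + n) x)"
      using fin
    proof eventually_elim
      case (elim x)
      have s1: "summable (\<lambda>k. norm (u (Suc (k + n)) x - u (k + n) x))"
        using summable_ignore_initial_segment[OF sm[OF elim], of n] by simp
      have "(\<lambda>k. u (Suc (k + n)) x - u (k + n) x) sums
          (lim (\<lambda>n. u n x) - u 0 x - (\<Sum>k<n. u (Suc k) x - u k x))"
        using sums_split_initial_segment[OF tel(1)[OF elim], of n] by simp
      then have "lim (\<lambda>n. u n x) - u n x = (\<Sum>k. u (Suc (k + n)) x - u (k + n) x)"
        by (simp add: sums_iff sum_lessThan_telescope[of "\<lambda>i. u i x"])
      then have "norm (lim (\<lambda>n. u n x) - u n x) \<le> (\<Sum>k. norm (u (Suc (k + n)) x - u (k + n) x))"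
        using summable_norm[OF s1] by simp
      then have "ennreal (norm (lim (\<lambda>n. u n x) - u n x)) \<le> ennreal (\<Sum>k. norm (u (Suc (k + n)) x - u (k + n) x))"
        by (rule ennreal_leI)
      also have "\<dots> = (\<Sum>k. d (k + n) x)"
        unfolding d_def using s1 by (intro suminf_ennreal2[symmetric]) auto
      finally show ?case .
    qed
  qed
  also have "\<dots> \<le> ennreal (2 * D * (1/2) ^ n)" by (rule S)
  finally show "(\<integral>\<^sup>+x. ennreal (norm (lim (\<lambda>n. u n x) - u n x)) \<partial>M) \<le> ennreal (2 * D * (1/2) ^ n)" .
qed

lemma absolutely_integrable_vec_iff:
  fixes q :: "real \<Rightarrow> real ^ 'm"
  shows "q absolutely_integrable_on S \<longleftrightarrow> (\<forall>i. (\<lambda>t. q t $ i) absolutely_integrable_on S)"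
proof (intro iffI allI)
  fix i assume q: "q absolutely_integrable_on S"
  have "integrable lebesgue (\<lambda>t. (indicator S t *\<^sub>R q t) \<bullet> axis i 1)"
    using q unfolding set_integrable_def by (rule integrable_inner_left)
  then show "(\<lambda>t. q t $ i) absolutely_integrable_on S"
    by (simp add: set_integrable_def inner_axis)
next
  assume q: "\<forall>i. (\<lambda>t. q t $ i) absolutely_integrable_on S"
  have "integrable lebesgue (\<lambda>t. \<Sum>i\<in>UNIV. (indicator S t *\<^sub>R (q t $ i)) *\<^sub>R axis i (1::real))"
    using q unfolding set_integrable_def by (intro Bochner_Integration.integrable_sum integrable_scaleR_left) auto
  moreover have "(\<Sum>i\<in>UNIV. (indicator S t *\<^sub>R (q t $ i)) *\<^sub>R axis i (1::real)) = indicator S t *\<^sub>R q t" for t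
    using basis_expansion[of "q t"] by (simp add: scalar_mult_eq_scaleR scaleR_sum_right[symmetric] scaleR_scaleR[symmetric] del: scaleR_scaleR)
  ultimately show "q absolutely_integrable_on S" by (simp add: set_integrable_def)
qed

section \<open>The Picard operator\<close>

definition rl_picard ::
  "real \<Rightarrow> real ^ 'm \<Rightarrow> real ^ 'm \<Rightarrow> (real ^ 'm \<Rightarrow> real \<Rightarrow> real ^ 'm) \<Rightarrow> (real \<Rightarrow> real ^ 'm) \<Rightarrow> real \<Rightarrow> real ^ 'm"
  where "rl_picard a \<alpha> qa f q t =
    (\<chi> i. qa $ i * rl_kernel (\<alpha> $ i) (t - a) + rl_integral_raw a (\<alpha> $ i) (\<lambda>s. f (q s) s $ i) t)"

text \<open>An L1 analogue of Bielecki's norm. Values in \<open>ennreal\<close> keep a divergent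
  integral visible as infinity, and the indicator confines everything to
  \<open>{a..c}\<close>.\<close>

definition weighted_norm :: "real \<Rightarrow> real \<Rightarrow> real \<Rightarrow> (real \<Rightarrow> 'b::real_normed_vector) \<Rightarrow> ennreal" where
  "weighted_norm \<mu> a c p =
    (\<integral>\<^sup>+t. ennreal (exp (- \<mu> * t)) * ennreal (norm (indicator {a..c} t *\<^sub>R p t)) \<partial>lebesgue)"

lemma weighted_norm_measurable:
  fixes p :: "real \<Rightarrow> 'b::{second_countable_topology, real_normed_vector}"
  assumes "(\<lambda>t. indicator {a..c} t *\<^sub>R p t) \<in> borel_measurable lebesgue"
  shows "(\<lambda>t. ennreal (exp (- \<mu> * t)) * ennreal (norm (indicator {a..c} t *\<^sub>R p t))) \<in> borel_measurable lebesgue"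
proof (rule borel_measurable_times_ennreal)
  show "(\<lambda>t. ennreal (exp (- \<mu> * t))) \<in> borel_measurable lebesgue"
    by (rule borel_imp_lebesgue) measurable
  show "(\<lambda>t. ennreal (norm (indicator {a..c} t *\<^sub>R p t))) \<in> borel_measurable lebesgue"
    using measurable_compose[OF assms, of "\<lambda>x. ennreal (norm x)" borel] by measurable
qed

lemma weighted_norm_finite:
  assumes "p absolutely_integrable_on {a..c}" "0 < \<mu>"
  shows "weighted_norm \<mu> a c p < \<infinity>"
proof -
  have "(\<lambda>t. norm (p t)) absolutely_integrable_on {a..c}"
    using set_integrable_norm[OF assms(1)] .
  then have "(\<integral>\<^sup>+t. ennreal (exp (- \<mu> * t)) * ennreal \<bar>cut a c (\<lambda>t. norm (p t)) t\<bar> \<partial>lebesgue) < \<infinity>"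
    by (rule weighted_cut_finite) fact
  then show ?thesis by (simp add: weighted_norm_def abs_mult)
qed

lemma absolutely_integrable_weighted_norm:
  fixes p :: "real \<Rightarrow> 'b::euclidean_space"
  assumes m: "(\<lambda>t. indicator {a..c} t *\<^sub>R p t) \<in> borel_measurable lebesgue"
    and "weighted_norm \<mu> a c p < \<infinity>" "0 < \<mu>"
  shows "p absolutely_integrable_on {a..c}"
  unfolding set_integrable_def
proof (rule integrableI_bounded[OF m])
  have "(\<integral>\<^sup>+t. ennreal (norm (indicator {a..c} t *\<^sub>R p t)) \<partial>lebesgue)
    \<le> (\<integral>\<^sup>+t. ennreal (exp (\<mu> * c)) * (ennreal (exp (- \<mu> * t)) * ennreal (norm (indicator {a..c} t *\<^sub>R p t))) \<partial>lebesgue)"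
  proof (rule nn_integral_mono)
    fix t
    show "ennreal (norm (indicator {a..c} t *\<^sub>R p t))
      \<le> ennreal (exp (\<mu> * c)) * (ennreal (exp (- \<mu> * t)) * ennreal (norm (indicator {a..c} t *\<^sub>R p t)))"
    proof (cases "t \<in> {a..c}")
      case True
      then have "1 \<le> exp (\<mu> * c) * exp (- \<mu> * t)"
        using assms(3) by (simp add: exp_add[symmetric])
      then have "1 * norm (p t) \<le> exp (\<mu> * c) * exp (- \<mu> * t) * norm (p t)"
        by (rule mult_right_mono) simp
      then show ?thesis using True by (simp add: ennreal_mult[symmetric] mult.assoc ennreal_leI)
    qed simp
  qed
  also have "\<dots> = ennreal (exp (\<mu> * c)) * weighted_norm \<mu> a c p"
    unfolding weighted_norm_def by (intro nn_integral_cmult weighted_norm_measurable m)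
  also have "\<dots> < \<infinity>" using assms(2) by (simp add: ennreal_mult_less_top)
  finally show "(\<integral>\<^sup>+t. ennreal (norm (indicator {a..c} t *\<^sub>R p t)) \<partial>lebesgue) < \<infinity>" .
qed

lemma weighted_norm_eq_0_imp:
  fixes p :: "real \<Rightarrow> 'b::euclidean_space"
  assumes m: "p absolutely_integrable_on {a..c}" and "weighted_norm \<mu> a c p = 0"
  shows "AE t in lebesgue. t \<in> {a..c} \<longrightarrow> p t = 0"
proof -
  have "(\<lambda>t. indicator {a..c} t *\<^sub>R p t) \<in> borel_measurable lebesgue"
    using m unfolding set_integrable_def by (rule borel_measurable_integrable)
  then have "AE t in lebesgue. ennreal (exp (- \<mu> * t)) * ennreal (norm (indicator {a..c} t *\<^sub>R p t)) = 0"
    using assms(2) unfolding weighted_norm_def by (simp only: nn_integral_0_iff_AE[OF weighted_norm_measurable])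
  then show ?thesis by eventually_elim auto
qed

lemma weighted_norm_cong_AE:
  assumes "AE t in lebesgue. t \<in> {a..c} \<longrightarrow> p t = q t"
  shows "weighted_norm \<mu> a c p = weighted_norm \<mu> a c q"
  unfolding weighted_norm_def
  by (rule nn_integral_cong_AE) (use assms in \<open>eventually_elim, auto simp: indicator_def\<close>)

lemma weighted_norm_triangle:
  fixes p q r :: "real \<Rightarrow> 'b::euclidean_space"
  assumes "p absolutely_integrable_on {a..c}" "q absolutely_integrable_on {a..c}" "r absolutely_integrable_on {a..c}"
  shows "weighted_norm \<mu> a c (\<lambda>t. p t - r t)
    \<le> weighted_norm \<mu> a c (\<lambda>t. p t - q t) + weighted_norm \<mu> a c (\<lambda>t. q t - r t)"
proof -
  have m: "(\<lambda>t. indicator {a..c} t *\<^sub>R (x t - y t)) \<in> borel_measurable lebesgue"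
    if "x absolutely_integrable_on {a..c}" "y absolutely_integrable_on {a..c}" for x y :: "real \<Rightarrow> 'b"
    using set_integral_diff(1)[OF that] unfolding set_integrable_def by (rule borel_measurable_integrable)
  have "weighted_norm \<mu> a c (\<lambda>t. p t - r t)
    \<le> (\<integral>\<^sup>+t. ennreal (exp (- \<mu> * t)) * ennreal (norm (indicator {a..c} t *\<^sub>R (p t - q t)))
        + ennreal (exp (- \<mu> * t)) * ennreal (norm (indicator {a..c} t *\<^sub>R (q t - r t))) \<partial>lebesgue)"
    unfolding weighted_norm_def
  proof (rule nn_integral_mono)
    fix t
    have "norm (indicator {a..c} t *\<^sub>R (p t - r t))
      \<le> norm (indicator {a..c} t *\<^sub>R (p t - q t)) + norm (indicator {a..c} t *\<^sub>R (q t - r t))"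
      using norm_triangle_ineq[of "p t - q t" "q t - r t"] by (cases "t \<in> {a..c}") simp_all
    then show "ennreal (exp (- \<mu> * t)) * ennreal (norm (indicator {a..c} t *\<^sub>R (p t - r t)))
      \<le> ennreal (exp (- \<mu> * t)) * ennreal (norm (indicator {a..c} t *\<^sub>R (p t - q t)))
        + ennreal (exp (- \<mu> * t)) * ennreal (norm (indicator {a..c} t *\<^sub>R (q t - r t)))"
      by (simp only: distrib_left[symmetric] ennreal_plus[symmetric] norm_ge_zero)
         (intro mult_left_mono ennreal_leI, auto)
  qed
  also have "\<dots> = weighted_norm \<mu> a c (\<lambda>t. p t - q t) + weighted_norm \<mu> a c (\<lambda>t. q t - r t)"
    unfolding weighted_norm_def
    by (intro nn_integral_add weighted_norm_measurable m assms)
  finally show ?thesis .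
qed

section \<open>The fixed point problem: contraction, uniqueness and existence\<close>

locale rl_cauchy_problem =
  fixes a :: real and I :: "real set"
    and f :: "real ^ 'm \<Rightarrow> real \<Rightarrow> real ^ 'm" and qa \<alpha> :: "real ^ 'm"
  assumes I: "I \<in> intervals_from a"
    and caratheodory: "caratheodory I f"
    and order: "\<And>i. 0 < \<alpha> $ i \<and> \<alpha> $ i \<le> 1"
    and f0: "(\<lambda>t. f 0 t) \<in> L1_loc I"
    and lip: "\<And>c d. c \<le> d \<Longrightarrow> {c..d} \<subseteq> I \<Longrightarrow>
           \<exists>L\<ge>0. \<forall>x1 x2. AE t in lebesgue_on {c..d}. norm (f x2 t - f x1 t) \<le> L * norm (x2 - x1)"
begin

abbreviation "T \<equiv> rl_picard a \<alpha> qa f"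

lemma lipschitz:
  assumes c: "c \<in> I"
  obtains L where "0 \<le> L"
    "AE t in lebesgue. t \<in> {a..c} \<longrightarrow> (\<forall>x y. norm (f y t - f x t) \<le> L * norm (y - x))"
proof -
  obtain L where L: "L \<ge> 0"
    "\<forall>x1 x2. AE t in lebesgue_on {a..c}. norm (f x2 t - f x1 t) \<le> L * norm (x2 - x1)"
    using lip[OF intervals_from_le[OF I c] intervals_from_subset[OF I c]] by blast
  have "AE t in lebesgue. t \<in> {a..c} \<longrightarrow> (\<forall>x y. norm (f y t - f x t) \<le> L * norm (y - x))"
  proof (rule AE_Lipschitz_uniform)
    show "AE t in lebesgue. t \<in> {a..c} \<longrightarrow> norm (f y t - f x t) \<le> L * norm (y - x)" for x y
      using L(2) by (simp add: AE_restrict_space_iff)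
    show "AE t in lebesgue. t \<in> {a..c} \<longrightarrow> continuous_on UNIV (\<lambda>x. f x t)"
      using caratheodory c by (simp add: caratheodory_def AE_intervals_from_iff[OF I])
  qed
  then show ?thesis using that L(1) by blast
qed

text \<open>Comparison with the state 0 gives linear growth: the norm of \<open>f (q t) t\<close> is
  at most that of \<open>f 0 t\<close> plus \<open>L\<close> times that of
  \<open>q t\<close>.\<close>

lemma superposition_L1_loc:
  assumes q: "q \<in> L1_loc I"
  shows "(\<lambda>t. f (q t) t) \<in> L1_loc I"
  unfolding L1_loc_iff[OF I]
proof
  fix c assume c: "c \<in> I"
  have qc: "q absolutely_integrable_on {a..c}" and f0c: "f 0 absolutely_integrable_on {a..c}"
    using q f0 c by (auto simp: L1_loc_iff[OF I])
  obtain L where L: "0 \<le> L"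
    "AE t in lebesgue. t \<in> {a..c} \<longrightarrow> (\<forall>x y. norm (f y t - f x t) \<le> L * norm (y - x))"
    using lipschitz[OF c] .
  have m: "(\<lambda>t. indicator {a..c} t *\<^sub>R f (q t) t) \<in> borel_measurable lebesgue"
  proof (rule caratheodory_compose_measurable[where f = f and q = q])
    fix x
    have "(\<lambda>t. indicator I t *\<^sub>R f x t) \<in> borel_measurable lebesgue"
      using caratheodory intervals_from_lebesgue[OF I]
      by (subst (asm) caratheodory_def) (auto simp: borel_measurable_restrict_space_iff)
    then have "(\<lambda>t. indicator {a..c} t *\<^sub>R (indicator I t *\<^sub>R f x t)) \<in> borel_measurable lebesgue"
      by (rule borel_measurable_scaleR[OF borel_measurable_indicator, rotated]) simp
    also have "(\<lambda>t. indicator {a..c} t *\<^sub>R (indicator I t *\<^sub>R f x t)) = (\<lambda>t. indicator {a..c} t *\<^sub>R f x t)"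
      using intervals_from_subset[OF I c] by (auto simp: fun_eq_iff indicator_def)
    finally show "(\<lambda>t. indicator {a..c} t *\<^sub>R f x t) \<in> borel_measurable lebesgue" .
  next
    show "AE t in lebesgue. t \<in> {a..c} \<longrightarrow> continuous_on UNIV (\<lambda>x. f x t)"
      using caratheodory c by (simp add: caratheodory_def AE_intervals_from_iff[OF I])
    show "(\<lambda>t. indicator {a..c} t *\<^sub>R q t) \<in> borel_measurable lebesgue"
      using qc unfolding set_integrable_def by (rule borel_measurable_integrable)
  qed
  have "integrable lebesgue (\<lambda>t. norm (indicator {a..c} t *\<^sub>R f 0 t) + L * norm (indicator {a..c} t *\<^sub>R q t))"
    using qc f0c unfolding set_integrable_def
    by (intro Bochner_Integration.integrable_add integrable_mult_right integrable_norm)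
  then show "(\<lambda>t. f (q t) t) absolutely_integrable_on {a..c}"
    unfolding set_integrable_def
  proof (rule Bochner_Integration.integrable_bound[OF _ m])
    show "AE t in lebesgue. norm (indicator {a..c} t *\<^sub>R f (q t) t)
      \<le> norm (norm (indicator {a..c} t *\<^sub>R f 0 t) + L * norm (indicator {a..c} t *\<^sub>R q t))"
      using L(2)
    proof eventually_elim
      case (elim t)
      show ?case
      proof (cases "t \<in> {a..c}")
        case True
        then have "norm (f (q t) t - f 0 t) \<le> L * norm (q t - 0)" using elim by blast
        then have "norm (f (q t) t) \<le> norm (f 0 t) + L * norm (q t)"
          using norm_triangle_sub[of "f (q t) t" "f 0 t"] by simp
        then show ?thesis using True L(1) by simp
      qed simp
    qed
  qed
qed

lemma rl_picard_component:
  assumes "t \<le> c"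
  shows "T q t $ i = qa $ i * rl_kernel (\<alpha> $ i) (t - a) + rconv (\<alpha> $ i) (cut a c (\<lambda>s. f (q s) s $ i)) t"
  using rl_integral_raw_eq_rconv[of "\<alpha> $ i" t c] order[of i] assms by (simp add: rl_picard_def)

lemma superposition_component:
  assumes "q \<in> L1_loc I" "c \<in> I"
  shows "(\<lambda>s. f (q s) s $ i) absolutely_integrable_on {a..c}"
  using superposition_L1_loc[OF assms(1)] assms(2) unfolding L1_loc_iff[OF I] absolutely_integrable_vec_iff by blast

lemma rl_picard_L1_loc:
  assumes q: "q \<in> L1_loc I"
  shows "T q \<in> L1_loc I"
  unfolding L1_loc_iff[OF I] absolutely_integrable_vec_iff
proof (intro ballI allI)
  fix c i assume c: "c \<in> I"
  have "(\<lambda>t. qa $ i * rl_kernel (\<alpha> $ i) (t - a) + rconv (\<alpha> $ i) (cut a c (\<lambda>s. f (q s) s $ i)) t)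
    absolutely_integrable_on {a..c}"
    using order[of i] superposition_component[OF q c]
    by (intro set_integral_add(1) set_integrable_mult_right rl_kernel_absolutely_integrable
      rconv_cut_absolutely_integrable) auto
  then show "(\<lambda>t. T q t $ i) absolutely_integrable_on {a..c}"
    by (rule set_integrable_cong[THEN iffD1, rotated -1]) (auto simp: rl_picard_component)
qed

text \<open>The linear equivalence is applied in each component with \<open>h\<close> taken as
  \<open>f (q t) t $ i\<close>, which is locally integrable once \<open>q\<close> is. For
  \<open>q\<close> outside \<open>L1_loc\<close> both sides are false.\<close>

lemma solution_iff_fixed_point:
  "is_solution I a \<alpha> f qa q \<longleftrightarrow> q \<in> L1_loc I \<and> (AE t in lebesgue_on I. q t = T q t)"
proof -
  have L1: "q \<in> L1_loc I \<longleftrightarrow> (\<forall>i. (\<lambda>t. q t $ i) \<in> L1_loc I)"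
    unfolding L1_loc_iff[OF I] absolutely_integrable_vec_iff[where q = q] by blast
  have AE_all: "(AE t in lebesgue_on I. \<forall>i. P i t) \<longleftrightarrow> (\<forall>i. AE t in lebesgue_on I. P i t)" for P :: "'m \<Rightarrow> real \<Rightarrow> bool"
    by (rule AE_all_countable)
  show ?thesis
  proof (cases "q \<in> L1_loc I")
    case False
    then show ?thesis using L1 by (auto simp: is_solution_def AC_frac_def)
  next
    case True
    have "is_solution I a \<alpha> f qa q \<longleftrightarrow> (\<forall>i. (\<lambda>t. q t $ i) \<in> AC_frac I a (\<alpha> $ i) \<and>
        rl_integral I a (1 - \<alpha> $ i) (\<lambda>t. q t $ i) a = qa $ i \<and>
        (AE t in lebesgue_on I. has_rl_derivative I a (\<alpha> $ i) (\<lambda>t. q t $ i) (f (q t) t $ i) t))"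
      unfolding is_solution_def AE_all by blast
    also have "\<dots> \<longleftrightarrow> (\<forall>i. AE t in lebesgue_on I. q t $ i = T q t $ i)"
    proof (rule iff_allI)
      fix i
      have "(\<lambda>t. q t $ i) \<in> L1_loc I" using True L1 by blast
      moreover have "(\<lambda>t. f (q t) t $ i) \<in> L1_loc I"
        using superposition_component[OF True] by (simp add: L1_loc_iff[OF I])
      ultimately show "((\<lambda>t. q t $ i) \<in> AC_frac I a (\<alpha> $ i) \<and>
          rl_integral I a (1 - \<alpha> $ i) (\<lambda>t. q t $ i) a = qa $ i \<and>
          (AE t in lebesgue_on I. has_rl_derivative I a (\<alpha> $ i) (\<lambda>t. q t $ i) (f (q t) t $ i) t))
        \<longleftrightarrow> (AE t in lebesgue_on I. q t $ i = T q t $ i)"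
        using rl_cauchy_iff_convolution[OF I, of "\<lambda>t. q t $ i" "\<lambda>t. f (q t) t $ i" "\<alpha> $ i" "qa $ i"] order[of i]
        by (simp add: rl_picard_def)
    qed
    also have "\<dots> \<longleftrightarrow> (AE t in lebesgue_on I. q t = T q t)"
      unfolding AE_all[symmetric] vec_eq_iff ..
    finally show ?thesis using True by simp
  qed
qed

text \<open>Bounding the Euclidean norm by the sum of the components, the weighted identity gives
  the factor \<open>\<mu> powr - (\<alpha> $ i)\<close> for each one; bounding each component of the
  difference of \<open>f\<close> by its norm brings in \<open>L\<close>.\<close>

lemma picard_Lipschitz:
  assumes c: "c \<in> I" and L: "0 \<le> L"
    "AE t in lebesgue. t \<in> {a..c} \<longrightarrow> (\<forall>x y. norm (f y t - f x t) \<le> L * norm (y - x))"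
    and "0 < \<mu>" and p: "p \<in> L1_loc I" and q: "q \<in> L1_loc I"
  shows "weighted_norm \<mu> a c (\<lambda>t. T p t - T q t)
    \<le> ennreal ((\<Sum>i\<in>UNIV. \<mu> powr - (\<alpha> $ i)) * L) * weighted_norm \<mu> a c (\<lambda>t. p t - q t)"
proof -
  define P where "P i = cut a c (\<lambda>s. f (p s) s $ i)" for i
  define Q where "Q i = cut a c (\<lambda>s. f (q s) s $ i)" for i
  define G where "G i = cut a c (\<lambda>s. f (p s) s $ i - f (q s) s $ i)" for i
  have fp: "(\<lambda>s. f (p s) s $ i) absolutely_integrable_on {a..c}"
    and fq: "(\<lambda>s. f (q s) s $ i) absolutely_integrable_on {a..c}" for i
    using superposition_component p q c by auto
  have Pm: "P i \<in> borel_measurable lebesgue" and Qm: "Q i \<in> borel_measurable lebesgue" for i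
    unfolding P_def Q_def by (rule cut_measurable[OF fp], rule cut_measurable[OF fq])
  have Gm: "G i \<in> borel_measurable lebesgue" for i
    unfolding G_def by (rule cut_measurable) (intro set_integral_diff(1) fp fq)
  have pq: "(\<lambda>t. p t - q t) absolutely_integrable_on {a..c}"
    using p q c unfolding L1_loc_iff[OF I] by (intro set_integral_diff(1)) auto
  have pqm: "(\<lambda>t. indicator {a..c} t *\<^sub>R (p t - q t)) \<in> borel_measurable lebesgue"
    using pq unfolding set_integrable_def by (rule borel_measurable_integrable)
  have GPQ: "G i = (\<lambda>\<tau>. - 1 * Q i \<tau> + P i \<tau>)" for i
    by (simp add: G_def P_def Q_def fun_eq_iff algebra_simps)
  have pos: "0 < \<alpha> $ i" for i using order[of i] by simp
  \<comment> \<open>The difference of two convolutions is the convolution of the difference only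
    where both converge absolutely.\<close>
  have "AE t in lebesgue. \<forall>i. nconv (\<alpha> $ i) (\<lambda>\<tau>. ennreal \<bar>P i \<tau>\<bar>) t < \<infinity> \<and>
      nconv (\<alpha> $ i) (\<lambda>\<tau>. ennreal \<bar>Q i \<tau>\<bar>) t < \<infinity>"
    unfolding AE_all_countable
  proof
    fix i
    show "AE t in lebesgue. nconv (\<alpha> $ i) (\<lambda>\<tau>. ennreal \<bar>P i \<tau>\<bar>) t < \<infinity> \<and>
      nconv (\<alpha> $ i) (\<lambda>\<tau>. ennreal \<bar>Q i \<tau>\<bar>) t < \<infinity>"
      using nconv_cut_finite_AE[OF fp pos, of i i] nconv_cut_finite_AE[OF fq pos, of i i]
      unfolding P_def Q_def by eventually_elim blast
  qed
  then have "AE t in lebesgue. ennreal (exp (- \<mu> * t)) * ennreal (norm (indicator {a..c} t *\<^sub>R (T p t - T q t)))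
    \<le> (\<Sum>i\<in>UNIV. ennreal (exp (- \<mu> * t)) * nconv (\<alpha> $ i) (\<lambda>\<tau>. ennreal \<bar>G i \<tau>\<bar>) t)"
  proof eventually_elim
    case (elim t)
    show ?case
    proof (cases "t \<in> {a..c}")
      case True
      then have tc: "t \<le> c" by simp
      have "(T p t - T q t) $ i = rconv (\<alpha> $ i) (G i) t" for i
      proof -
        have "rconv (\<alpha> $ i) (G i) t = - 1 * rconv (\<alpha> $ i) (Q i) t + rconv (\<alpha> $ i) (P i) t"
          unfolding GPQ by (rule rconv_linear) (use pos Pm Qm elim in auto)
        moreover have "T p t $ i - T q t $ i = rconv (\<alpha> $ i) (P i) t - rconv (\<alpha> $ i) (Q i) t"
          unfolding rl_picard_component[OF tc] P_def Q_def by simp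
        ultimately show ?thesis by simp
      qed
      then have "norm (T p t - T q t) \<le> (\<Sum>i\<in>UNIV. \<bar>rconv (\<alpha> $ i) (G i) t\<bar>)"
        using norm_le_l1_cart[of "T p t - T q t"] by simp
      then have "ennreal (norm (T p t - T q t)) \<le> (\<Sum>i\<in>UNIV. ennreal \<bar>rconv (\<alpha> $ i) (G i) t\<bar>)"
        by (simp add: sum_ennreal ennreal_leI)
      also have "\<dots> \<le> (\<Sum>i\<in>UNIV. nconv (\<alpha> $ i) (\<lambda>\<tau>. ennreal \<bar>G i \<tau>\<bar>) t)"
        by (intro sum_mono norm_rconv_le pos)
      finally show ?thesis
        using True by (simp add: sum_distrib_left[symmetric] mult_left_mono)
    qed simp
  qed
  then have "weighted_norm \<mu> a c (\<lambda>t. T p t - T q t)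
    \<le> (\<integral>\<^sup>+t. (\<Sum>i\<in>UNIV. ennreal (exp (- \<mu> * t)) * nconv (\<alpha> $ i) (\<lambda>\<tau>. ennreal \<bar>G i \<tau>\<bar>) t) \<partial>lebesgue)"
    unfolding weighted_norm_def by (rule nn_integral_mono_AE)
  also have "\<dots> = (\<Sum>i\<in>UNIV. \<integral>\<^sup>+t. ennreal (exp (- \<mu> * t)) * nconv (\<alpha> $ i) (\<lambda>\<tau>. ennreal \<bar>G i \<tau>\<bar>) t \<partial>lebesgue)"
    by (intro nn_integral_sum borel_measurable_times_ennreal borel_imp_lebesgue nconv_abs_measurable Gm) measurable
  also have "\<dots> = (\<Sum>i\<in>UNIV. ennreal (\<mu> powr - (\<alpha> $ i)) * (\<integral>\<^sup>+t. ennreal (exp (- \<mu> * t)) * ennreal \<bar>G i t\<bar> \<partial>lebesgue))"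
    by (intro sum.cong refl nconv_weighted_abs pos \<open>0 < \<mu>\<close> Gm)
  also have "\<dots> \<le> (\<Sum>i\<in>UNIV. ennreal (\<mu> powr - (\<alpha> $ i)) * (ennreal L * weighted_norm \<mu> a c (\<lambda>t. p t - q t)))"
  proof (intro sum_mono mult_left_mono)
    fix i
    have "(\<integral>\<^sup>+t. ennreal (exp (- \<mu> * t)) * ennreal \<bar>G i t\<bar> \<partial>lebesgue)
      \<le> (\<integral>\<^sup>+t. ennreal L * (ennreal (exp (- \<mu> * t)) * ennreal (norm (indicator {a..c} t *\<^sub>R (p t - q t)))) \<partial>lebesgue)"
    proof (rule nn_integral_mono_AE)
      show "AE t in lebesgue. ennreal (exp (- \<mu> * t)) * ennreal \<bar>G i t\<bar>
        \<le> ennreal L * (ennreal (exp (- \<mu> * t)) * ennreal (norm (indicator {a..c} t *\<^sub>R (p t - q t))))"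
        using L(2)
      proof eventually_elim
        case (elim t)
        show ?case
        proof (cases "t \<in> {a..c}")
          case True
          have "\<bar>G i t\<bar> = \<bar>(f (p t) t - f (q t) t) $ i\<bar>" using True by (simp add: G_def)
          also have "\<dots> \<le> norm (f (p t) t - f (q t) t)" by (rule component_le_norm_cart)
          also have "\<dots> \<le> L * norm (p t - q t)" using elim True by blast
          finally have "exp (- \<mu> * t) * \<bar>G i t\<bar> \<le> L * (exp (- \<mu> * t) * norm (p t - q t))"
            by (simp add: mult.left_commute)
          then show ?thesis using True L(1) by (simp add: ennreal_mult[symmetric] ennreal_leI)
        qed (simp add: G_def)
      qed
    qed
    also have "\<dots> = ennreal L * weighted_norm \<mu> a c (\<lambda>t. p t - q t)"
      unfolding weighted_norm_def by (rule nn_integral_cmult[OF weighted_norm_measurable[OF pqm]])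
    finally show "(\<integral>\<^sup>+t. ennreal (exp (- \<mu> * t)) * ennreal \<bar>G i t\<bar> \<partial>lebesgue)
      \<le> ennreal L * weighted_norm \<mu> a c (\<lambda>t. p t - q t)" .
  qed simp
  also have "\<dots> = ennreal ((\<Sum>i\<in>UNIV. \<mu> powr - (\<alpha> $ i)) * L) * weighted_norm \<mu> a c (\<lambda>t. p t - q t)"
    using L(1) by (simp add: sum_distrib_right[symmetric] sum_ennreal ennreal_mult sum_nonneg mult.assoc)
  finally show ?thesis .
qed

text \<open>All orders are positive, so every summand of the Lipschitz factor tends to 0 as \<mu>
  grows. The rate \<mu> depends on \<open>c\<close> through \<open>L\<close>; the ratio 1/2 is the
  one of \<open>geometric_L1_limit\<close>.\<close>

lemma picard_contraction:
  assumes c: "c \<in> I"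
  obtains \<mu> where "0 < \<mu>" "\<And>p q :: real \<Rightarrow> real ^ 'm. p \<in> L1_loc I \<Longrightarrow> q \<in> L1_loc I \<Longrightarrow>
    weighted_norm \<mu> a c (\<lambda>t. T p t - T q t) \<le> ennreal (1/2) * weighted_norm \<mu> a c (\<lambda>t. p t - q t)"
proof -
  obtain L where L: "0 \<le> L"
    "AE t in lebesgue. t \<in> {a..c} \<longrightarrow> (\<forall>x y. norm (f y t - f x t) \<le> L * norm (y - x))"
    using lipschitz[OF c] .
  have "((\<lambda>\<mu>. (\<Sum>i\<in>UNIV. \<mu> powr - (\<alpha> $ i)) * L) \<longlongrightarrow> (\<Sum>i\<in>(UNIV :: 'm set). 0) * L) at_top"
    using order by (intro tendsto_mult tendsto_sum tendsto_const tendsto_neg_powr filterlim_ident) auto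
  then have "eventually (\<lambda>\<mu>. (\<Sum>i\<in>UNIV. \<mu> powr - (\<alpha> $ i)) * L < 1/2) at_top"
    by (rule order_tendstoD) simp
  then have "eventually (\<lambda>\<mu>. (\<Sum>i\<in>UNIV. \<mu> powr - (\<alpha> $ i)) * L < 1/2 \<and> 0 < \<mu>) at_top"
    using eventually_gt_at_top[of 0] by eventually_elim simp
  then obtain \<mu> where \<mu>: "(\<Sum>i\<in>UNIV. \<mu> powr - (\<alpha> $ i)) * L < 1/2" "0 < \<mu>"
    by (auto simp: eventually_at_top_linorder)
  show ?thesis
  proof (rule that[OF \<mu>(2)])
    fix p q :: "real \<Rightarrow> real ^ 'm" assume pq: "p \<in> L1_loc I" "q \<in> L1_loc I"
    have "weighted_norm \<mu> a c (\<lambda>t. T p t - T q t)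
      \<le> ennreal ((\<Sum>i\<in>UNIV. \<mu> powr - (\<alpha> $ i)) * L) * weighted_norm \<mu> a c (\<lambda>t. p t - q t)"
      by (rule picard_Lipschitz[OF c L \<mu>(2) pq])
    also have "\<dots> \<le> ennreal (1/2) * weighted_norm \<mu> a c (\<lambda>t. p t - q t)"
      using \<mu>(1) by (intro mult_right_mono ennreal_leI) auto
    finally show "weighted_norm \<mu> a c (\<lambda>t. T p t - T q t) \<le> ennreal (1/2) * weighted_norm \<mu> a c (\<lambda>t. p t - q t)" .
  qed
qed

lemma fixed_point_unique:
  assumes p: "p \<in> L1_loc I" "AE t in lebesgue_on I. p t = T p t"
    and q: "q \<in> L1_loc I" "AE t in lebesgue_on I. q t = T q t"
  shows "AE t in lebesgue_on I. p t = q t"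
  unfolding AE_intervals_from_iff[OF I]
proof
  fix c assume c: "c \<in> I"
  obtain \<mu> where \<mu>: "0 < \<mu>" "\<And>p q :: real \<Rightarrow> real ^ 'm. p \<in> L1_loc I \<Longrightarrow> q \<in> L1_loc I \<Longrightarrow>
    weighted_norm \<mu> a c (\<lambda>t. T p t - T q t) \<le> ennreal (1/2) * weighted_norm \<mu> a c (\<lambda>t. p t - q t)"
    by (rule picard_contraction[OF c], rule that)
  have pq: "(\<lambda>t. p t - q t) absolutely_integrable_on {a..c}"
    using p(1) q(1) c unfolding L1_loc_iff[OF I] by (intro set_integral_diff(1)) auto
  have "AE t in lebesgue. t \<in> {a..c} \<longrightarrow> p t = T p t" "AE t in lebesgue. t \<in> {a..c} \<longrightarrow> q t = T q t"
    using p(2) q(2) c unfolding AE_intervals_from_iff[OF I] by blast+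
  then have "AE t in lebesgue. t \<in> {a..c} \<longrightarrow> p t - q t = T p t - T q t"
    by eventually_elim auto
  then have "weighted_norm \<mu> a c (\<lambda>t. p t - q t) = weighted_norm \<mu> a c (\<lambda>t. T p t - T q t)"
    by (rule weighted_norm_cong_AE)
  then have le: "weighted_norm \<mu> a c (\<lambda>t. p t - q t) \<le> ennreal (1/2) * weighted_norm \<mu> a c (\<lambda>t. p t - q t)"
    using \<mu>(2)[OF p(1) q(1)] by simp
  \<comment> \<open>A finite number that is at most half of itself is 0; the value infinity is
    excluded by integrability.\<close>
  have "weighted_norm \<mu> a c (\<lambda>t. p t - q t) = 0"
  proof (cases "weighted_norm \<mu> a c (\<lambda>t. p t - q t)")
    case (real r)
    have "r \<le> 1/2 * r" using le real by (simp add: ennreal_mult[symmetric] del: ennreal_half)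
    then show ?thesis using real by simp
  next
    case top
    then show ?thesis using weighted_norm_finite[OF pq \<mu>(1)] by simp
  qed
  from weighted_norm_eq_0_imp[OF pq this]
  show "AE t in lebesgue. t \<in> {a..c} \<longrightarrow> p t = q t" by eventually_elim auto
qed

lemma fixed_point_exists:
  obtains q where "q \<in> L1_loc I" "AE t in lebesgue_on I. q t = T q t"
proof -
  \<comment> \<open>Neither the iterates nor their pointwise limit mention \<open>c\<close>, so the
    estimates on the different compact intervals concern one and the same function.\<close>
  define Q where "Q n = (T ^^ n) (\<lambda>_. 0)" for n
  have Q0: "Q 0 = (\<lambda>_. 0)" and QS: "Q (Suc n) = T (Q n)" for n
    by (simp_all add: Q_def)
  have QL: "Q n \<in> L1_loc I" for n
  proof (induction n)
    case 0
    show ?case by (simp add: Q0 L1_loc_iff[OF I] set_integrable_def)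
  next
    case (Suc n)
    then show ?case unfolding QS by (rule rl_picard_L1_loc)
  qed
  define q where "q t = lim (\<lambda>n. Q n t)" for t
  \<comment> \<open>Contraction may be applied to \<open>q\<close> only after
    \<open>q \<in> L1_loc I\<close> is known, that is, after all \<open>c\<close> have been treated.
    The constants for each \<open>c\<close> are therefore kept for the second pass.\<close>
  have main: "q absolutely_integrable_on {a..c} \<and> (\<exists>\<mu> D. 0 < \<mu> \<and> 0 \<le> D \<and>
      (\<forall>n. weighted_norm \<mu> a c (\<lambda>t. q t - Q n t) \<le> ennreal (2 * D * (1/2) ^ n)) \<and>
      (\<forall>p q :: real \<Rightarrow> real ^ 'm. p \<in> L1_loc I \<longrightarrow> q \<in> L1_loc I \<longrightarrow>
        weighted_norm \<mu> a c (\<lambda>t. T p t - T q t) \<le> ennreal (1/2) * weighted_norm \<mu> a c (\<lambda>t. p t - q t)))"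
    if c: "c \<in> I" for c
  proof -
    obtain \<mu> where \<mu>: "0 < \<mu>" "\<And>p q :: real \<Rightarrow> real ^ 'm. p \<in> L1_loc I \<Longrightarrow> q \<in> L1_loc I \<Longrightarrow>
      weighted_norm \<mu> a c (\<lambda>t. T p t - T q t) \<le> ennreal (1/2) * weighted_norm \<mu> a c (\<lambda>t. p t - q t)"
      by (rule picard_contraction[OF c], rule that)
    have Qc: "Q n absolutely_integrable_on {a..c}" for n
      using QL c by (simp add: L1_loc_iff[OF I])
    define D where "D = enn2real (weighted_norm \<mu> a c (\<lambda>t. Q 1 t - Q 0 t))"
    have "weighted_norm \<mu> a c (\<lambda>t. Q 1 t - Q 0 t) < \<infinity>"
      by (rule weighted_norm_finite[OF set_integral_diff(1)[OF Qc Qc] \<mu>(1)])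
    then have D: "0 \<le> D" "weighted_norm \<mu> a c (\<lambda>t. Q 1 t - Q 0 t) = ennreal D"
      by (auto simp: D_def)
    have step: "weighted_norm \<mu> a c (\<lambda>t. Q (Suc n) t - Q n t) \<le> ennreal (D * (1/2) ^ n)" for n
    proof (induction n)
      case 0
      then show ?case using D by simp
    next
      case (Suc n)
      have "weighted_norm \<mu> a c (\<lambda>t. Q (Suc (Suc n)) t - Q (Suc n) t)
        \<le> ennreal (1/2) * weighted_norm \<mu> a c (\<lambda>t. Q (Suc n) t - Q n t)"
        unfolding QS[of "Suc n"] QS[of n] using \<mu>(2)[OF QL QL, of "Suc n" n] by (simp add: QS)
      also have "\<dots> \<le> ennreal (1/2) * ennreal (D * (1/2) ^ n)"
        by (intro mult_left_mono Suc) simp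
      also have "\<dots> = ennreal (D * (1/2) ^ Suc n)"
        using D(1) by (simp add: ennreal_mult[symmetric] mult_ac del: ennreal_half)
      finally show ?case .
    qed
    define u where "u n t = indicator {a..c} t *\<^sub>R Q n t" for n t
    \<comment> \<open>Moving the weight into the measure makes the weighted norm a plain L1
      norm.\<close>
    define M where "M = density lebesgue (\<lambda>t. ennreal (exp (- \<mu> * t)))"
    have um [measurable]: "u n \<in> borel_measurable lebesgue" for n
      using Qc[of n] unfolding set_integrable_def u_def by (rule borel_measurable_integrable)
    have uM: "u n \<in> borel_measurable M" for n by (simp add: M_def)
    have WM: "(\<integral>\<^sup>+t. ennreal (norm (indicator {a..c} t *\<^sub>R p t)) \<partial>M) = weighted_norm \<mu> a c p"
      if "(\<lambda>t. indicator {a..c} t *\<^sub>R p t) \<in> borel_measurable lebesgue" for p :: "real \<Rightarrow> real ^ 'm"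
      unfolding M_def weighted_norm_def
    proof (rule nn_integral_density)
      show "(\<lambda>t. ennreal (exp (- \<mu> * t))) \<in> borel_measurable lebesgue"
        by (rule borel_imp_lebesgue) measurable
      show "(\<lambda>t. ennreal (norm (indicator {a..c} t *\<^sub>R p t))) \<in> borel_measurable lebesgue"
        using measurable_compose[OF that, of "\<lambda>x. ennreal (norm x)" borel] by measurable
    qed
    have bound: "(\<integral>\<^sup>+t. ennreal (norm (u (Suc n) t - u n t)) \<partial>M) \<le> ennreal (D * (1/2) ^ n)" for n
    proof -
      have e: "u (Suc n) t - u n t = indicator {a..c} t *\<^sub>R (Q (Suc n) t - Q n t)" for t
        by (simp add: u_def scaleR_diff_right)
      have "(\<lambda>t. u (Suc n) t - u n t) \<in> borel_measurable lebesgue" by measurable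
      then show ?thesis using step[of n] WM[of "\<lambda>t. Q (Suc n) t - Q n t"] unfolding e by simp
    qed
    note limit = geometric_L1_limit[of u M D, OF uM D(1) bound]
    \<comment> \<open>Inside \<open>{a..c}\<close> both sides are the same \<open>lim\<close> term,
      even where the iterates diverge; outside, the sequence is constantly 0.\<close>
    have limu: "lim (\<lambda>n. u n t) = indicator {a..c} t *\<^sub>R q t" for t
      by (cases "t \<in> {a..c}") (auto simp: u_def q_def limI)
    have qm: "(\<lambda>t. indicator {a..c} t *\<^sub>R q t) \<in> borel_measurable lebesgue"
      unfolding limu[symmetric] by (rule borel_measurable_lim_metric) (rule um)
    have close: "weighted_norm \<mu> a c (\<lambda>t. q t - Q n t) \<le> ennreal (2 * D * (1/2) ^ n)" for n
    proof -
      have e: "lim (\<lambda>n. u n t) - u n t = indicator {a..c} t *\<^sub>R (q t - Q n t)" for t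
        unfolding limu by (simp add: u_def scaleR_diff_right)
      have "(\<lambda>t. indicator {a..c} t *\<^sub>R q t - u n t) \<in> borel_measurable lebesgue"
        using qm by measurable
      then show ?thesis using limit(2)[of n] WM[of "\<lambda>t. q t - Q n t"] unfolding e by (simp add: u_def scaleR_diff_right)
    qed
    have "weighted_norm \<mu> a c q < \<infinity>"
      using close[of 0] by (simp add: Q0) (metis ennreal_less_top le_less_trans)
    then have "q absolutely_integrable_on {a..c}"
      by (rule absolutely_integrable_weighted_norm[OF qm _ \<mu>(1)])
    then show ?thesis using \<mu> D(1) close by blast
  qed
  have qL: "q \<in> L1_loc I" using main by (simp add: L1_loc_iff[OF I])
  have "AE t in lebesgue_on I. q t = T q t"
    unfolding AE_intervals_from_iff[OF I]
  proof
    fix c assume c: "c \<in> I"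
    obtain \<mu> D where \<mu>: "0 < \<mu>" and D: "0 \<le> D"
      and close: "\<And>n. weighted_norm \<mu> a c (\<lambda>t. q t - Q n t) \<le> ennreal (2 * D * (1/2) ^ n)"
      and contr: "\<And>p q :: real \<Rightarrow> real ^ 'm. p \<in> L1_loc I \<Longrightarrow> q \<in> L1_loc I \<Longrightarrow>
        weighted_norm \<mu> a c (\<lambda>t. T p t - T q t) \<le> ennreal (1/2) * weighted_norm \<mu> a c (\<lambda>t. p t - q t)"
      using main[OF c] by blast
    have int: "p absolutely_integrable_on {a..c}" if "p \<in> L1_loc I" for p :: "real \<Rightarrow> real ^ 'm"
      using that c by (simp add: L1_loc_iff[OF I])
    note TqL = rl_picard_L1_loc[OF qL]
    have sym: "weighted_norm \<mu> a c (\<lambda>t. x t - y t) = weighted_norm \<mu> a c (\<lambda>t. y t - x t)" for x y :: "real \<Rightarrow> real ^ 'm"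
      by (simp add: weighted_norm_def norm_minus_commute)
    \<comment> \<open>\<open>Q (Suc n)\<close> is inserted between \<open>q\<close> and
      \<open>T q\<close>: it is close to \<open>q\<close> as an iterate and close to
      \<open>T q\<close> as the image of \<open>Q n\<close>. The two bounds add up to
      \<open>2 * D * (1/2) ^ n\<close>; the constant 4 leaves slack.\<close>
    have le: "weighted_norm \<mu> a c (\<lambda>t. q t - T q t) \<le> ennreal (4 * D * (1/2) ^ n)" for n
    proof -
      have "weighted_norm \<mu> a c (\<lambda>t. q t - T q t)
        \<le> weighted_norm \<mu> a c (\<lambda>t. q t - Q (Suc n) t) + weighted_norm \<mu> a c (\<lambda>t. Q (Suc n) t - T q t)"
        by (rule weighted_norm_triangle[OF int[OF qL] int[OF QL] int[OF TqL]])
      also have "\<dots> \<le> ennreal (2 * D * (1/2) ^ Suc n) + ennreal (1/2) * ennreal (2 * D * (1/2) ^ n)"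
      proof (rule add_mono)
        show "weighted_norm \<mu> a c (\<lambda>t. q t - Q (Suc n) t) \<le> ennreal (2 * D * (1/2) ^ Suc n)" by (rule close)
        have "weighted_norm \<mu> a c (\<lambda>t. Q (Suc n) t - T q t) \<le> ennreal (1/2) * weighted_norm \<mu> a c (\<lambda>t. Q n t - q t)"
          unfolding QS by (rule contr[OF QL qL])
        also have "\<dots> \<le> ennreal (1/2) * ennreal (2 * D * (1/2) ^ n)"
          using close[of n] by (intro mult_left_mono) (auto simp: sym[of "Q n"])
        finally show "weighted_norm \<mu> a c (\<lambda>t. Q (Suc n) t - T q t) \<le> ennreal (1/2) * ennreal (2 * D * (1/2) ^ n)" .
      qed
      also have "\<dots> = ennreal (2 * D * (1/2) ^ n)"
        using D by (simp add: ennreal_mult[symmetric] ennreal_plus[symmetric] del: ennreal_half ennreal_plus)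
      also have "\<dots> \<le> ennreal (4 * D * (1/2) ^ n)"
        using D by (intro ennreal_leI mult_right_mono) auto
      finally show ?thesis .
    qed
    have "(\<lambda>n. ennreal (4 * D * (1/2) ^ n)) \<longlonglongrightarrow> ennreal (4 * D * 0)"
      by (intro tendsto_ennrealI tendsto_mult tendsto_const LIMSEQ_power_zero) simp
    then have "weighted_norm \<mu> a c (\<lambda>t. q t - T q t) \<le> ennreal (4 * D * 0)"
      by (rule LIMSEQ_le_const) (use le in auto)
    then have "weighted_norm \<mu> a c (\<lambda>t. q t - T q t) = 0" by simp
    from weighted_norm_eq_0_imp[OF set_integral_diff(1)[OF int[OF qL] int[OF TqL]] this]
    show "AE t in lebesgue. t \<in> {a..c} \<longrightarrow> q t = T q t" by eventually_elim auto
  qed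
  with qL show ?thesis by (rule that)
qed

end

theorem theorem1:
  fixes a :: real and I :: "real set"
    and f :: "real ^ 'm \<Rightarrow> real \<Rightarrow> real ^ 'm"
    and qa \<alpha> :: "real ^ 'm"
  assumes "I \<in> intervals_from a"
    and "caratheodory I f"
    and "\<And>i. 0 < \<alpha> $ i \<and> \<alpha> $ i \<le> 1"
    and "(\<lambda>t. f 0 t) \<in> L1_loc I"
    and "\<And>c d. c \<le> d \<Longrightarrow> {c..d} \<subseteq> I \<Longrightarrow>
           \<exists>L\<ge>0. \<forall>x1 x2. AE t in lebesgue_on {c..d}. norm (f x2 t - f x1 t) \<le> L * norm (x2 - x1)"
  shows "\<exists>q. is_solution I a \<alpha> f qa q \<and>
           (\<forall>q'. is_solution I a \<alpha> f qa q' \<longrightarrow> (AE t in lebesgue_on I. q' t = q t))"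
proof -
  interpret rl_cauchy_problem a I f qa \<alpha>
    by unfold_locales (fact assms)+
  obtain q where q: "q \<in> L1_loc I" "AE t in lebesgue_on I. q t = rl_picard a \<alpha> qa f q t"
    by (rule fixed_point_exists)
  show ?thesis
    unfolding solution_iff_fixed_point using q fixed_point_unique by blast
qed

end
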